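(* Let $(M,\varphi,\xi,\eta,g)$ denote a three-dimensional paracontact metric manifold. (a) If $(M,\varphi,\xi,\eta,g)$ is not paraSasakian and $\xi$ is an infinitesimal harmonic transformation, then $(M,\varphi,\xi,\eta,g)$ is a paracontact $(\kappa,\mu)$-space, with $\kappa=-1$ and $\mu=-\varepsilon A/a_1$. Here, with respect to a local $\varphi$-basis $\{\xi,e,\varphi e\}$, one has $he=a_1e+a_2\varphi e$ with $a_2=\varepsilon a_1=\pm a_1$, and $A=\xi(a_1)+2\varepsilon a_1a_3$ with $a_3=g(\nabla_\xi\varphi e,e)$. (b) In particular, $(M,\varphi,\xi,\eta,g)$ is a nontrivial paracontact Ricci soliton if and only if it is a paracontact $(\kappa,\mu)$-space, with $\kappa=-1$ and $\mu=-2\varepsilon$, of scalar curvature $r=-6$ (where again $\varepsilon=\pm1$ is the sign for which $he=a_1(e+\varepsilon\varphi e)$).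
   Context: An almost paracontact structure on a connected smooth manifold $M$ of dimension $3$ is a triple $(\varphi,\xi,\eta)$ of a $(1,1)$-tensor, a global vector field and a $1$-form with $\varphi(\xi)=0$, $\eta\circ\varphi=0$, $\eta(\xi)=1$, $\varphi^2=\mathrm{Id}-\eta\otimes\xi$, and such that the $\pm1$-eigenbundles of $\varphi|_{\ker\eta}$ both have rank $1$. A pseudo-Riemannian metric $g$ is compatible if $g(\varphi X,\varphi Y)=-g(X,Y)+\eta(X)\eta(Y)$; then $(\varphi,\xi,\eta,g)$ is an almost paracontact metric structure, $\eta=g(\xi,\cdot)$, and $g$ has signature $(2,1)$. It is a paracontact metric structure if $d\eta(X,Y)=g(X,\varphi Y)$ for all $X,Y$, with the convention $d\eta(X,Y)=\frac12\big(X\eta(Y)-Y\eta(X)-\eta([X,Y])\big)$. A (local) $\varphi$-basis is a pseudo-orthonormal local frame $\{\xi,e,\varphi e\}$ with $\xi,e$ space-like unit and $\varphi e$ time-like unit. The tensor $h$ is $h=\frac12\mathcal L_\xi\varphi$. In dimension three a paracontact metric manifold is paraSasakian if and only if $h=0$. With respect to a local $\varphi$-basis, $he=a_1e+a_2\varphi e$ and $h\varphi e=-a_2e-a_1\varphi e$ for some smooth functions $a_1,a_2$; the condition $h^2=0$ is equivalent to $a_2=\varepsilon a_1=\pm a_1$. The condition $h^2=0$ holds both when $\xi$ is an infinitesimal harmonic transformation (in particular for paracontact Ricci solitons) and for paracontact $(\kappa,\mu)$-spaces with $\kappa=-1$. $\nabla$ is the Levi-Civita connection, and the curvature convention is $R(X,Y)=\nabla_{[X,Y]}-[\nabla_X,\nabla_Y]$.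 $\varrho$ is the Ricci tensor with the standard sign (positive on round spheres), and $r$ is its $g$-trace, the scalar curvature. A paracontact $(\kappa,\mu)$-space is a paracontact metric manifold satisfying $$R(X,Y)\xi=\kappa(\eta(X)Y-\eta(Y)X)+\mu(\eta(X)hY-\eta(Y)hX)$$ for all vector fields $X,Y$, where $\kappa,\mu$ are smooth functions. $\xi$ is an infinitesimal harmonic transformation if the $g$-trace of $\mathcal L_\xi\nabla$ vanishes, where $(\mathcal L_\xi\nabla)(X,Y)=\mathcal L_\xi(\nabla_XY)-\nabla_{\mathcal L_\xi X}Y-\nabla_X(\mathcal L_\xi Y)$. A paracontact Ricci soliton is a paracontact metric manifold with $\mathcal L_\xi g+\varrho=\lambda g$ for some real constant $\lambda$; it is trivial if $g$ is Einstein, nontrivial otherwise.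
   Formalization: In (a) the (κ,μ)-condition and the formula for μ are claimed only on the open set where h≠0, since it can fail where h=0; in (b) the right side also requires M not paraSasakian, and μ smooth with μ=-2ε is required only where h≠0. *)

theory Defs
  imports "HOL-Analysis.Analysis" "HOL-Library.Function_Algebras"
begin

section \<open>Real-valued functionals as a real vector space\<close>

text \<open>Tangent vectors are functionals on real functions, added and scaled pointwise.
  This instance makes \<^const>\<open>span\<close>, \<^const>\<open>independent\<close> and \<^const>\<open>dim\<close> available for them.\<close>

instantiation "fun" :: (type, real_vector) real_vector
begin

definition scaleR_fun :: "real \<Rightarrow> ('a \<Rightarrow> 'b) \<Rightarrow> 'a \<Rightarrow> 'b" where
  "scaleR_fun a f = (\<lambda>x. a *\<^sub>R f x)"

instance
  by standard (simp_all add: scaleR_fun_def fun_eq_iff algebra_simps)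

end

lemma scaleR_fun_apply [simp]: "(a *\<^sub>R f) x = a *\<^sub>R f x"
  by (simp add: scaleR_fun_def)

section \<open>Smooth manifolds\<close>

text \<open>\<open>Ck_on k S f\<close> is meant for open \<open>S\<close>: \<open>f\<close> is \<open>k\<close> times continuously differentiable.\<close>

fun Ck_on :: "nat \<Rightarrow> 'a::euclidean_space set \<Rightarrow> ('a \<Rightarrow> 'b::real_normed_vector) \<Rightarrow> bool" where
  "Ck_on 0 S f \<longleftrightarrow> continuous_on S f"
| "Ck_on (Suc k) S f \<longleftrightarrow> f differentiable_on S \<and>
     (\<forall>b\<in>Basis. Ck_on k S (\<lambda>x. frechet_derivative f (at x) b))"

definition smooth_on :: "'a::euclidean_space set \<Rightarrow> ('a \<Rightarrow> 'b::real_normed_vector) \<Rightarrow> bool" where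
  "smooth_on S f \<longleftrightarrow> (\<forall>k. Ck_on k S f)"

text \<open>A chart is a pair of its domain and its coordinate map (irrelevant off the domain).
  The manifold is the whole type \<open>'m\<close>; Hausdorff and second countable are sort constraints.\<close>

type_synonym ('m, 'e) atlas = "('m set \<times> ('m \<Rightarrow> 'e)) set"

definition smooth_atlas :: "('m::{t2_space,second_countable_topology}, 'e::euclidean_space) atlas \<Rightarrow> bool" where
  "smooth_atlas A \<longleftrightarrow>
     (\<Union>(U, c)\<in>A. U) = UNIV \<and>
     (\<forall>(U, c)\<in>A. open U \<and> open (c ` U) \<and> inj_on c U \<and>
        homeomorphism U (c ` U) c (inv_into U c)) \<and>
     (\<forall>(U, c)\<in>A. \<forall>(V, d)\<in>A. smooth_on (c ` (U \<inter> V)) (d \<circ> inv_into U c))"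

definition smooth_fun_on ::
    "('m::topological_space, 'e::euclidean_space) atlas \<Rightarrow> 'm set \<Rightarrow> ('m \<Rightarrow> real) \<Rightarrow> bool" where
  "smooth_fun_on A S f \<longleftrightarrow>
     open S \<and> (\<forall>(U, c)\<in>A. smooth_on (c ` (U \<inter> S)) (f \<circ> inv_into U c))"

definition smooth_at ::
    "('m::topological_space, 'e::euclidean_space) atlas \<Rightarrow> 'm \<Rightarrow> ('m \<Rightarrow> real) \<Rightarrow> bool" where
  "smooth_at A p f \<longleftrightarrow> (\<exists>S. p \<in> S \<and> smooth_fun_on A S f)"

section \<open>Tangent vectors and vector fields\<close>

type_synonym 'm tvec = "('m \<Rightarrow> real) \<Rightarrow> real"
type_synonym 'm vfield = "'m \<Rightarrow> 'm tvec"

text \<open>Tangent vectors at \<open>p\<close> are the derivations at \<open>p\<close> of the functions smooth near \<open>p\<close>. They are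
  given the value \<open>0\<close> on all other functions, so that equality of tangent vectors is equality of
  functionals.\<close>

definition tangent_space ::
    "('m::topological_space, 'e::euclidean_space) atlas \<Rightarrow> 'm \<Rightarrow> 'm tvec set" where
  "tangent_space A p = {v.
     (\<forall>f. \<not> smooth_at A p f \<longrightarrow> v f = 0) \<and>
     (\<forall>f g a b. smooth_at A p f \<longrightarrow> smooth_at A p g \<longrightarrow>
        v (\<lambda>x. a * f x + b * g x) = a * v f + b * v g) \<and>
     (\<forall>f g. smooth_at A p f \<longrightarrow> smooth_at A p g \<longrightarrow>
        v (\<lambda>x. f x * g x) = f p * v g + g p * v f)}"

text \<open>\<open>vector_field_on A S X\<close>: \<open>X\<close> is a smooth vector field on the open set \<open>S\<close>; its values off \<open>S\<close>
  are irrelevant. Tensorial conditions below are tested on vector fields over arbitrary open sets,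
  which is equivalent to testing on global ones.\<close>

definition vector_field_on ::
    "('m::topological_space, 'e::euclidean_space) atlas \<Rightarrow> 'm set \<Rightarrow> 'm vfield \<Rightarrow> bool" where
  "vector_field_on A S X \<longleftrightarrow>
     open S \<and> (\<forall>p\<in>S. X p \<in> tangent_space A p) \<and>
     (\<forall>W f. W \<subseteq> S \<longrightarrow> smooth_fun_on A W f \<longrightarrow> smooth_fun_on A W (\<lambda>p. X p f))"

definition bracket ::
    "('m::topological_space, 'e::euclidean_space) atlas \<Rightarrow> 'm vfield \<Rightarrow> 'm vfield \<Rightarrow> 'm vfield" where
  "bracket A X Y = (\<lambda>p f. if smooth_at A p f
     then X p (\<lambda>q. Y q f) - Y p (\<lambda>q. X q f) else 0)"

text \<open>Some smooth extension of a tangent vector to a vector field near \<open>p\<close>, used to evaluate at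
  tangent vectors a tensor that is defined on vector fields; the result does not depend on the
  choice.\<close>

definition extend_vec ::
    "('m::topological_space, 'e::euclidean_space) atlas \<Rightarrow> 'm \<Rightarrow> 'm tvec \<Rightarrow> 'm vfield" where
  "extend_vec A p v = (SOME X. X p = v \<and> (\<exists>S. p \<in> S \<and> vector_field_on A S X))"

definition linear_on_space :: "'a::real_vector set \<Rightarrow> ('a \<Rightarrow> 'b::real_vector) \<Rightarrow> bool" where
  "linear_on_space T f \<longleftrightarrow>
     (\<forall>v\<in>T. \<forall>w\<in>T. \<forall>a b. f (a *\<^sub>R v + b *\<^sub>R w) = a *\<^sub>R f v + b *\<^sub>R f w)"

section \<open>Pseudo-Riemannian geometry\<close>

type_synonym 'm metric = "'m \<Rightarrow> 'm tvec \<Rightarrow> 'm tvec \<Rightarrow> real"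
type_synonym 'm connection = "'m vfield \<Rightarrow> 'm vfield \<Rightarrow> 'm vfield"

definition pseudo_riemannian_metric ::
    "('m::topological_space, 'e::euclidean_space) atlas \<Rightarrow> 'm metric \<Rightarrow> bool" where
  "pseudo_riemannian_metric A g \<longleftrightarrow>
     (\<forall>p. \<forall>v\<in>tangent_space A p.
        linear_on_space (tangent_space A p) (g p v) \<and>
        (\<forall>w\<in>tangent_space A p. g p v w = g p w v) \<and>
        ((\<forall>w\<in>tangent_space A p. g p v w = 0) \<longrightarrow> v = 0)) \<and>
     (\<forall>S X Y. vector_field_on A S X \<longrightarrow> vector_field_on A S Y \<longrightarrow>
        smooth_fun_on A S (\<lambda>p. g p (X p) (Y p)))"

definition affine_connection ::
    "('m::topological_space, 'e::euclidean_space) atlas \<Rightarrow> 'm connection \<Rightarrow> bool" where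
  "affine_connection A D \<longleftrightarrow>
     (\<forall>S X Y. vector_field_on A S X \<longrightarrow> vector_field_on A S Y \<longrightarrow> vector_field_on A S (D X Y)) \<and>
     (\<forall>S X X' Y f. vector_field_on A S X \<longrightarrow> vector_field_on A S X' \<longrightarrow> vector_field_on A S Y \<longrightarrow>
        smooth_fun_on A S f \<longrightarrow>
        (\<forall>p\<in>S. D (\<lambda>q. X q + X' q) Y p = D X Y p + D X' Y p \<and>
               D Y (\<lambda>q. X q + X' q) p = D Y X p + D Y X' p \<and>
               D (\<lambda>q. f q *\<^sub>R X q) Y p = f p *\<^sub>R D X Y p \<and>
               D X (\<lambda>q. f q *\<^sub>R Y q) p = X p f *\<^sub>R Y p + f p *\<^sub>R D X Y p))"

definition levi_civita ::
    "('m::topological_space, 'e::euclidean_space) atlas \<Rightarrow> 'm metric \<Rightarrow> 'm connection \<Rightarrow> bool" where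
  "levi_civita A g D \<longleftrightarrow>
     affine_connection A D \<and>
     (\<forall>S X Y Z. vector_field_on A S X \<longrightarrow> vector_field_on A S Y \<longrightarrow> vector_field_on A S Z \<longrightarrow>
        (\<forall>p\<in>S. D X Y p - D Y X p = bracket A X Y p \<and>
               X p (\<lambda>q. g q (Y q) (Z q)) = g p (D X Y p) (Z p) + g p (Y p) (D X Z p)))"

text \<open>The sign convention is \<open>R(X,Y) = D\<^bsub>[X,Y]\<^esub> - [D\<^bsub>X\<^esub>, D\<^bsub>Y\<^esub>]\<close>.\<close>

definition curvature ::
    "('m::topological_space, 'e::euclidean_space) atlas \<Rightarrow> 'm connection \<Rightarrow>
     'm vfield \<Rightarrow> 'm vfield \<Rightarrow> 'm vfield \<Rightarrow> 'm vfield" where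
  "curvature A D X Y Z =
     (\<lambda>p. D (bracket A X Y) Z p - (D X (D Y Z) p - D Y (D X Z) p))"

definition orthonormal_basis ::
    "('m::topological_space, 'e::euclidean_space) atlas \<Rightarrow> 'm metric \<Rightarrow> 'm \<Rightarrow> 'm tvec set \<Rightarrow> bool" where
  "orthonormal_basis A g p B \<longleftrightarrow>
     finite B \<and> independent B \<and> span B = tangent_space A p \<and>
     (\<forall>b\<in>B. g p b b \<in> {1, -1}) \<and>
     (\<forall>b\<in>B. \<forall>b'\<in>B. b \<noteq> b' \<longrightarrow> g p b b' = 0)"

text \<open>The \<open>g\<close>-trace of a bilinear map on the tangent space; it does not depend on the choice of the
  pseudo-orthonormal basis. The values may be numbers or tangent vectors.\<close>

definition metric_trace ::
    "('m::topological_space, 'e::euclidean_space) atlas \<Rightarrow> 'm metric \<Rightarrow> 'm \<Rightarrow>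
     ('m tvec \<Rightarrow> 'm tvec \<Rightarrow> 'b::real_vector) \<Rightarrow> 'b" where
  "metric_trace A g p \<beta> =
     (let B = (SOME B. orthonormal_basis A g p B) in \<Sum>b\<in>B. g p b b *\<^sub>R \<beta> b b)"

text \<open>With the above sign of the curvature, the Ricci tensor that is positive on round spheres is
  the trace of \<open>z \<mapsto> R(x,z)y\<close>.\<close>

definition ricci ::
    "('m::topological_space, 'e::euclidean_space) atlas \<Rightarrow> 'm metric \<Rightarrow> 'm connection \<Rightarrow> 'm metric" where
  "ricci A g D p x y = metric_trace A g p
     (\<lambda>z w. g p (curvature A D (extend_vec A p x) (extend_vec A p z) (extend_vec A p y) p) w)"

definition scalar_curvature ::
    "('m::topological_space, 'e::euclidean_space) atlas \<Rightarrow> 'm metric \<Rightarrow> 'm connection \<Rightarrow> 'm \<Rightarrow> real" where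
  "scalar_curvature A g D p = metric_trace A g p (ricci A g D p)"

definition einstein ::
    "('m::topological_space, 'e::euclidean_space) atlas \<Rightarrow> 'm metric \<Rightarrow> 'm connection \<Rightarrow> bool" where
  "einstein A g D \<longleftrightarrow> (\<exists>c. \<forall>p. \<forall>x\<in>tangent_space A p. \<forall>y\<in>tangent_space A p.
     ricci A g D p x y = c * g p x y)"

definition lie_metric ::
    "('m::topological_space, 'e::euclidean_space) atlas \<Rightarrow> 'm vfield \<Rightarrow> 'm metric \<Rightarrow>
     'm vfield \<Rightarrow> 'm vfield \<Rightarrow> 'm \<Rightarrow> real" where
  "lie_metric A \<xi> g X Y p = \<xi> p (\<lambda>q. g q (X q) (Y q))
     - g p (bracket A \<xi> X p) (Y p) - g p (X p) (bracket A \<xi> Y p)"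

definition lie_connection ::
    "('m::topological_space, 'e::euclidean_space) atlas \<Rightarrow> 'm vfield \<Rightarrow> 'm connection \<Rightarrow> 'm connection" where
  "lie_connection A \<xi> D X Y =
     (\<lambda>p. bracket A \<xi> (D X Y) p - D (bracket A \<xi> X) Y p - D X (bracket A \<xi> Y) p)"

definition infinitesimal_harmonic ::
    "('m::topological_space, 'e::euclidean_space) atlas \<Rightarrow> 'm metric \<Rightarrow> 'm connection \<Rightarrow> 'm vfield \<Rightarrow> bool" where
  "infinitesimal_harmonic A g D \<xi> \<longleftrightarrow>
     (\<forall>p. metric_trace A g p
        (\<lambda>x y. lie_connection A \<xi> D (extend_vec A p x) (extend_vec A p y) p) = 0)"

section \<open>Paracontact metric structures in dimension three\<close>

type_synonym 'm endo = "'m \<Rightarrow> 'm tvec \<Rightarrow> 'm tvec"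
type_synonym 'm oneform = "'m \<Rightarrow> 'm tvec \<Rightarrow> real"

definition app :: "'m endo \<Rightarrow> 'm vfield \<Rightarrow> 'm vfield" where
  "app \<phi> X = (\<lambda>p. \<phi> p (X p))"

definition d_oneform ::
    "('m::topological_space, 'e::euclidean_space) atlas \<Rightarrow> 'm oneform \<Rightarrow> 'm vfield \<Rightarrow> 'm vfield \<Rightarrow> 'm \<Rightarrow> real" where
  "d_oneform A \<eta> X Y p =
     (X p (\<lambda>q. \<eta> q (Y q)) - Y p (\<lambda>q. \<eta> q (X q)) - \<eta> p (bracket A X Y p)) / 2"

definition almost_paracontact ::
    "('m::topological_space, real^3) atlas \<Rightarrow> 'm endo \<Rightarrow> 'm vfield \<Rightarrow> 'm oneform \<Rightarrow> bool" where
  "almost_paracontact A \<phi> \<xi> \<eta> \<longleftrightarrow>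
     vector_field_on A UNIV \<xi> \<and>
     (\<forall>p. linear_on_space (tangent_space A p) (\<phi> p) \<and>
          linear_on_space (tangent_space A p) (\<eta> p) \<and>
          \<phi> p ` tangent_space A p \<subseteq> tangent_space A p) \<and>
     (\<forall>S X. vector_field_on A S X \<longrightarrow>
        vector_field_on A S (app \<phi> X) \<and> smooth_fun_on A S (\<lambda>p. \<eta> p (X p))) \<and>
     (\<forall>p. \<phi> p (\<xi> p) = 0 \<and> \<eta> p (\<xi> p) = 1 \<and>
        (\<forall>v\<in>tangent_space A p. \<eta> p (\<phi> p v) = 0 \<and> \<phi> p (\<phi> p v) = v - \<eta> p v *\<^sub>R \<xi> p)) \<and>
     (\<forall>p. dim {v \<in> tangent_space A p. \<eta> p v = 0 \<and> \<phi> p v = v} = 1 \<and>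
          dim {v \<in> tangent_space A p. \<eta> p v = 0 \<and> \<phi> p v = - v} = 1)"

definition paracontact_metric_manifold ::
    "('m::{t2_space,second_countable_topology}, real^3) atlas \<Rightarrow> 'm endo \<Rightarrow> 'm vfield \<Rightarrow>
     'm oneform \<Rightarrow> 'm metric \<Rightarrow> bool" where
  "paracontact_metric_manifold A \<phi> \<xi> \<eta> g \<longleftrightarrow>
     smooth_atlas A \<and> connected (UNIV :: 'm set) \<and>
     almost_paracontact A \<phi> \<xi> \<eta> \<and>
     pseudo_riemannian_metric A g \<and>
     (\<forall>p. \<forall>v\<in>tangent_space A p. \<forall>w\<in>tangent_space A p.
        g p (\<phi> p v) (\<phi> p w) = - g p v w + \<eta> p v * \<eta> p w) \<and>
     (\<forall>S X Y. vector_field_on A S X \<longrightarrow> vector_field_on A S Y \<longrightarrow>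
        (\<forall>p\<in>S. d_oneform A \<eta> X Y p = g p (X p) (\<phi> p (Y p))))"

text \<open>The tensor \<open>h\<close> is half the Lie derivative of \<open>\<phi>\<close> along \<open>\<xi>\<close>.\<close>

definition h_tensor ::
    "('m::topological_space, 'e::euclidean_space) atlas \<Rightarrow> 'm endo \<Rightarrow> 'm vfield \<Rightarrow> 'm vfield \<Rightarrow> 'm vfield" where
  "h_tensor A \<phi> \<xi> X = (\<lambda>p. (1/2) *\<^sub>R (bracket A \<xi> (app \<phi> X) p - \<phi> p (bracket A \<xi> X p)))"

text \<open>The open set where \<open>h \<noteq> 0\<close>. Only there \<open>a\<^sub>1 \<noteq> 0\<close>, so that the quotient \<open>A / a\<^sub>1\<close> and the sign \<open>\<epsilon>\<close> with
  \<open>h e = a\<^sub>1 (e + \<epsilon> \<phi> e)\<close> make sense, and only there the \<open>(\<kappa>,\<mu>)\<close>-condition determines \<open>\<mu>\<close>. It is the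
  whole manifold when \<open>h\<close> vanishes nowhere. It cannot be replaced by the whole manifold in general:
  on \<open>\<real>\<^sup>3\<close> with coordinates \<open>(x,y,t)\<close> and \<open>f = t\<^sup>2/2\<close>, let \<open>\<eta> = dt - 4x dy\<close>, \<open>\<xi> = \<partial>\<^sub>t\<close>, \<open>u = \<partial>\<^sub>x\<close>,
  \<open>v = \<partial>\<^sub>y + 4x \<partial>\<^sub>t + f \<partial>\<^sub>x\<close>, \<open>\<phi> u = u\<close>, \<open>\<phi> v = - v\<close>, \<open>g(u,v) = 2\<close>. Then \<open>\<xi>\<close> is infinitesimal harmonic,
  \<open>h u = 0\<close> and \<open>h v = - t u\<close>, but \<open>R(\<xi>,v)\<xi> = - v + (1 - 2t) u\<close>, which violates every
  \<open>(\<kappa>,\<mu>)\<close>-condition at \<open>t = 0\<close>.\<close>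

definition h_support ::
    "('m::topological_space, 'e::euclidean_space) atlas \<Rightarrow> 'm endo \<Rightarrow> 'm vfield \<Rightarrow> 'm set" where
  "h_support A \<phi> \<xi> = {p. \<exists>S X. p \<in> S \<and> vector_field_on A S X \<and> h_tensor A \<phi> \<xi> X p \<noteq> 0}"

text \<open>ParaSasakian means normal: \<open>[\<phi>,\<phi>] - 2 d\<eta> \<otimes> \<xi> = 0\<close>, where \<open>[\<phi>,\<phi>]\<close> is the Nijenhuis torsion.\<close>

definition para_sasakian ::
    "('m::topological_space, 'e::euclidean_space) atlas \<Rightarrow> 'm endo \<Rightarrow> 'm vfield \<Rightarrow> 'm oneform \<Rightarrow> bool" where
  "para_sasakian A \<phi> \<xi> \<eta> \<longleftrightarrow>
     (\<forall>S X Y. vector_field_on A S X \<longrightarrow> vector_field_on A S Y \<longrightarrow>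
        (\<forall>p\<in>S. \<phi> p (\<phi> p (bracket A X Y p)) + bracket A (app \<phi> X) (app \<phi> Y) p
                - \<phi> p (bracket A (app \<phi> X) Y p) - \<phi> p (bracket A X (app \<phi> Y) p)
                - (2 * d_oneform A \<eta> X Y p) *\<^sub>R \<xi> p = 0))"

text \<open>\<open>phi_basis_on A \<phi> \<xi> g V e\<close>: the frame \<open>\<xi>, e, \<phi> e\<close> is a \<open>\<phi>\<close>-basis on the open set \<open>V\<close>.\<close>

definition phi_basis_on ::
    "('m::topological_space, real^3) atlas \<Rightarrow> 'm endo \<Rightarrow> 'm vfield \<Rightarrow> 'm metric \<Rightarrow>
     'm set \<Rightarrow> 'm vfield \<Rightarrow> bool" where
  "phi_basis_on A \<phi> \<xi> g V e \<longleftrightarrow>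
     vector_field_on A V e \<and>
     (\<forall>p\<in>V. g p (\<xi> p) (\<xi> p) = 1 \<and> g p (e p) (e p) = 1 \<and> g p (\<phi> p (e p)) (\<phi> p (e p)) = -1 \<and>
            g p (\<xi> p) (e p) = 0 \<and> g p (\<xi> p) (\<phi> p (e p)) = 0 \<and> g p (e p) (\<phi> p (e p)) = 0)"

definition kappa_mu_at ::
    "('m::topological_space, 'e::euclidean_space) atlas \<Rightarrow> 'm endo \<Rightarrow> 'm vfield \<Rightarrow> 'm oneform \<Rightarrow>
     'm connection \<Rightarrow> ('m \<Rightarrow> real) \<Rightarrow> ('m \<Rightarrow> real) \<Rightarrow> 'm \<Rightarrow> bool" where
  "kappa_mu_at A \<phi> \<xi> \<eta> D \<kappa> \<mu> p \<longleftrightarrow>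
     (\<forall>S X Y. p \<in> S \<longrightarrow> vector_field_on A S X \<longrightarrow> vector_field_on A S Y \<longrightarrow>
        curvature A D X Y \<xi> p =
          \<kappa> p *\<^sub>R (\<eta> p (X p) *\<^sub>R Y p - \<eta> p (Y p) *\<^sub>R X p) +
          \<mu> p *\<^sub>R (\<eta> p (X p) *\<^sub>R h_tensor A \<phi> \<xi> Y p - \<eta> p (Y p) *\<^sub>R h_tensor A \<phi> \<xi> X p))"

text \<open>The open submanifold \<open>W\<close> of a paracontact metric manifold is a paracontact
  \<open>(\<kappa>,\<mu>)\<close>-space; \<open>W = UNIV\<close> gives the notion for the manifold itself.\<close>

definition kappa_mu_space_on ::
    "('m::topological_space, 'e::euclidean_space) atlas \<Rightarrow> 'm endo \<Rightarrow> 'm vfield \<Rightarrow> 'm oneform \<Rightarrow>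
     'm connection \<Rightarrow> 'm set \<Rightarrow> ('m \<Rightarrow> real) \<Rightarrow> ('m \<Rightarrow> real) \<Rightarrow> bool" where
  "kappa_mu_space_on A \<phi> \<xi> \<eta> D W \<kappa> \<mu> \<longleftrightarrow>
     smooth_fun_on A W \<kappa> \<and> smooth_fun_on A W \<mu> \<and> (\<forall>p\<in>W. kappa_mu_at A \<phi> \<xi> \<eta> D \<kappa> \<mu> p)"

definition paracontact_ricci_soliton ::
    "('m::topological_space, 'e::euclidean_space) atlas \<Rightarrow> 'm vfield \<Rightarrow> 'm metric \<Rightarrow> 'm connection \<Rightarrow> bool" where
  "paracontact_ricci_soliton A \<xi> g D \<longleftrightarrow>
     (\<exists>c. \<forall>S X Y. vector_field_on A S X \<longrightarrow> vector_field_on A S Y \<longrightarrow>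
        (\<forall>p\<in>S. lie_metric A \<xi> g X Y p + ricci A g D p (X p) (Y p) = c * g p (X p) (Y p)))"

end

theory Submission
  imports Defs
begin

text \<open>Near every point there is a frame \<open>\<xi>, u, v\<close> with \<open>\<phi> u = u\<close>, \<open>\<phi> v = - v\<close>, \<open>g(u, v) = 2\<close> and \<open>u, v\<close> null.
  The structure equations give \<open>[\<xi>,u] = a u + b v\<close>, \<open>[\<xi>,v] = c u - a v\<close>, \<open>[u,v] = 4 \<xi> + m u + n v\<close>, whence
  \<open>h u = b v\<close> and \<open>h v = - c u\<close>, and the Koszul formula determines the connection and the curvature. The
  vector field \<open>\<xi>\<close> is infinitesimal harmonic iff \<open>b c = 0\<close>, \<open>u(c) = 2 n c\<close> and \<open>v(b) = - 2 m b\<close>. As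
  \<open>R(\<xi>,u)\<xi> = (- 1 - b c) u + (\<xi>(b) + 2 b - 2 a b) v\<close>, \<open>R(\<xi>,v)\<xi> = (- 1 - b c) v + (\<xi>(c) + 2 a c - 2 c) u\<close> and
  \<open>R(u,v)\<xi> = (u(c) - 2 n c) u - (v(b) + 2 m b) v\<close>, these equations give the \<open>(\<kappa>,\<mu>)\<close>-condition with
  \<open>\<kappa> = - 1\<close> wherever \<open>h \<noteq> 0\<close>, since there one of \<open>b, c\<close> vanishes identically near the point and the other
  can be divided by. On a soliton \<open>b c\<close> is constant and \<open>\<xi>(b c) = 4 b c\<close>, so \<open>b c = 0\<close>; the other components
  of the soliton equation amount to \<open>\<mu> = - 2 \<epsilon>\<close> and \<open>r = - 6\<close>.\<close>

section \<open>Smooth functions\<close>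

text \<open>A null frame is preferred to a \<phi>-basis because \<phi> is diagonal in it, its Gram
  matrix is constant and h has only two entries; the sign \<epsilon> is decided by which of them
  survives. The number 4 in [u,v] is forced by the contact condition, and the Jacobi identity makes
  the diagonal entries of ad \<xi> opposite. The three equations of harmonicity are exactly those
  parts of the (\<kappa>,\<mu>)-condition with \<kappa> = -1 in which \<mu> does not occur. The
  remaining two prescribe \<open>\<mu> * bb\<close> and \<open>- \<mu> * cc\<close> by expressions
  containing the derivatives of \<open>bb\<close> and \<open>cc\<close> along \<xi>. They are
  compatible where one function vanishes near the point, not merely at it; hence the harmonic case
  is restricted to points with h nonzero. On a soliton these derivatives vanish together with the
  functions, so zeros of h do no harm. The formal obstacle is choice: traces and the Ricci tensor
  use arbitrary orthonormal bases and arbitrary extensions of vectors. Linearity over smooth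
  functions is therefore proved for every tensor before it is evaluated on a frame.\<close>

lemma Ck_on_SucD:
  assumes "Ck_on (Suc k) S f" "open S" "x \<in> S"
  shows "(f has_derivative frechet_derivative f (at x)) (at x)"
  using assms by (metis Ck_on.simps(2) differentiable_on_def at_within_open frechet_derivative_works)

text \<open>At a point of an open set the derivative depends only on nearby values. The induction
  varies both functions because its step passes to their partial derivatives.\<close>

lemma Ck_on_cong:
  assumes "open S" "\<And>x. x \<in> S \<Longrightarrow> f x = g x" "Ck_on k S f"
  shows "Ck_on k S g"
  using assms(2,3)
proof (induction k arbitrary: f g)
  case 0
  then show ?case using continuous_on_cong by (metis Ck_on.simps(1))
next
  case (Suc k)
  have d: "(g has_derivative frechet_derivative f (at x)) (at x)" if "x \<in> S" for x
    by (rule has_derivative_transform_within_open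
        [OF Ck_on_SucD[OF Suc.prems(2) assms(1) that] assms(1) that Suc.prems(1)])
  then have "g differentiable_on S"
    unfolding differentiable_on_def by (meson differentiable_at_withinI differentiable_def)
  moreover have "Ck_on k S (\<lambda>x. frechet_derivative g (at x) b)" if "b \<in> Basis" for b
  proof (rule Suc.IH)
    show "frechet_derivative f (at x) b = frechet_derivative g (at x) b" if "x \<in> S" for x
      using frechet_derivative_at[OF d[OF that]] by simp
    show "Ck_on k S (\<lambda>x. frechet_derivative f (at x) b)" using Suc.prems(2) that by simp
  qed
  ultimately show ?case by simp
qed

text \<open>Derivatives at points of an open set are unique, so an explicit candidate
  \<open>F\<close> may replace \<open>frechet_derivative\<close>. The closure proofs below obtain
  \<open>F\<close> from differentiation rules.\<close>

lemma Ck_on_SucI: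
  assumes "open S" "\<And>x. x \<in> S \<Longrightarrow> (f has_derivative F x) (at x)"
    and "\<And>b. b \<in> Basis \<Longrightarrow> Ck_on k S (\<lambda>x. F x b)"
  shows "Ck_on (Suc k) S f"
proof -
  have "f differentiable_on S"
    unfolding differentiable_on_def using assms(2)
    by (meson differentiable_at_withinI differentiable_def)
  moreover have "Ck_on k S (\<lambda>x. frechet_derivative f (at x) b)" if "b \<in> Basis" for b
    by (rule Ck_on_cong[OF assms(1) _ assms(3)[OF that]]) (metis assms(2) frechet_derivative_at)
  ultimately show ?thesis by simp
qed

lemma Ck_on_subset:
  assumes "Ck_on k S f" "open S" "open T" "T \<subseteq> S"
  shows "Ck_on k T f"
  using assms(1)
proof (induction k arbitrary: f)
  case 0
  then show ?case using assms(4) continuous_on_subset by auto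
next
  case (Suc k)
  show ?case
  proof (rule Ck_on_SucI[OF assms(3)])
    show "(f has_derivative frechet_derivative f (at x)) (at x)" if "x \<in> T" for x
      using Ck_on_SucD[OF Suc.prems assms(2)] that assms(4) by blast
    show "Ck_on k T (\<lambda>x. frechet_derivative f (at x) b)" if "b \<in> Basis" for b
      using Suc that by simp
  qed
qed

lemma Ck_on_local:
  assumes "open S" "\<And>x. x \<in> S \<Longrightarrow> \<exists>T. open T \<and> x \<in> T \<and> Ck_on k T f"
  shows "Ck_on k S f"
  using assms(2)
proof (induction k arbitrary: f)
  case 0
  then have "continuous (at x) f" if "x \<in> S" for x
    using that by (metis Ck_on.simps(1) continuous_on_eq_continuous_at)
  then show ?case using continuous_at_imp_continuous_on by (simp add: continuous_at_imp_continuous_on)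
next
  case (Suc k)
  show ?case
  proof (rule Ck_on_SucI[OF assms(1)])
    show "(f has_derivative frechet_derivative f (at x)) (at x)" if "x \<in> S" for x
      using Ck_on_SucD Suc.prems[OF that] by blast
    show "Ck_on k S (\<lambda>x. frechet_derivative f (at x) b)" if "b \<in> Basis" for b
      using Suc that by (metis Ck_on.simps(2))
  qed
qed

text \<open>The product and chain rules contain the functions themselves next to their derivatives,
  so the order of differentiability has to be lowered.\<close>

lemma Ck_on_SucD_Ck_on:
  assumes "Ck_on (Suc k) S f" "open S"
  shows "Ck_on k S f"
  using assms(1)
proof (induction k arbitrary: f)
  case 0
  then show ?case by (simp add: differentiable_imp_continuous_on)
next
  case (Suc k)
  show ?case
  proof (rule Ck_on_SucI[OF assms(2)])
    show "(f has_derivative frechet_derivative f (at x)) (at x)" if "x \<in> S" for x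
      using Ck_on_SucD Suc.prems assms(2) that by blast
    show "Ck_on k S (\<lambda>x. frechet_derivative f (at x) b)" if "b \<in> Basis" for b
      using Suc that by (metis Ck_on.simps(2))
  qed
qed

lemma Ck_on_const: "open S \<Longrightarrow> Ck_on k S (\<lambda>x. c)"
proof (induction k arbitrary: c)
  case (Suc k)
  show ?case
    by (rule Ck_on_SucI[OF Suc(2) has_derivative_const Suc.IH[OF Suc(2)]])
qed simp

lemma Ck_on_add:
  assumes "open S" "Ck_on k S f" "Ck_on k S g"
  shows "Ck_on k S (\<lambda>x. f x + g x)"
  using assms(2,3)
proof (induction k arbitrary: f g)
  case 0
  then show ?case by (simp add: continuous_on_add)
next
  case (Suc k)
  show ?case
  proof (rule Ck_on_SucI[OF assms(1)])
    show "((\<lambda>x. f x + g x) has_derivative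
        (\<lambda>b. frechet_derivative f (at x) b + frechet_derivative g (at x) b)) (at x)" if "x \<in> S" for x
      using Ck_on_SucD[OF Suc.prems(1) assms(1) that] Ck_on_SucD[OF Suc.prems(2) assms(1) that]
      by (rule has_derivative_add)
    show "Ck_on k S (\<lambda>x. frechet_derivative f (at x) b + frechet_derivative g (at x) b)"
      if "b \<in> Basis" for b
      using Suc that by simp
  qed
qed

lemma Ck_on_mult:
  fixes f g :: "'a::euclidean_space \<Rightarrow> real"
  assumes "open S" "Ck_on k S f" "Ck_on k S g"
  shows "Ck_on k S (\<lambda>x. f x * g x)"
  using assms(2,3)
proof (induction k arbitrary: f g)
  case 0
  then show ?case by (simp add: continuous_on_mult)
next
  case (Suc k)
  show ?case
  proof (rule Ck_on_SucI[OF assms(1)])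
    show "((\<lambda>x. f x * g x) has_derivative
        (\<lambda>b. f x * frechet_derivative g (at x) b + frechet_derivative f (at x) b * g x)) (at x)"
      if "x \<in> S" for x
      using Ck_on_SucD[OF Suc.prems(1) assms(1) that] Ck_on_SucD[OF Suc.prems(2) assms(1) that]
      by (rule has_derivative_mult)
    show "Ck_on k S (\<lambda>x. f x * frechet_derivative g (at x) b + frechet_derivative f (at x) b * g x)"
      if "b \<in> Basis" for b
      by (intro Ck_on_add[OF assms(1)] Suc.IH)
        (use Suc.prems that Ck_on_SucD_Ck_on[OF _ assms(1)] in auto)
  qed
qed

lemma Ck_on_sum:
  assumes "open S" "\<And>i. i \<in> I \<Longrightarrow> Ck_on k S (f i)"
  shows "Ck_on k S (\<lambda>x. \<Sum>i\<in>I. f i x)"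
  using assms(2)
  by (induction I rule: infinite_finite_induct) (simp_all add: Ck_on_const Ck_on_add assms(1))

text \<open>The derivative of \<open>1 / f\<close> contains \<open>1 / f\<close> again, so the
  induction stays with one fixed \<open>f\<close>.\<close>

lemma Ck_on_inverse:
  fixes f :: "'a::euclidean_space \<Rightarrow> real"
  assumes "open S" "Ck_on k S f" "\<And>x. x \<in> S \<Longrightarrow> f x \<noteq> 0"
  shows "Ck_on k S (\<lambda>x. inverse (f x))"
  using assms(2)
proof (induction k)
  case 0
  then show ?case using assms(3) by (simp add: continuous_on_inverse)
next
  case (Suc k)
  show ?case
  proof (rule Ck_on_SucI[OF assms(1)])
    show "((\<lambda>x. inverse (f x)) has_derivative
        (\<lambda>b. (-1) * (inverse (f x) * frechet_derivative f (at x) b * inverse (f x)))) (at x)"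
      if "x \<in> S" for x
      using Deriv.has_derivative_inverse[OF assms(3)[OF that] Ck_on_SucD[OF Suc.prems(1) assms(1) that]]
      by simp
    have "Ck_on k S f" using Suc.prems assms(1) Ck_on_SucD_Ck_on by blast
    then show "Ck_on k S (\<lambda>x. (-1) * (inverse (f x) * frechet_derivative f (at x) b * inverse (f x)))"
      if "b \<in> Basis" for b
      by (intro Ck_on_mult[OF assms(1)] Ck_on_const assms(1) Suc.IH)
        (use Suc.prems that in auto)
  qed
qed

lemma Ck_on_inner:
  fixes f :: "'a::euclidean_space \<Rightarrow> 'b::euclidean_space"
  assumes "open S" "Ck_on k S f"
  shows "Ck_on k S (\<lambda>x. f x \<bullet> j)"
  using assms(2)
proof (induction k arbitrary: f)
  case 0
  then show ?case by (simp add: continuous_on_inner)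
next
  case (Suc k)
  show ?case
  proof (rule Ck_on_SucI[OF assms(1)])
    show "((\<lambda>x. f x \<bullet> j) has_derivative (\<lambda>b. frechet_derivative f (at x) b \<bullet> j)) (at x)"
      if "x \<in> S" for x
      using Ck_on_SucD[OF Suc.prems(1) assms(1) that] by (rule has_derivative_inner_left)
    show "Ck_on k S (\<lambda>x. frechet_derivative f (at x) b \<bullet> j)" if "b \<in> Basis" for b
      using Suc that by simp
  qed
qed

lemma Ck_on_compose:
  fixes f :: "'b::euclidean_space \<Rightarrow> real" and G :: "'a::euclidean_space \<Rightarrow> 'b"
  assumes "open S" "open T" "Ck_on k T f" "Ck_on k S G" "G ` S \<subseteq> T"
  shows "Ck_on k S (\<lambda>x. f (G x))"
  using assms(3,4)
proof (induction k arbitrary: f)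
  case 0
  then show ?case using assms(5) by (auto intro: continuous_on_compose2)
next
  case (Suc k)
  show ?case
  proof (rule Ck_on_SucI[OF assms(1)])
    fix x assume x: "x \<in> S"
    then have Gx: "G x \<in> T" using assms(5) by auto
    note f' = Ck_on_SucD[OF Suc.prems(1) assms(2) Gx]
    have d: "((\<lambda>x. f (G x)) has_derivative
       (\<lambda>b. frechet_derivative f (at (G x)) (frechet_derivative G (at x) b))) (at x)"
      using has_derivative_compose[OF Ck_on_SucD[OF Suc.prems(2) assms(1) x] f'] .
    \<comment> \<open>Expanding the argument in the basis turns the chain rule into a sum of
      products, and the induction hypothesis applies to the partial derivatives of
      \<open>f\<close>.\<close>
    have eq: "frechet_derivative f (at (G x)) w
       = (\<Sum>j\<in>Basis. frechet_derivative f (at (G x)) j * (w \<bullet> j))" for w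
    proof -
      have l: "linear (frechet_derivative f (at (G x)))"
        using f' has_derivative_linear by blast
      have "frechet_derivative f (at (G x)) w
         = frechet_derivative f (at (G x)) (\<Sum>j\<in>Basis. (w \<bullet> j) *\<^sub>R j)"
        by (simp add: euclidean_representation)
      then show ?thesis
        by (simp add: linear_sum[OF l] linear_scale[OF l] mult.commute)
    qed
    show "((\<lambda>x. f (G x)) has_derivative
       (\<lambda>b. \<Sum>j\<in>Basis. frechet_derivative f (at (G x)) j * (frechet_derivative G (at x) b \<bullet> j))) (at x)"
      by (rule has_derivative_eq_rhs[OF d]) (rule ext, rule eq)
  next
    fix b :: 'a assume b: "b \<in> Basis"
    show "Ck_on k S (\<lambda>x. \<Sum>j\<in>Basis. frechet_derivative f (at (G x)) j * (frechet_derivative G (at x) b \<bullet> j))"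
      by (intro Ck_on_sum Ck_on_mult Ck_on_inner assms(1) Suc.IH)
        (use Suc.prems b Ck_on_SucD_Ck_on[OF _ assms(1)] in auto)
  qed
qed

section \<open>Smooth functions on a manifold, read in charts\<close>

locale smooth_manifold =
  fixes A :: "('m::{t2_space,second_countable_topology}, 'e::euclidean_space) atlas"
  assumes smooth_atlas: "smooth_atlas A"
begin

lemma chartD:
  assumes "(U, c) \<in> A"
  shows "open U" "open (c ` U)" "inj_on c U" "homeomorphism U (c ` U) c (inv_into U c)"
  using smooth_atlas assms unfolding smooth_atlas_def by fast+

lemma chart_transition:
  assumes "(U, c) \<in> A" "(V, d) \<in> A"
  shows "smooth_on (c ` (U \<inter> V)) (d \<circ> inv_into U c)"
  using smooth_atlas assms unfolding smooth_atlas_def by fast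

lemma chart_at:
  obtains U c where "(U, c) \<in> A" "p \<in> U"
proof -
  have "p \<in> (\<Union>(U, c)\<in>A. U)" using smooth_atlas by (simp add: smooth_atlas_def)
  then show ?thesis using that by auto
qed

lemma inv_chart: "(U, c) \<in> A \<Longrightarrow> q \<in> U \<Longrightarrow> inv_into U c (c q) = q"
  using chartD(3) inv_into_f_f by metis

lemma open_chart_image:
  assumes "(U, c) \<in> A" "open W"
  shows "open (c ` (U \<inter> W))"
proof -
  have "openin (top_of_set (c ` U)) (c ` (U \<inter> W))"
    using homeomorphism_imp_open_map[OF chartD(4)[OF assms(1)]] assms(2) by (simp add: openin_open_Int)
  then show ?thesis using chartD(2)[OF assms(1)] openin_open_trans by blast
qed

lemma smooth_fun_on_iff:
  "smooth_fun_on A S f \<longleftrightarrow>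
     open S \<and> (\<forall>U c k. (U, c) \<in> A \<longrightarrow> Ck_on k (c ` (U \<inter> S)) (f \<circ> inv_into U c))"
  unfolding smooth_fun_on_def smooth_on_def by fast

lemma smooth_fun_onI:
  assumes "open S" "\<And>U c k. (U, c) \<in> A \<Longrightarrow> Ck_on k (c ` (U \<inter> S)) (f \<circ> inv_into U c)"
  shows "smooth_fun_on A S f"
  using assms by (simp add: smooth_fun_on_iff)

lemma smooth_fun_onD:
  assumes "smooth_fun_on A S f" "(U, c) \<in> A"
  shows "Ck_on k (c ` (U \<inter> S)) (f \<circ> inv_into U c)"
  using assms by (simp add: smooth_fun_on_iff)

lemma smooth_fun_on_open: "smooth_fun_on A S f \<Longrightarrow> open S"
  by (simp add: smooth_fun_on_iff)

lemma smooth_fun_on_cong: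
  assumes "smooth_fun_on A S f" "\<And>q. q \<in> S \<Longrightarrow> f q = g q"
  shows "smooth_fun_on A S g"
proof (rule smooth_fun_onI)
  fix U c k assume c: "(U, c) \<in> A"
  show "Ck_on k (c ` (U \<inter> S)) (g \<circ> inv_into U c)"
    by (rule Ck_on_cong[OF open_chart_image[OF c smooth_fun_on_open[OF assms(1)]] _ smooth_fun_onD[OF assms(1) c]])
      (auto simp: inv_chart[OF c] assms(2))
qed (use assms smooth_fun_on_open in blast)

lemma smooth_fun_on_subset:
  assumes "smooth_fun_on A S f" "open T" "T \<subseteq> S"
  shows "smooth_fun_on A T f"
proof (rule smooth_fun_onI)
  fix U c k assume c: "(U, c) \<in> A"
  show "Ck_on k (c ` (U \<inter> T)) (f \<circ> inv_into U c)"
    by (rule Ck_on_subset[OF smooth_fun_onD[OF assms(1) c]])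
     (use assms open_chart_image[OF c] smooth_fun_on_open in blast)+
qed (fact assms)

lemma smooth_fun_on_local:
  assumes "open S" "\<And>q. q \<in> S \<Longrightarrow> \<exists>T. q \<in> T \<and> smooth_fun_on A T f"
  shows "smooth_fun_on A S f"
proof (rule smooth_fun_onI)
  fix U c k assume c: "(U, c) \<in> A"
  show "Ck_on k (c ` (U \<inter> S)) (f \<circ> inv_into U c)"
  proof (rule Ck_on_local[OF open_chart_image[OF c assms(1)]])
    fix x assume "x \<in> c ` (U \<inter> S)"
    then obtain q where q: "q \<in> U" "q \<in> S" "x = c q" by auto
    then obtain T where T: "q \<in> T" "smooth_fun_on A T f" using assms(2) by blast
    then show "\<exists>T. open T \<and> x \<in> T \<and> Ck_on k T (f \<circ> inv_into U c)"
      using q open_chart_image[OF c smooth_fun_on_open] smooth_fun_onD[OF T(2) c]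
      by (intro exI[of _ "c ` (U \<inter> T)"]) auto
  qed
qed (fact assms)

lemma smooth_fun_on_const: "open S \<Longrightarrow> smooth_fun_on A S (\<lambda>q. r)"
  by (rule smooth_fun_onI) (simp_all add: comp_def Ck_on_const open_chart_image)

lemma smooth_fun_on_add:
  assumes "smooth_fun_on A S f" "smooth_fun_on A S g"
  shows "smooth_fun_on A S (\<lambda>q. f q + g q)"
proof (rule smooth_fun_onI)
  show S: "open S" using assms smooth_fun_on_open by blast
  show "Ck_on k (c ` (U \<inter> S)) ((\<lambda>q. f q + g q) \<circ> inv_into U c)" if "(U, c) \<in> A" for U c k
    using Ck_on_add[OF open_chart_image[OF that S] smooth_fun_onD[OF assms(1) that]
        smooth_fun_onD[OF assms(2) that]] by (simp add: comp_def)
qed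

lemma smooth_fun_on_mult:
  assumes "smooth_fun_on A S f" "smooth_fun_on A S g"
  shows "smooth_fun_on A S (\<lambda>q. f q * g q)"
proof (rule smooth_fun_onI)
  show S: "open S" using assms smooth_fun_on_open by blast
  show "Ck_on k (c ` (U \<inter> S)) ((\<lambda>q. f q * g q) \<circ> inv_into U c)" if "(U, c) \<in> A" for U c k
    using Ck_on_mult[OF open_chart_image[OF that S] smooth_fun_onD[OF assms(1) that]
        smooth_fun_onD[OF assms(2) that]] by (simp add: comp_def)
qed

lemma smooth_fun_on_cmult:
  assumes "smooth_fun_on A S f"
  shows "smooth_fun_on A S (\<lambda>q. r * f q)"
  using smooth_fun_on_mult[OF smooth_fun_on_const assms] smooth_fun_on_open[OF assms] by simp

lemma smooth_fun_on_minus: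
  assumes "smooth_fun_on A S f"
  shows "smooth_fun_on A S (\<lambda>q. - f q)"
  using smooth_fun_on_cmult[OF assms, of "-1"] by simp

lemma smooth_fun_on_diff:
  assumes "smooth_fun_on A S f" "smooth_fun_on A S g"
  shows "smooth_fun_on A S (\<lambda>q. f q - g q)"
  using smooth_fun_on_add[OF assms(1) smooth_fun_on_minus[OF assms(2)]] by simp

lemma smooth_fun_on_inverse:
  assumes "smooth_fun_on A S f" "\<And>q. q \<in> S \<Longrightarrow> f q \<noteq> 0"
  shows "smooth_fun_on A S (\<lambda>q. inverse (f q))"
proof (rule smooth_fun_onI)
  show S: "open S" using assms smooth_fun_on_open by blast
  show "Ck_on k (c ` (U \<inter> S)) ((\<lambda>q. inverse (f q)) \<circ> inv_into U c)" if "(U, c) \<in> A" for U c k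
    unfolding comp_def
    by (rule Ck_on_inverse[OF open_chart_image[OF that S]
          smooth_fun_onD[OF assms(1) that, unfolded comp_def]])
      (auto simp: inv_chart[OF that] assms(2))
qed

lemma smooth_fun_on_divide:
  assumes "smooth_fun_on A S f" "smooth_fun_on A S g" "\<And>q. q \<in> S \<Longrightarrow> g q \<noteq> 0"
  shows "smooth_fun_on A S (\<lambda>q. f q / g q)"
  using smooth_fun_on_mult[OF assms(1) smooth_fun_on_inverse[OF assms(2,3)]]
  by (simp add: divide_inverse)

lemmas smooth_intros = smooth_fun_on_add smooth_fun_on_cmult smooth_fun_on_mult smooth_fun_on_minus
  smooth_fun_on_diff smooth_fun_on_const

lemma smooth_fun_on_imp_continuous_on:
  assumes "smooth_fun_on A S f"
  shows "continuous_on S f"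
proof -
  have S: "open S" using assms smooth_fun_on_open by blast
  have "continuous (at p) f" if "p \<in> S" for p
  proof -
    obtain U c where c: "(U, c) \<in> A" "p \<in> U" by (rule chart_at)
    have "continuous_on (c ` (U \<inter> S)) (f \<circ> inv_into U c)"
      using smooth_fun_onD[OF assms c(1), of 0] by simp
    moreover have "continuous_on (U \<inter> S) c"
      using chartD(4)[OF c(1)] homeomorphism_cont1 continuous_on_subset inf_le1 by metis
    ultimately have "continuous_on (U \<inter> S) (\<lambda>q. (f \<circ> inv_into U c) (c q))"
      by (rule continuous_on_compose2) simp
    then have "continuous_on (U \<inter> S) f"
      by (rule continuous_on_cong[THEN iffD1, rotated -1]) (simp_all add: inv_chart[OF c(1)])
    then show ?thesis
      using continuous_on_eq_continuous_at[of "U \<inter> S" f] chartD(1)[OF c(1)] S c(2) that by auto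
  qed
  then show ?thesis by (simp add: continuous_at_imp_continuous_on)
qed

text \<open>Supplies the open domains on which a smooth function may be divided by.\<close>

lemma open_nonzero:
  assumes "smooth_fun_on A S f"
  shows "open {q \<in> S. f q \<noteq> 0}"
proof -
  have "open (f -` (- {0}) \<inter> S)"
    using smooth_fun_on_imp_continuous_on[OF assms] smooth_fun_on_open[OF assms]
    by (metis continuous_on_open_vimage open_Compl closed_singleton)
  moreover have "f -` (- {0}) \<inter> S = {q \<in> S. f q \<noteq> 0}" by auto
  ultimately show ?thesis by simp
qed

lemma smooth_atI: "smooth_fun_on A S f \<Longrightarrow> p \<in> S \<Longrightarrow> smooth_at A p f"
  unfolding smooth_at_def by blast

lemma smooth_atE:
  assumes "smooth_at A p f"
  obtains S where "p \<in> S" "smooth_fun_on A S f"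
  using assms unfolding smooth_at_def by blast

lemma smooth_at_cong:
  assumes "open W" "p \<in> W" "\<And>q. q \<in> W \<Longrightarrow> f q = g q"
  shows "smooth_at A p f \<longleftrightarrow> smooth_at A p g"
proof -
  have *: "smooth_at A p k" if h: "smooth_at A p h" and hk: "\<And>q. q \<in> W \<Longrightarrow> h q = k q" for h k
  proof -
    obtain S where S: "p \<in> S" "smooth_fun_on A S h" using h by (rule smooth_atE)
    have "smooth_fun_on A (S \<inter> W) h"
      using S assms(1) by (intro smooth_fun_on_subset[OF S(2)]) (auto simp: smooth_fun_on_open)
    then have "smooth_fun_on A (S \<inter> W) k"
      by (rule smooth_fun_on_cong) (use hk in auto)
    then show ?thesis using S assms(2) smooth_atI by blast
  qed
  show ?thesis using *[of f g] *[of g f] assms(3) by metis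
qed

lemma smooth_at_add:
  assumes "smooth_at A p f" "smooth_at A p g" shows "smooth_at A p (\<lambda>q. f q + g q)"
proof -
  obtain S where S: "p \<in> S" "smooth_fun_on A S f" using assms(1) by (rule smooth_atE)
  obtain T where T: "p \<in> T" "smooth_fun_on A T g" using assms(2) by (rule smooth_atE)
  have o: "open (S \<inter> T)" using S T smooth_fun_on_open by blast
  show ?thesis
    using smooth_fun_on_add[OF smooth_fun_on_subset[OF S(2) o] smooth_fun_on_subset[OF T(2) o]]
      S T by (auto intro: smooth_atI)
qed

lemma smooth_at_mult:
  assumes "smooth_at A p f" "smooth_at A p g" shows "smooth_at A p (\<lambda>q. f q * g q)"
proof -
  obtain S where S: "p \<in> S" "smooth_fun_on A S f" using assms(1) by (rule smooth_atE)
  obtain T where T: "p \<in> T" "smooth_fun_on A T g" using assms(2) by (rule smooth_atE)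
  have o: "open (S \<inter> T)" using S T smooth_fun_on_open by blast
  show ?thesis
    using smooth_fun_on_mult[OF smooth_fun_on_subset[OF S(2) o] smooth_fun_on_subset[OF T(2) o]]
      S T by (auto intro: smooth_atI)
qed

lemma smooth_at_const: "smooth_at A p (\<lambda>q. r)"
  using smooth_fun_on_const[OF open_UNIV] smooth_atI by blast

section \<open>Tangent vectors and vector fields\<close>

lemma tangent_nonsmooth: "v \<in> tangent_space A p \<Longrightarrow> \<not> smooth_at A p f \<Longrightarrow> v f = 0"
  unfolding tangent_space_def by blast

lemma tangent_lin:
  "v \<in> tangent_space A p \<Longrightarrow> smooth_at A p f \<Longrightarrow> smooth_at A p g \<Longrightarrow>
     v (\<lambda>x. a * f x + b * g x) = a * v f + b * v g"
  unfolding tangent_space_def by blast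

lemma tangent_mult:
  "v \<in> tangent_space A p \<Longrightarrow> smooth_at A p f \<Longrightarrow> smooth_at A p g \<Longrightarrow>
     v (\<lambda>x. f x * g x) = f p * v g + g p * v f"
  unfolding tangent_space_def by blast

lemma tangent_add:
  "v \<in> tangent_space A p \<Longrightarrow> smooth_at A p f \<Longrightarrow> smooth_at A p g \<Longrightarrow>
     v (\<lambda>x. f x + g x) = v f + v g"
  using tangent_lin[of v p f g 1 1] by simp

lemma tangent_diff:
  "v \<in> tangent_space A p \<Longrightarrow> smooth_at A p f \<Longrightarrow> smooth_at A p g \<Longrightarrow>
     v (\<lambda>x. f x - g x) = v f - v g"
  using tangent_lin[of v p f g 1 "-1"] by simp

lemma tangent_cmult:
  "v \<in> tangent_space A p \<Longrightarrow> smooth_at A p f \<Longrightarrow> v (\<lambda>x. a * f x) = a * v f"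
  using tangent_lin[of v p f f a 0] by simp

lemma tangent_minus:
  "v \<in> tangent_space A p \<Longrightarrow> smooth_at A p f \<Longrightarrow> v (\<lambda>x. - f x) = - v f"
  using tangent_lin[of v p f f "-1" 0] by simp

lemma tangent_const: "v \<in> tangent_space A p \<Longrightarrow> v (\<lambda>x. r) = 0"
proof -
  assume v: "v \<in> tangent_space A p"
  have "v (\<lambda>x. 1) = 0"
    using tangent_mult[OF v smooth_at_const smooth_at_const, of 1 1] by simp
  then show ?thesis using tangent_cmult[OF v smooth_at_const, of r 1] by simp
qed

text \<open>The indicator of an open set is smooth on that set, so no bump functions are needed for
  the locality of derivations, nor for that of tensors and connections.\<close>

lemma tangent_cong:
  assumes v: "v \<in> tangent_space A p" and W: "open W" "p \<in> W" "\<And>q. q \<in> W \<Longrightarrow> f q = g q"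
  shows "v f = v g"
proof (cases "smooth_at A p f")
  case False
  then show ?thesis using tangent_nonsmooth[OF v] smooth_at_cong[of W p f g] W by metis
next
  case True
  then have g: "smooth_at A p g" using smooth_at_cong[of W p f g] W by metis
  define k where "k q = (if q \<in> W then 1 else 0 :: real)" for q
  have k: "smooth_at A p k"
    using smooth_at_cong[of W p k "\<lambda>_. 1"] W smooth_at_const[of p 1] by (simp add: k_def)
  have "(\<lambda>q. k q * f q) = (\<lambda>q. k q * g q)" using W(3) by (auto simp: k_def)
  then have "v (\<lambda>q. k q * f q) = v (\<lambda>q. k q * g q)" by simp
  then show ?thesis
    using tangent_mult[OF v k True] tangent_mult[OF v k g] W by (simp add: k_def)
qed

lemma subspace_tangent: "subspace (tangent_space A p)"
  unfolding subspace_def tangent_space_def by (auto simp: algebra_simps)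

lemma tangent_zero [simp]: "0 \<in> tangent_space A p"
  and tangent_plus [simp]: "v \<in> tangent_space A p \<Longrightarrow> w \<in> tangent_space A p \<Longrightarrow> v + w \<in> tangent_space A p"
  and tangent_scaleR [simp]: "v \<in> tangent_space A p \<Longrightarrow> a *\<^sub>R v \<in> tangent_space A p"
  and tangent_uminus [simp]: "v \<in> tangent_space A p \<Longrightarrow> - v \<in> tangent_space A p"
  and tangent_minus_vec [simp]: "v \<in> tangent_space A p \<Longrightarrow> w \<in> tangent_space A p \<Longrightarrow> v - w \<in> tangent_space A p"
  by (simp_all add: subspace_tangent subspace_0 subspace_add subspace_scale subspace_neg subspace_diff)

lemma vector_field_onI:
  assumes "open S" "\<And>p. p \<in> S \<Longrightarrow> X p \<in> tangent_space A p"
    and "\<And>W f. W \<subseteq> S \<Longrightarrow> smooth_fun_on A W f \<Longrightarrow> smooth_fun_on A W (\<lambda>p. X p f)"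
  shows "vector_field_on A S X"
  using assms unfolding vector_field_on_def by blast

lemma vf_open: "vector_field_on A S X \<Longrightarrow> open S"
  and vf_tangent: "vector_field_on A S X \<Longrightarrow> p \<in> S \<Longrightarrow> X p \<in> tangent_space A p"
  unfolding vector_field_on_def by blast+

lemma vf_smooth:
  assumes "vector_field_on A S X" "smooth_fun_on A W f" "W \<subseteq> S"
  shows "smooth_fun_on A W (\<lambda>p. X p f)"
  using assms unfolding vector_field_on_def by blast

lemma vf_smooth_at:
  assumes "vector_field_on A S X" "smooth_at A p f" "p \<in> S"
  shows "smooth_at A p (\<lambda>p. X p f)"
proof -
  obtain T where T: "p \<in> T" "smooth_fun_on A T f" using assms(2) by (rule smooth_atE)
  have "open (S \<inter> T)" using T assms(1) smooth_fun_on_open vf_open by blast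
  then have "smooth_fun_on A (S \<inter> T) (\<lambda>p. X p f)"
    using smooth_fun_on_subset[OF T(2)] by (intro vf_smooth[OF assms(1)]) auto
  then show ?thesis using T assms(3) smooth_atI by blast
qed

lemma vf_subset:
  assumes "vector_field_on A S X" "open T" "T \<subseteq> S"
  shows "vector_field_on A T X"
  using assms unfolding vector_field_on_def by blast

lemma vf_zero: "open S \<Longrightarrow> vector_field_on A S (\<lambda>q. 0)"
  by (rule vector_field_onI) (auto intro: smooth_fun_on_const smooth_fun_on_open)

lemma vf_add:
  assumes "vector_field_on A S X" "vector_field_on A S Y"
  shows "vector_field_on A S (\<lambda>q. X q + Y q)"
  by (rule vector_field_onI)
    (auto intro: vf_open[OF assms(1)] tangent_plus vf_tangent[OF assms(1)] vf_tangent[OF assms(2)]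
      smooth_fun_on_add vf_smooth[OF assms(1)] vf_smooth[OF assms(2)])

lemma vf_scale:
  assumes "vector_field_on A S X" "smooth_fun_on A S f"
  shows "vector_field_on A S (\<lambda>q. f q *\<^sub>R X q)"
proof (rule vector_field_onI)
  fix W h assume W: "W \<subseteq> S" "smooth_fun_on A W h"
  have "smooth_fun_on A W f" using smooth_fun_on_subset[OF assms(2) smooth_fun_on_open W(1)] W by blast
  then show "smooth_fun_on A W (\<lambda>p. (f p *\<^sub>R X p) h)"
    using smooth_fun_on_mult vf_smooth[OF assms(1) W(2,1)] by simp
qed (auto intro: vf_open[OF assms(1)] tangent_scaleR vf_tangent[OF assms(1)])

lemma vf_cscale:
  assumes "vector_field_on A S X"
  shows "vector_field_on A S (\<lambda>q. r *\<^sub>R X q)"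
  using vf_scale[OF assms smooth_fun_on_const] vf_open[OF assms] by simp

lemma vf_minus:
  assumes "vector_field_on A S X"
  shows "vector_field_on A S (\<lambda>q. - X q)"
  using vf_cscale[OF assms, of "-1"] by simp

lemma vf_diff:
  assumes "vector_field_on A S X" "vector_field_on A S Y"
  shows "vector_field_on A S (\<lambda>q. X q - Y q)"
  using vf_add[OF assms(1) vf_minus[OF assms(2)]] by simp

lemma bracket_apply: "smooth_at A p f \<Longrightarrow> bracket A X Y p f = X p (\<lambda>q. Y q f) - Y p (\<lambda>q. X q f)"
  by (simp add: bracket_def)

lemma vf_bracket:
  assumes X: "vector_field_on A S X" and Y: "vector_field_on A S Y"
  shows "vector_field_on A S (bracket A X Y)"
proof (rule vector_field_onI)
  show "open S" using X vf_open by blast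
next
  fix p assume p: "p \<in> S"
  note Xp = vf_tangent[OF X p] and Yp = vf_tangent[OF Y p]
  note sX = vf_smooth_at[OF X _ p] and sY = vf_smooth_at[OF Y _ p]
  show "bracket A X Y p \<in> tangent_space A p"
    unfolding tangent_space_def
  proof (intro CollectI conjI allI impI)
    fix f assume "\<not> smooth_at A p f"
    then show "bracket A X Y p f = 0" by (simp add: bracket_def)
  next
    fix f g a b assume f: "smooth_at A p f" and g: "smooth_at A p g"
    have fg: "smooth_at A p (\<lambda>x. a * f x + b * g x)"
      by (intro smooth_at_add smooth_at_mult smooth_at_const f g)
    obtain T where T: "p \<in> T" "smooth_fun_on A T f" using f by (rule smooth_atE)
    obtain T' where T': "p \<in> T'" "smooth_fun_on A T' g" using g by (rule smooth_atE)
    have o: "open (S \<inter> T \<inter> T')" using T T' smooth_fun_on_open X vf_open by blast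
    \<comment> \<open>Linearity of \<open>Z q\<close> is available only at points \<open>q\<close>
      near \<open>p\<close>, where both functions are smooth; locality of \<open>v\<close> permits
      the substitution.\<close>
    have *: "v (\<lambda>q. Z q (\<lambda>x. a * f x + b * g x)) = a * v (\<lambda>q. Z q f) + b * v (\<lambda>q. Z q g)"
      if v: "v \<in> tangent_space A p" and Z: "vector_field_on A S Z" for v Z
    proof -
      have "v (\<lambda>q. Z q (\<lambda>x. a * f x + b * g x)) = v (\<lambda>q. a * Z q f + b * Z q g)"
        by (rule tangent_cong[OF v o])
          (use p T T' in \<open>auto intro!: tangent_lin vf_tangent[OF Z] smooth_atI[OF T(2)] smooth_atI[OF T'(2)]\<close>)
      also have "\<dots> = a * v (\<lambda>q. Z q f) + b * v (\<lambda>q. Z q g)"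
        by (intro tangent_lin[OF v] vf_smooth_at[OF Z _ p] f g)
      finally show ?thesis .
    qed
    show "bracket A X Y p (\<lambda>x. a * f x + b * g x) = a * bracket A X Y p f + b * bracket A X Y p g"
      by (simp add: bracket_apply f g fg *[OF Xp Y] *[OF Yp X] algebra_simps)
  next
    fix f g assume f: "smooth_at A p f" and g: "smooth_at A p g"
    have fg: "smooth_at A p (\<lambda>x. f x * g x)" by (intro smooth_at_mult f g)
    obtain T where T: "p \<in> T" "smooth_fun_on A T f" using f by (rule smooth_atE)
    obtain T' where T': "p \<in> T'" "smooth_fun_on A T' g" using g by (rule smooth_atE)
    have o: "open (S \<inter> T \<inter> T')" using T T' smooth_fun_on_open X vf_open by blast
    \<comment> \<open>The mixed terms \<open>Z p g * v f + Z p f * v g\<close> are symmetric in the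
      two fields and cancel in the commutator.\<close>
    have *: "v (\<lambda>q. Z q (\<lambda>x. f x * g x)) =
       f p * v (\<lambda>q. Z q g) + Z p g * v f + (g p * v (\<lambda>q. Z q f) + Z p f * v g)"
      if v: "v \<in> tangent_space A p" and Z: "vector_field_on A S Z" for v Z
    proof -
      have "v (\<lambda>q. Z q (\<lambda>x. f x * g x)) = v (\<lambda>q. f q * Z q g + g q * Z q f)"
        by (rule tangent_cong[OF v o])
          (use p T T' in \<open>auto intro!: tangent_mult vf_tangent[OF Z] smooth_atI[OF T(2)] smooth_atI[OF T'(2)]\<close>)
      also have "\<dots> = v (\<lambda>q. f q * Z q g) + v (\<lambda>q. g q * Z q f)"
        by (intro tangent_add[OF v] smooth_at_mult vf_smooth_at[OF Z _ p] f g)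
      finally show ?thesis by (simp add: tangent_mult[OF v] vf_smooth_at[OF Z _ p] f g)
    qed
    show "bracket A X Y p (\<lambda>x. f x * g x) = f p * bracket A X Y p g + g p * bracket A X Y p f"
      by (simp add: bracket_apply f g fg *[OF Xp Y] *[OF Yp X] algebra_simps)
  qed
next
  fix W f assume W: "W \<subseteq> S" "smooth_fun_on A W f"
  have "smooth_fun_on A W (\<lambda>p. X p (\<lambda>q. Y q f) - Y p (\<lambda>q. X q f))"
    by (intro smooth_fun_on_diff vf_smooth[OF X] vf_smooth[OF Y] W)
  then show "smooth_fun_on A W (\<lambda>p. bracket A X Y p f)"
    by (rule smooth_fun_on_cong) (simp add: bracket_apply smooth_atI[OF W(2)])
qed

text \<open>A supply of explicit smooth fields. In the paracontact setting they reach every tangent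
  vector (\<open>tangent_span_coordinate_fields\<close>).\<close>

definition coordinate_field :: "'m set \<Rightarrow> ('m \<Rightarrow> 'e) \<Rightarrow> 'e \<Rightarrow> 'm vfield" where
  "coordinate_field U c j p f =
     (if smooth_at A p f then frechet_derivative (f \<circ> inv_into U c) (at (c p)) j else 0)"

lemma smooth_at_has_derivative:
  assumes c: "(U, c) \<in> A" "p \<in> U" and f: "smooth_at A p f"
  shows "((f \<circ> inv_into U c) has_derivative frechet_derivative (f \<circ> inv_into U c) (at (c p))) (at (c p))"
proof -
  obtain S where S: "p \<in> S" "smooth_fun_on A S f" using f by (rule smooth_atE)
  show ?thesis
    by (rule Ck_on_SucD[OF smooth_fun_onD[OF S(2) c(1)] open_chart_image[OF c(1)]])
      (use S c smooth_fun_on_open in auto)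
qed

lemma vf_coordinate_field:
  assumes c: "(U, c) \<in> A" and j: "j \<in> Basis"
  shows "vector_field_on A U (coordinate_field U c j)"
proof (rule vector_field_onI)
  show "open U" using chartD c by blast
next
  fix p assume p: "p \<in> U"
  note d = smooth_at_has_derivative[OF c p]
  show "coordinate_field U c j p \<in> tangent_space A p"
    unfolding tangent_space_def
  proof (intro CollectI conjI allI impI)
    fix f assume "\<not> smooth_at A p f"
    then show "coordinate_field U c j p f = 0" by (simp add: coordinate_field_def)
  next
    fix f g a b assume f: "smooth_at A p f" and g: "smooth_at A p g"
    have fg: "smooth_at A p (\<lambda>x. a * f x + b * g x)"
      by (intro smooth_at_add smooth_at_mult smooth_at_const f g)
    have "(((\<lambda>x. a * f x + b * g x) \<circ> inv_into U c) has_derivative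
       (\<lambda>h. a * frechet_derivative (f \<circ> inv_into U c) (at (c p)) h
          + b * frechet_derivative (g \<circ> inv_into U c) (at (c p)) h)) (at (c p))"
      using has_derivative_add[OF has_derivative_mult_right[OF d[OF f], of a]
          has_derivative_mult_right[OF d[OF g], of b]] by (simp add: comp_def)
    from frechet_derivative_at[OF this, symmetric]
    show "coordinate_field U c j p (\<lambda>x. a * f x + b * g x) =
        a * coordinate_field U c j p f + b * coordinate_field U c j p g"
      by (simp add: coordinate_field_def f g fg)
  next
    fix f g assume f: "smooth_at A p f" and g: "smooth_at A p g"
    have fg: "smooth_at A p (\<lambda>x. f x * g x)"
      by (intro smooth_at_mult f g)
    have "(((\<lambda>x. f x * g x) \<circ> inv_into U c) has_derivative
       (\<lambda>h. f p * frechet_derivative (g \<circ> inv_into U c) (at (c p)) h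
          + frechet_derivative (f \<circ> inv_into U c) (at (c p)) h * g p)) (at (c p))"
      using has_derivative_mult[OF d[OF f] d[OF g]] by (simp add: comp_def inv_chart[OF c p])
    from frechet_derivative_at[OF this, symmetric]
    show "coordinate_field U c j p (\<lambda>x. f x * g x) =
        f p * coordinate_field U c j p g + g p * coordinate_field U c j p f"
      by (simp add: coordinate_field_def f g fg)
  qed
next
  fix W f assume W: "W \<subseteq> U" "smooth_fun_on A W f"
  then have oW: "open W" by (simp add: smooth_fun_on_open)
  have UW: "U \<inter> W = W" using W by auto
  show "smooth_fun_on A W (\<lambda>p. coordinate_field U c j p f)"
  proof (rule smooth_fun_onI[OF oW])
    fix V d k assume d: "(V, d) \<in> A"
    have o1: "open (d ` (V \<inter> W))" and o2: "open (c ` W)"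
      using open_chart_image[OF d oW] open_chart_image[OF c oW] UW by auto
    have "Ck_on (Suc k) (c ` W) (f \<circ> inv_into U c)"
      using smooth_fun_onD[OF W(2) c] UW by metis
    then have 1: "Ck_on k (c ` W) (\<lambda>x. frechet_derivative (f \<circ> inv_into U c) (at x) j)"
      using j by simp
    \<comment> \<open>Read in another chart \<open>d\<close>, the partial derivative taken in
      \<open>c\<close> is composed with the smooth transition map.\<close>
    have "Ck_on k (d ` (V \<inter> U)) (c \<circ> inv_into V d)"
      using chart_transition[OF d c] by (simp add: smooth_on_def)
    then have 2: "Ck_on k (d ` (V \<inter> W)) (c \<circ> inv_into V d)"
      by (rule Ck_on_subset) (use W o1 open_chart_image[OF d chartD(1)[OF c]] in auto)
    have 3: "Ck_on k (d ` (V \<inter> W))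
       (\<lambda>x. frechet_derivative (f \<circ> inv_into U c) (at ((c \<circ> inv_into V d) x)) j)"
      by (rule Ck_on_compose[OF o1 o2 1 2]) (auto simp: inv_chart[OF d])
    show "Ck_on k (d ` (V \<inter> W)) ((\<lambda>p. coordinate_field U c j p f) \<circ> inv_into V d)"
      by (rule Ck_on_cong[OF o1 _ 3])
        (auto simp: inv_chart[OF d] coordinate_field_def smooth_atI[OF W(2)])
  qed
qed

lemma smooth_coordinate:
  assumes c: "(U, c) \<in> A"
  shows "smooth_fun_on A U (\<lambda>q. c q \<bullet> i)"
proof (rule smooth_fun_onI)
  show U: "open U" using chartD c by blast
  fix V d k assume d: "(V, d) \<in> A"
  show "Ck_on k (d ` (V \<inter> U)) ((\<lambda>q. c q \<bullet> i) \<circ> inv_into V d)"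
    using Ck_on_inner[OF open_chart_image[OF d U], of k "c \<circ> inv_into V d"] chart_transition[OF d c]
    by (simp add: smooth_on_def comp_def)
qed

lemma coordinate_field_coordinate:
  assumes c: "(U, c) \<in> A" "p \<in> U"
  shows "coordinate_field U c j p (\<lambda>q. c q \<bullet> i) = j \<bullet> i"
proof -
  have "(((\<lambda>q. c q \<bullet> i) \<circ> inv_into U c) has_derivative (\<lambda>h. h \<bullet> i)) (at (c p))"
  proof (rule has_derivative_transform_within_open)
    show "((\<lambda>x. x \<bullet> i) has_derivative (\<lambda>h. h \<bullet> i)) (at (c p))"
      by (rule has_derivative_inner_left[OF has_derivative_ident])
    show "open (c ` U)" using chartD c by blast
  qed (use c in \<open>auto simp: f_inv_into_f\<close>)
  from frechet_derivative_at[OF this, symmetric] show ?thesis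
    using smooth_atI[OF smooth_coordinate[OF c(1)] c(2)] by (simp add: coordinate_field_def)
qed

text \<open>Applied to the coordinate function of index \<open>i\<close>, a linear relation returns
  its coefficient of index \<open>i\<close>. Injectivity serves the later count of exactly three
  fields.\<close>

lemma coordinate_fields_independent:
  assumes c: "(U, c) \<in> A" "p \<in> U"
  shows "inj_on (\<lambda>j. coordinate_field U c j p) Basis"
    and "independent ((\<lambda>j. coordinate_field U c j p) ` Basis)"
proof -
  note cc = coordinate_field_coordinate[OF c]
  show inj: "inj_on (\<lambda>j. coordinate_field U c j p) Basis"
    by (rule inj_onI) (metis cc inner_Basis zero_neq_one)
  have *: "f v = 0"
    if 0: "(\<Sum>x\<in>(\<lambda>j. coordinate_field U c j p) ` Basis. f x *\<^sub>R x) = 0"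
      and v: "v \<in> (\<lambda>j. coordinate_field U c j p) ` Basis" for f v
  proof -
    obtain i where i: "i \<in> Basis" "v = coordinate_field U c i p" using v by auto
    have "(\<Sum>j\<in>Basis. f (coordinate_field U c j p) *\<^sub>R coordinate_field U c j p) = 0"
      using 0 by (simp add: sum.reindex[OF inj])
    then have "(\<Sum>j\<in>Basis. f (coordinate_field U c j p) *\<^sub>R coordinate_field U c j p) (\<lambda>q. c q \<bullet> i) = 0"
      by (simp only: zero_fun_def)
    moreover have "sum G I x = (\<Sum>j\<in>I. G j x)" for G :: "'e \<Rightarrow> 'm tvec" and I x
      by (induction I rule: infinite_finite_induct) auto
    ultimately have "(\<Sum>j\<in>Basis. f (coordinate_field U c j p) * (j \<bullet> i)) = 0"
      by (simp add: cc)
    then show ?thesis using i by (simp add: inner_Basis if_distrib sum.delta cong: if_cong)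
  qed
  show "independent ((\<lambda>j. coordinate_field U c j p) ` Basis)"
    by (rule independent_if_scalars_zero) (simp, erule *, assumption)
qed

section \<open>Rules for vector fields and Lie brackets\<close>

lemma vf_apply_mult:
  assumes "vector_field_on A S X" "p \<in> S" "smooth_fun_on A S f" "smooth_fun_on A S h"
  shows "X p (\<lambda>q. f q * h q) = f p * X p h + h p * X p f"
  by (rule tangent_mult) (use assms in \<open>auto intro: vf_tangent smooth_atI\<close>)

lemma vf_apply_cong:
  assumes "vector_field_on A S X" "p \<in> S" "\<And>q. q \<in> S \<Longrightarrow> f q = h q"
  shows "X p f = X p h"
  by (rule tangent_cong[OF vf_tangent[OF assms(1,2)] vf_open[OF assms(1)] assms(2,3)])

lemma vf_apply_const:
  assumes "vector_field_on A S X" "p \<in> S" "\<And>q. q \<in> S \<Longrightarrow> f q = r"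
  shows "X p f = 0"
  using vf_apply_cong[OF assms] tangent_const[OF vf_tangent[OF assms(1,2)]] by simp

lemma bracket_anti: "bracket A X Y p = - bracket A Y X p"
  by (auto simp: bracket_def fun_eq_iff)

lemma bracket_anti_fun: "bracket A X Y = (\<lambda>p. - bracket A Y X p)"
  using bracket_anti by blast

lemma bracket_self: "bracket A X X p = 0"
  by (auto simp: bracket_def fun_eq_iff)

lemma bracket_cong:
  assumes "vector_field_on A S X" "vector_field_on A S Y"
    and "vector_field_on A S X'" "vector_field_on A S Y'" "p \<in> S"
    and "\<And>q. q \<in> S \<Longrightarrow> X q = X' q" "\<And>q. q \<in> S \<Longrightarrow> Y q = Y' q"
  shows "bracket A X Y p = bracket A X' Y' p"
proof -
  have "X p (\<lambda>q. Y q f) = X p (\<lambda>q. Y' q f)" "Y p (\<lambda>q. X q f) = Y p (\<lambda>q. X' q f)" for f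
    using vf_apply_cong[OF assms(1,5), of "\<lambda>q. Y q f" "\<lambda>q. Y' q f"]
      vf_apply_cong[OF assms(2,5), of "\<lambda>q. X q f" "\<lambda>q. X' q f"] assms(6,7) by auto
  then have "bracket A X Y p f = bracket A X' Y' p f" for f
    unfolding bracket_def using assms(6,7)[OF assms(5)] by metis
  then show ?thesis by blast
qed

lemma bracket_add_right:
  assumes X: "vector_field_on A S X" and Y: "vector_field_on A S Y" and Z: "vector_field_on A S Z"
    and p: "p \<in> S"
  shows "bracket A X (\<lambda>q. Y q + Z q) p = bracket A X Y p + bracket A X Z p"
proof
  fix f
  show "bracket A X (\<lambda>q. Y q + Z q) p f = (bracket A X Y p + bracket A X Z p) f"
  proof (cases "smooth_at A p f")
    case True
    have "X p (\<lambda>q. Y q f + Z q f) = X p (\<lambda>q. Y q f) + X p (\<lambda>q. Z q f)"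
      by (rule tangent_add[OF vf_tangent[OF X p]]) (use True Y Z p vf_smooth_at in auto)
    then show ?thesis using True by (simp add: bracket_apply)
  qed (simp add: bracket_def)
qed

lemma bracket_scale_right:
  assumes X: "vector_field_on A S X" and Y: "vector_field_on A S Y" and f: "smooth_fun_on A S f"
    and p: "p \<in> S"
  shows "bracket A X (\<lambda>q. f q *\<^sub>R Y q) p = X p f *\<^sub>R Y p + f p *\<^sub>R bracket A X Y p"
proof
  fix h
  show "bracket A X (\<lambda>q. f q *\<^sub>R Y q) p h = (X p f *\<^sub>R Y p + f p *\<^sub>R bracket A X Y p) h"
  proof (cases "smooth_at A p h")
    case True
    have "X p (\<lambda>q. f q * Y q h) = f p * X p (\<lambda>q. Y q h) + Y p h * X p f"
      by (rule tangent_mult[OF vf_tangent[OF X p]])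
        (use True Y p vf_smooth_at smooth_atI[OF f] in auto)
    then show ?thesis using True by (simp add: bracket_apply algebra_simps)
  next
    case False
    then show ?thesis by (simp add: bracket_def tangent_nonsmooth[OF vf_tangent[OF Y p]])
  qed
qed

lemma bracket_add_left:
  assumes "vector_field_on A S X" "vector_field_on A S Y" "vector_field_on A S Z" "p \<in> S"
  shows "bracket A (\<lambda>q. Y q + Z q) X p = bracket A Y X p + bracket A Z X p"
  using bracket_add_right[OF assms] by (simp add: bracket_anti[of _ X])

lemma bracket_scale_left:
  assumes "vector_field_on A S X" "vector_field_on A S Y" "smooth_fun_on A S f" "p \<in> S"
  shows "bracket A (\<lambda>q. f q *\<^sub>R Y q) X p = - (X p f *\<^sub>R Y p) + f p *\<^sub>R bracket A Y X p"
  using bracket_scale_right[OF assms] by (simp add: bracket_anti[of _ X])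

text \<open>Once all brackets are expanded, the iterated derivatives of \<open>f\<close> cancel in
  pairs. Expanding an inner bracket under \<open>U p\<close> again uses locality.\<close>

lemma bracket_jacobi:
  assumes X: "vector_field_on A S X" and Y: "vector_field_on A S Y" and Z: "vector_field_on A S Z"
    and p: "p \<in> S"
  shows "bracket A X (bracket A Y Z) p = bracket A (bracket A X Y) Z p + bracket A Y (bracket A X Z) p"
proof
  fix f
  show "bracket A X (bracket A Y Z) p f =
    (bracket A (bracket A X Y) Z p + bracket A Y (bracket A X Z) p) f"
  proof (cases "smooth_at A p f")
    case True
    then obtain T where T: "p \<in> T" "smooth_fun_on A T f" by (rule smooth_atE)
    note o = smooth_fun_on_open[OF T(2)]
    have *: "U p (\<lambda>q. bracket A V W q f) = U p (\<lambda>q. V q (\<lambda>r. W r f)) - U p (\<lambda>q. W q (\<lambda>r. V r f))"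
      if U: "vector_field_on A S U" and V: "vector_field_on A S V" and W: "vector_field_on A S W"
      for U V W
    proof -
      have "U p (\<lambda>q. bracket A V W q f) = U p (\<lambda>q. V q (\<lambda>r. W r f) - W q (\<lambda>r. V r f))"
        by (rule tangent_cong[OF vf_tangent[OF U p] o T(1)]) (simp add: bracket_apply smooth_atI[OF T(2)])
      also have "\<dots> = U p (\<lambda>q. V q (\<lambda>r. W r f)) - U p (\<lambda>q. W q (\<lambda>r. V r f))"
        by (intro tangent_diff[OF vf_tangent[OF U p]] vf_smooth_at[OF V _ p] vf_smooth_at[OF W _ p] True)
      finally show ?thesis .
    qed
    show ?thesis
      by (simp add: bracket_apply True vf_smooth_at[OF X _ p] vf_smooth_at[OF Y _ p] vf_smooth_at[OF Z _ p]
          *[OF X Y Z] *[OF Y X Z] *[OF Z X Y])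
  qed (simp add: bracket_def)
qed

section \<open>Tensors and connections\<close>

text \<open>Only the value at the single point \<open>p\<close> is concerned, while the fields may
  live on any neighbourhood of it. Locality is a consequence, see
  \<open>tensorial_cong\<close>.\<close>

definition tensorial :: "'m \<Rightarrow> ('m vfield \<Rightarrow> 'b::real_vector) \<Rightarrow> bool" where
  "tensorial p F \<longleftrightarrow>
     (\<forall>S X Y. p \<in> S \<longrightarrow> vector_field_on A S X \<longrightarrow> vector_field_on A S Y \<longrightarrow>
        F (\<lambda>q. X q + Y q) = F X + F Y) \<and>
     (\<forall>S X f. p \<in> S \<longrightarrow> vector_field_on A S X \<longrightarrow> smooth_fun_on A S f \<longrightarrow>
        F (\<lambda>q. f q *\<^sub>R X q) = f p *\<^sub>R F X)"

text \<open>Shrinking to \<open>T \<subseteq> S\<close> allows the other arguments of a multilinear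
  expression, given on \<open>S\<close>, to be restricted to the same set.\<close>

lemma tensorialI:
  assumes "open S" "p \<in> S"
    and add: "\<And>T X Y. p \<in> T \<Longrightarrow> T \<subseteq> S \<Longrightarrow> open T \<Longrightarrow> vector_field_on A T X \<Longrightarrow> vector_field_on A T Y \<Longrightarrow>
        F (\<lambda>q. X q + Y q) = F X + F Y"
    and scale: "\<And>T X f. p \<in> T \<Longrightarrow> T \<subseteq> S \<Longrightarrow> open T \<Longrightarrow> vector_field_on A T X \<Longrightarrow> smooth_fun_on A T f \<Longrightarrow>
        F (\<lambda>q. f q *\<^sub>R X q) = f p *\<^sub>R F X"
  shows "tensorial p F"
  unfolding tensorial_def
proof (intro conjI allI impI)
  fix T X Y assume T: "p \<in> T" "vector_field_on A T X" "vector_field_on A T Y"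
  have o: "open (S \<inter> T)" using assms(1) T vf_open by blast
  show "F (\<lambda>q. X q + Y q) = F X + F Y"
    by (rule add[of "S \<inter> T"]) (use o assms(2) T in \<open>auto intro: vf_subset\<close>)
next
  fix T X f assume T: "p \<in> T" "vector_field_on A T X" "smooth_fun_on A T f"
  have o: "open (S \<inter> T)" using assms(1) T vf_open by blast
  show "F (\<lambda>q. f q *\<^sub>R X q) = f p *\<^sub>R F X"
    by (rule scale[of "S \<inter> T"]) (use o assms(2) T in \<open>auto intro: vf_subset smooth_fun_on_subset\<close>)
qed

lemma tensorial_add:
  assumes "tensorial p F" "p \<in> S" "vector_field_on A S X" "vector_field_on A S Y"
  shows "F (\<lambda>q. X q + Y q) = F X + F Y"
  using assms unfolding tensorial_def by blast

lemma tensorial_scale: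
  assumes "tensorial p F" "p \<in> S" "vector_field_on A S X" "smooth_fun_on A S f"
  shows "F (\<lambda>q. f q *\<^sub>R X q) = f p *\<^sub>R F X"
  using assms unfolding tensorial_def by blast

lemma tensorial_vanish:
  assumes F: "tensorial p F" and p: "p \<in> S" and X: "vector_field_on A S X"
    and 0: "\<And>q. q \<in> S \<Longrightarrow> X q = 0"
  shows "F X = 0"
proof -
  have S: "open S" using X vf_open by blast
  define k where "k q = (if q \<in> S then 1 else 0 :: real)" for q
  have k: "smooth_fun_on A S k"
    by (rule smooth_fun_on_cong[OF smooth_fun_on_const[OF S, of 1]]) (simp add: k_def)
  \<comment> \<open>After multiplication by the indicator both sides are equal as total functions,
    also off \<open>S\<close>, where \<open>X\<close> is arbitrary.\<close>
  have "(\<lambda>q. k q *\<^sub>R X q) = (\<lambda>q. 0 *\<^sub>R X q)" using 0 by (auto simp: k_def)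
  then have "F (\<lambda>q. k q *\<^sub>R X q) = F (\<lambda>q. 0 *\<^sub>R X q)" by simp
  then show ?thesis
    using tensorial_scale[OF F p X k] tensorial_scale[OF F p X smooth_fun_on_const[OF S, of 0]] p
    by (simp add: k_def)
qed

lemma tensorial_cong:
  assumes F: "tensorial p F" and p: "p \<in> S" and X: "vector_field_on A S X" and Y: "vector_field_on A S Y"
    and eq: "\<And>q. q \<in> S \<Longrightarrow> X q = Y q"
  shows "F X = F Y"
proof -
  have "F (\<lambda>q. X q - Y q) = 0"
    by (rule tensorial_vanish[OF F p vf_diff[OF X Y]]) (simp add: eq)
  then show ?thesis
    using tensorial_add[OF F p vf_diff[OF X Y] Y] by simp
qed

end

section \<open>Affine connections, their curvature and their Lie derivative\<close>

locale affine_manifold = smooth_manifold A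
  for A :: "('m::{t2_space,second_countable_topology}, 'e::euclidean_space) atlas" +
  fixes D :: "'m connection"
  assumes affine: "affine_connection A D"
begin

lemma vf_D:
  assumes "vector_field_on A S X" "vector_field_on A S Y"
  shows "vector_field_on A S (D X Y)"
  using affine assms unfolding affine_connection_def by fast

lemma D_rules:
  assumes "vector_field_on A S X" "vector_field_on A S X'" "vector_field_on A S Y"
    and "smooth_fun_on A S f" "p \<in> S"
  shows "D (\<lambda>q. X q + X' q) Y p = D X Y p + D X' Y p"
    and "D Y (\<lambda>q. X q + X' q) p = D Y X p + D Y X' p"
    and "D (\<lambda>q. f q *\<^sub>R X q) Y p = f p *\<^sub>R D X Y p"
    and "D X (\<lambda>q. f q *\<^sub>R Y q) p = X p f *\<^sub>R Y p + f p *\<^sub>R D X Y p"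
proof -
  note r = affine[unfolded affine_connection_def, THEN conjunct2, rule_format, OF assms]
  show "D (\<lambda>q. X q + X' q) Y p = D X Y p + D X' Y p"
    by (rule r[THEN conjunct1])
  show "D Y (\<lambda>q. X q + X' q) p = D Y X p + D Y X' p"
    by (rule r[THEN conjunct2, THEN conjunct1])
  show "D (\<lambda>q. f q *\<^sub>R X q) Y p = f p *\<^sub>R D X Y p"
    by (rule r[THEN conjunct2, THEN conjunct2, THEN conjunct1])
  show "D X (\<lambda>q. f q *\<^sub>R Y q) p = X p f *\<^sub>R Y p + f p *\<^sub>R D X Y p"
    by (rule r[THEN conjunct2, THEN conjunct2, THEN conjunct2])
qed

lemma D_add_left:
  assumes "vector_field_on A S X" "vector_field_on A S X'" "vector_field_on A S Y" "p \<in> S"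
  shows "D (\<lambda>q. X q + X' q) Y p = D X Y p + D X' Y p"
  using D_rules(1)[OF assms(1-3) smooth_fun_on_const[OF vf_open[OF assms(1)]] assms(4)] .

lemma D_add_right:
  assumes "vector_field_on A S X" "vector_field_on A S X'" "vector_field_on A S Y" "p \<in> S"
  shows "D Y (\<lambda>q. X q + X' q) p = D Y X p + D Y X' p"
  using D_rules(2)[OF assms(1-3) smooth_fun_on_const[OF vf_open[OF assms(1)]] assms(4)] .

lemma D_scale_left:
  assumes "vector_field_on A S X" "vector_field_on A S Y" "smooth_fun_on A S f" "p \<in> S"
  shows "D (\<lambda>q. f q *\<^sub>R X q) Y p = f p *\<^sub>R D X Y p"
  using D_rules(3)[OF assms(1) assms(1-4)] .

lemma D_scale_right:
  assumes "vector_field_on A S X" "vector_field_on A S Y" "smooth_fun_on A S f" "p \<in> S"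
  shows "D X (\<lambda>q. f q *\<^sub>R Y q) p = X p f *\<^sub>R Y p + f p *\<^sub>R D X Y p"
  using D_rules(4)[OF assms(1) assms(1-4)] .

lemma tensorial_D:
  assumes "vector_field_on A S Y" "p \<in> S"
  shows "tensorial p (\<lambda>X. D X Y p)"
proof (rule tensorialI[OF vf_open[OF assms(1)] assms(2)])
  fix T X X' assume T: "p \<in> T" "T \<subseteq> S" "open T" "vector_field_on A T X" "vector_field_on A T X'"
  show "D (\<lambda>q. X q + X' q) Y p = D X Y p + D X' Y p"
    by (rule D_add_left[OF T(4,5) vf_subset[OF assms(1) T(3,2)] T(1)])
next
  fix T X f assume T: "p \<in> T" "T \<subseteq> S" "open T" "vector_field_on A T X" "smooth_fun_on A T f"
  show "D (\<lambda>q. f q *\<^sub>R X q) Y p = f p *\<^sub>R D X Y p"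
    by (rule D_scale_left[OF T(4) vf_subset[OF assms(1) T(3,2)] T(5,1)])
qed

lemmas D_cong_left = tensorial_cong[OF tensorial_D]

text \<open>The connection is only a derivation in this argument, but the extra term of the Leibniz
  rule is a multiple of \<open>Y p\<close>, which is zero.\<close>

lemma D_vanish_right:
  assumes X: "vector_field_on A S X" and Y: "vector_field_on A S Y" and p: "p \<in> S"
    and 0: "\<And>q. q \<in> S \<Longrightarrow> Y q = 0"
  shows "D X Y p = 0"
proof -
  have S: "open S" using X vf_open by blast
  define k where "k q = (if q \<in> S then 1 else 0 :: real)" for q
  have k: "smooth_fun_on A S k"
    by (rule smooth_fun_on_cong[OF smooth_fun_on_const[OF S, of 1]]) (simp add: k_def)
  have "(\<lambda>q. k q *\<^sub>R Y q) = (\<lambda>q. 0 *\<^sub>R Y q)" using 0 by (auto simp: k_def)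
  then have "D X (\<lambda>q. k q *\<^sub>R Y q) p = D X (\<lambda>q. 0 *\<^sub>R Y q) p" by simp
  then show ?thesis
    using D_scale_right[OF X Y k p] D_scale_right[OF X Y smooth_fun_on_const[OF S, of 0] p] p 0[OF p]
    by (simp add: k_def)
qed

lemma D_cong_right:
  assumes X: "vector_field_on A S X" and Y: "vector_field_on A S Y" and Y': "vector_field_on A S Y'"
    and p: "p \<in> S" and eq: "\<And>q. q \<in> S \<Longrightarrow> Y q = Y' q"
  shows "D X Y p = D X Y' p"
proof -
  have "D X (\<lambda>q. Y q - Y' q) p = 0"
    by (rule D_vanish_right[OF X vf_diff[OF Y Y'] p]) (simp add: eq)
  then show ?thesis
    using D_add_right[OF vf_diff[OF Y Y'] Y' X p] by simp
qed

lemma D_minus_left: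
  assumes "vector_field_on A S X" "vector_field_on A S Y" "p \<in> S"
  shows "D (\<lambda>q. - X q) Y p = - D X Y p"
  using D_scale_left[OF assms(1,2) smooth_fun_on_const[OF vf_open[OF assms(1)], of "-1"] assms(3)] by simp

lemma curvature_anti:
  assumes "vector_field_on A S X" "vector_field_on A S Y" "vector_field_on A S Z" "p \<in> S"
  shows "curvature A D X Y Z p = - curvature A D Y X Z p"
  using D_minus_left[OF vf_bracket[OF assms(2,1)] assms(3,4)]
  by (simp add: curvature_def bracket_anti_fun[of X Y])

text \<open>The term with \<open>Y p f\<close> from the bracket of \<open>f X\<close> and
  \<open>Y\<close> cancels the one from differentiating \<open>f\<close> in
  \<open>D Y (D (f X) Z)\<close>.\<close>

lemma tensorial_curvature_1:
  assumes Y: "vector_field_on A S Y" and Z: "vector_field_on A S Z" and p: "p \<in> S"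
  shows "tensorial p (\<lambda>X. curvature A D X Y Z p)"
proof (rule tensorialI[OF vf_open[OF Y] p])
  fix T X X' assume T: "p \<in> T" "T \<subseteq> S" "open T" and X: "vector_field_on A T X" and X': "vector_field_on A T X'"
  note Y' = vf_subset[OF Y T(3,2)] and Z' = vf_subset[OF Z T(3,2)]
  have 1: "D (bracket A (\<lambda>q. X q + X' q) Y) Z p = D (\<lambda>q. bracket A X Y q + bracket A X' Y q) Z p"
    by (rule D_cong_left[OF Z' T(1) T(1)])
      (auto intro!: vf_bracket vf_add X X' Y' bracket_add_left[of T])
  have 2: "D Y (D (\<lambda>q. X q + X' q) Z) p = D Y (\<lambda>q. D X Z q + D X' Z q) p"
    by (rule D_cong_right[OF Y' _ _ T(1)]) (auto intro!: vf_D vf_add X X' Z' D_add_left[of T])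
  show "curvature A D (\<lambda>q. X q + X' q) Y Z p = curvature A D X Y Z p + curvature A D X' Y Z p"
    by (simp add: curvature_def 1 2 D_add_left[OF vf_bracket[OF X Y'] vf_bracket[OF X' Y'] Z' T(1)]
        D_add_right[OF vf_D[OF X Z'] vf_D[OF X' Z'] Y' T(1)]
        D_add_left[OF X X' vf_D[OF Y' Z'] T(1)])
next
  fix T X f assume T: "p \<in> T" "T \<subseteq> S" "open T" and X: "vector_field_on A T X" and f: "smooth_fun_on A T f"
  note Y' = vf_subset[OF Y T(3,2)] and Z' = vf_subset[OF Z T(3,2)]
  have Yf: "smooth_fun_on A T (\<lambda>q. Y q f)" by (rule vf_smooth[OF Y' f]) simp
  have 1: "D (bracket A (\<lambda>q. f q *\<^sub>R X q) Y) Z p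
      = D (\<lambda>q. (- Y q f) *\<^sub>R X q + f q *\<^sub>R bracket A X Y q) Z p"
    by (rule D_cong_left[OF Z' T(1) T(1)])
      (auto intro!: vf_bracket vf_add vf_diff vf_scale X Y' Yf f smooth_fun_on_minus bracket_scale_left[of T, THEN trans])
  have 2: "D Y (D (\<lambda>q. f q *\<^sub>R X q) Z) p = D Y (\<lambda>q. f q *\<^sub>R D X Z q) p"
    by (rule D_cong_right[OF Y' _ _ T(1)]) (auto intro!: vf_D vf_scale X f Z' D_scale_left[of T])
  show "curvature A D (\<lambda>q. f q *\<^sub>R X q) Y Z p = f p *\<^sub>R curvature A D X Y Z p"
    using D_add_left[OF vf_scale[OF X smooth_fun_on_minus[OF Yf]] vf_scale[OF vf_bracket[OF X Y'] f] Z' T(1)]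
      D_scale_left[OF X Z' smooth_fun_on_minus[OF Yf] T(1)]
      D_scale_left[OF vf_bracket[OF X Y'] Z' f T(1)]
      D_scale_right[OF Y' vf_D[OF X Z'] f T(1)]
      D_scale_left[OF X vf_D[OF Y' Z'] f T(1)]
    by (simp add: curvature_def 1 2 algebra_simps)
qed

text \<open>Antisymmetry carries the result over from the first slot.\<close>

lemma tensorial_curvature_2:
  assumes X: "vector_field_on A S X" and Z: "vector_field_on A S Z" and p: "p \<in> S"
  shows "tensorial p (\<lambda>Y. curvature A D X Y Z p)"
proof (rule tensorialI[OF vf_open[OF X] p])
  fix T Y Y' assume T: "p \<in> T" "T \<subseteq> S" "open T" and Y: "vector_field_on A T Y" and Y': "vector_field_on A T Y'"
  note X' = vf_subset[OF X T(3,2)] and Z' = vf_subset[OF Z T(3,2)]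
  show "curvature A D X (\<lambda>q. Y q + Y' q) Z p = curvature A D X Y Z p + curvature A D X Y' Z p"
    using tensorial_add[OF tensorial_curvature_1[OF X' Z' T(1)] T(1) Y Y']
    by (simp add: curvature_anti[OF X' _ Z' T(1)] Y Y' vf_add)
next
  fix T Y f assume T: "p \<in> T" "T \<subseteq> S" "open T" and Y: "vector_field_on A T Y" and f: "smooth_fun_on A T f"
  note X' = vf_subset[OF X T(3,2)] and Z' = vf_subset[OF Z T(3,2)]
  show "curvature A D X (\<lambda>q. f q *\<^sub>R Y q) Z p = f p *\<^sub>R curvature A D X Y Z p"
    using tensorial_scale[OF tensorial_curvature_1[OF X' Z' T(1)] T(1) Y f]
    by (simp add: curvature_anti[OF X' _ Z' T(1)] Y f vf_scale)
qed

text \<open>The second derivatives of \<open>f\<close> combine to \<open>X (Y f) - Y (X f)\<close>,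
  which the bracket term absorbs; the mixed first-order terms are symmetric in \<open>X\<close> and
  \<open>Y\<close> and cancel.\<close>

lemma tensorial_curvature_3:
  assumes X: "vector_field_on A S X" and Y: "vector_field_on A S Y" and p: "p \<in> S"
  shows "tensorial p (\<lambda>Z. curvature A D X Y Z p)"
proof (rule tensorialI[OF vf_open[OF Y] p])
  fix T Z Z' assume T: "p \<in> T" "T \<subseteq> S" "open T" and Z: "vector_field_on A T Z" and Z': "vector_field_on A T Z'"
  note X' = vf_subset[OF X T(3,2)] and Y' = vf_subset[OF Y T(3,2)]
  have *: "D V (D W (\<lambda>q. Z q + Z' q)) p = D V (\<lambda>q. D W Z q + D W Z' q) p"
    if "vector_field_on A T V" "vector_field_on A T W" for V W
    by (rule D_cong_right[OF that(1) _ _ T(1)]) (auto intro!: vf_D vf_add that Z Z' D_add_right[of T])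
  show "curvature A D X Y (\<lambda>q. Z q + Z' q) p = curvature A D X Y Z p + curvature A D X Y Z' p"
    by (simp add: curvature_def *[OF X' Y'] *[OF Y' X'] D_add_right[OF Z Z' vf_bracket[OF X' Y'] T(1)]
        D_add_right[OF vf_D[OF X' Z] vf_D[OF X' Z'] Y' T(1)]
        D_add_right[OF vf_D[OF Y' Z] vf_D[OF Y' Z'] X' T(1)])
next
  fix T Z f assume T: "p \<in> T" "T \<subseteq> S" "open T" and Z: "vector_field_on A T Z" and f: "smooth_fun_on A T f"
  note X' = vf_subset[OF X T(3,2)] and Y' = vf_subset[OF Y T(3,2)]
  have *: "D V (D W (\<lambda>q. f q *\<^sub>R Z q)) p =
      (V p (\<lambda>q. W q f) *\<^sub>R Z p + W p f *\<^sub>R D V Z p) + (V p f *\<^sub>R D W Z p + f p *\<^sub>R D V (D W Z) p)"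
    if V: "vector_field_on A T V" and W: "vector_field_on A T W" for V W
  proof -
    have Wf: "smooth_fun_on A T (\<lambda>q. W q f)" by (rule vf_smooth[OF W f]) simp
    have "D V (D W (\<lambda>q. f q *\<^sub>R Z q)) p = D V (\<lambda>q. W q f *\<^sub>R Z q + f q *\<^sub>R D W Z q) p"
      by (rule D_cong_right[OF V _ _ T(1)])
        (auto intro!: vf_D vf_add vf_scale V W Z f Wf D_scale_right[of T])
    then show ?thesis
      by (simp add: D_add_right[OF vf_scale[OF Z Wf] vf_scale[OF vf_D[OF W Z] f] V T(1)]
          D_scale_right[OF V Z Wf T(1)] D_scale_right[OF V vf_D[OF W Z] f T(1)])
  qed
  have "D (bracket A X Y) (\<lambda>q. f q *\<^sub>R Z q) p
     = (X p (\<lambda>q. Y q f) - Y p (\<lambda>q. X q f)) *\<^sub>R Z p + f p *\<^sub>R D (bracket A X Y) Z p"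
    by (simp add: D_scale_right[OF vf_bracket[OF X' Y'] Z f T(1)] bracket_apply[OF smooth_atI[OF f T(1)]])
  then show "curvature A D X Y (\<lambda>q. f q *\<^sub>R Z q) p = f p *\<^sub>R curvature A D X Y Z p"
    by (simp add: curvature_def *[OF X' Y'] *[OF Y' X'] algebra_simps)
qed

text \<open>The derivative of \<open>f\<close> along \<open>V\<close> appears once from the outer
  bracket and once, with opposite sign, from the bracket in the lower slot.\<close>

lemma tensorial_lie_connection_1:
  assumes V: "vector_field_on A S V" and Y: "vector_field_on A S Y" and p: "p \<in> S"
  shows "tensorial p (\<lambda>X. lie_connection A V D X Y p)"
proof (rule tensorialI[OF vf_open[OF Y] p])
  fix T X X' assume T: "p \<in> T" "T \<subseteq> S" "open T" and X: "vector_field_on A T X" and X': "vector_field_on A T X'"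
  note V' = vf_subset[OF V T(3,2)] and Y' = vf_subset[OF Y T(3,2)]
  have 1: "bracket A V (D (\<lambda>q. X q + X' q) Y) p = bracket A V (\<lambda>q. D X Y q + D X' Y q) p"
    by (rule bracket_cong[OF V' _ V' _ T(1)]) (auto intro!: vf_D vf_add X X' Y' D_add_left[of T])
  have 2: "D (bracket A V (\<lambda>q. X q + X' q)) Y p = D (\<lambda>q. bracket A V X q + bracket A V X' q) Y p"
    by (rule D_cong_left[OF Y' T(1) T(1)]) (auto intro!: vf_bracket vf_add V' X X' Y' bracket_add_right[of T])
  show "lie_connection A V D (\<lambda>q. X q + X' q) Y p = lie_connection A V D X Y p + lie_connection A V D X' Y p"
    by (simp add: lie_connection_def 1 2 bracket_add_right[OF V' vf_D[OF X Y'] vf_D[OF X' Y'] T(1)]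
        D_add_left[OF vf_bracket[OF V' X] vf_bracket[OF V' X'] Y' T(1)]
        D_add_left[OF X X' vf_bracket[OF V' Y'] T(1)])
next
  fix T X f assume T: "p \<in> T" "T \<subseteq> S" "open T" and X: "vector_field_on A T X" and f: "smooth_fun_on A T f"
  note V' = vf_subset[OF V T(3,2)] and Y' = vf_subset[OF Y T(3,2)]
  have Vf: "smooth_fun_on A T (\<lambda>q. V q f)" by (rule vf_smooth[OF V' f]) simp
  have 1: "bracket A V (D (\<lambda>q. f q *\<^sub>R X q) Y) p = bracket A V (\<lambda>q. f q *\<^sub>R D X Y q) p"
    by (rule bracket_cong[OF V' _ V' _ T(1)]) (auto intro!: vf_D vf_scale X f Y' D_scale_left[of T])
  have 2: "D (bracket A V (\<lambda>q. f q *\<^sub>R X q)) Y p = D (\<lambda>q. V q f *\<^sub>R X q + f q *\<^sub>R bracket A V X q) Y p"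
    by (rule D_cong_left[OF Y' T(1) T(1)])
      (auto intro!: vf_bracket vf_add vf_scale V' Vf X f Y' bracket_scale_right[of T])
  show "lie_connection A V D (\<lambda>q. f q *\<^sub>R X q) Y p = f p *\<^sub>R lie_connection A V D X Y p"
    using bracket_scale_right[OF V' vf_D[OF X Y'] f T(1)]
      D_add_left[OF vf_scale[OF X Vf] vf_scale[OF vf_bracket[OF V' X] f] Y' T(1)]
      D_scale_left[OF X Y' Vf T(1)] D_scale_left[OF vf_bracket[OF V' X] Y' f T(1)]
      D_scale_left[OF X vf_bracket[OF V' Y'] f T(1)]
    by (simp add: lie_connection_def 1 2 algebra_simps)
qed

text \<open>Besides cancellations as in the first slot, \<open>V (X f) - X (V f)\<close> is matched
  by the derivative of \<open>f\<close> along the bracket of \<open>V\<close> and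
  \<open>X\<close>.\<close>

lemma tensorial_lie_connection_2:
  assumes V: "vector_field_on A S V" and X: "vector_field_on A S X" and p: "p \<in> S"
  shows "tensorial p (\<lambda>Y. lie_connection A V D X Y p)"
proof (rule tensorialI[OF vf_open[OF X] p])
  fix T Y Y' assume T: "p \<in> T" "T \<subseteq> S" "open T" and Y: "vector_field_on A T Y" and Y': "vector_field_on A T Y'"
  note V' = vf_subset[OF V T(3,2)] and X' = vf_subset[OF X T(3,2)]
  have 1: "bracket A V (D X (\<lambda>q. Y q + Y' q)) p = bracket A V (\<lambda>q. D X Y q + D X Y' q) p"
    by (rule bracket_cong[OF V' _ V' _ T(1)]) (auto intro!: vf_D vf_add X' Y Y' D_add_right[of T])
  have 2: "D X (bracket A V (\<lambda>q. Y q + Y' q)) p = D X (\<lambda>q. bracket A V Y q + bracket A V Y' q) p"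
    by (rule D_cong_right[OF X' _ _ T(1)]) (auto intro!: vf_bracket vf_add V' Y Y' bracket_add_right[of T])
  show "lie_connection A V D X (\<lambda>q. Y q + Y' q) p = lie_connection A V D X Y p + lie_connection A V D X Y' p"
    by (simp add: lie_connection_def 1 2 bracket_add_right[OF V' vf_D[OF X' Y] vf_D[OF X' Y'] T(1)]
        D_add_right[OF vf_bracket[OF V' Y] vf_bracket[OF V' Y'] X' T(1)]
        D_add_right[OF Y Y' vf_bracket[OF V' X'] T(1)])
next
  fix T Y f assume T: "p \<in> T" "T \<subseteq> S" "open T" and Y: "vector_field_on A T Y" and f: "smooth_fun_on A T f"
  note V' = vf_subset[OF V T(3,2)] and X' = vf_subset[OF X T(3,2)]
  have Vf: "smooth_fun_on A T (\<lambda>q. V q f)" by (rule vf_smooth[OF V' f]) simp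
  have Xf: "smooth_fun_on A T (\<lambda>q. X q f)" by (rule vf_smooth[OF X' f]) simp
  have 1: "bracket A V (D X (\<lambda>q. f q *\<^sub>R Y q)) p = bracket A V (\<lambda>q. X q f *\<^sub>R Y q + f q *\<^sub>R D X Y q) p"
    by (rule bracket_cong[OF V' _ V' _ T(1)])
      (auto intro!: vf_D vf_add vf_scale X' Xf f Y D_scale_right[of T])
  have 2: "D X (bracket A V (\<lambda>q. f q *\<^sub>R Y q)) p = D X (\<lambda>q. V q f *\<^sub>R Y q + f q *\<^sub>R bracket A V Y q) p"
    by (rule D_cong_right[OF X' _ _ T(1)])
      (auto intro!: vf_bracket vf_add vf_scale V' Vf X' f Y bracket_scale_right[of T])
  show "lie_connection A V D X (\<lambda>q. f q *\<^sub>R Y q) p = f p *\<^sub>R lie_connection A V D X Y p"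
    using bracket_add_right[OF V' vf_scale[OF Y Xf] vf_scale[OF vf_D[OF X' Y] f] T(1)]
      bracket_scale_right[OF V' vf_D[OF X' Y] f T(1)] bracket_scale_right[OF V' Y Xf T(1)]
      D_add_right[OF vf_scale[OF Y Vf] vf_scale[OF vf_bracket[OF V' Y] f] X' T(1)]
      D_scale_right[OF X' Y Vf T(1)] D_scale_right[OF X' vf_bracket[OF V' Y] f T(1)]
      D_scale_right[OF vf_bracket[OF V' X'] Y f T(1)]
    by (simp add: lie_connection_def 1 2 bracket_apply[OF smooth_atI[OF f T(1)]] algebra_simps)
qed

end

section \<open>Null frames\<close>

lemma linear_on_spaceI:
  assumes "\<And>v w. v \<in> T \<Longrightarrow> w \<in> T \<Longrightarrow> f (v + w) = f v + f w"
    and "\<And>v a. v \<in> T \<Longrightarrow> f (a *\<^sub>R v) = a *\<^sub>R f v" and "subspace T"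
  shows "linear_on_space T f"
  using assms by (simp add: linear_on_space_def subspace_scale)

lemma linear_on_space_add:
  assumes "linear_on_space T f" "v \<in> T" "w \<in> T"
  shows "f (v + w) = f v + f w"
  using assms unfolding linear_on_space_def by (metis scaleR_one)

lemma linear_on_space_scale:
  assumes "linear_on_space T f" "v \<in> T"
  shows "f (a *\<^sub>R v) = a *\<^sub>R f v"
proof -
  have "f (a *\<^sub>R v + 0 *\<^sub>R v) = a *\<^sub>R f v + 0 *\<^sub>R f v"
    using assms unfolding linear_on_space_def by blast
  then show ?thesis by simp
qed

lemma linear_on_space_sum:
  assumes f: "linear_on_space T f" and T: "subspace T" and "finite B" "B \<subseteq> T"
  shows "f (\<Sum>b\<in>B. r b *\<^sub>R b) = (\<Sum>b\<in>B. r b *\<^sub>R f b)"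
  using assms(3,4)
proof (induction B)
  case empty
  show ?case using linear_on_space_scale[OF f subspace_0[OF T], of 0] by simp
next
  case (insert b B)
  then show ?case
    by (simp add: linear_on_space_add[OF f] linear_on_space_scale[OF f] subspace_scale[OF T]
        subspace_sum[OF T] subset_iff)
qed

lemma dim_1_generator:
  fixes V :: "'a::real_vector set"
  assumes "subspace V" "dim V = 1"
  obtains b where "b \<in> V" "b \<noteq> 0" "\<And>w. w \<in> V \<Longrightarrow> \<exists>r. w = r *\<^sub>R b"
proof -
  obtain B where B: "B \<subseteq> V" "independent B" "V \<subseteq> span B" "card B = dim V"
    using basis_exists by blast
  then obtain b where b: "B = {b}" using assms(2) by (metis card_1_singletonE)
  show ?thesis
  proof (rule that)
    show "b \<in> V" "b \<noteq> 0" using B b dependent_zero by auto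
    show "\<exists>r. w = r *\<^sub>R b" if "w \<in> V" for w
      using that B(3) b by (auto simp: span_singleton)
  qed
qed

lemma dim_1_multiple:
  fixes V :: "'a::real_vector set"
  assumes "subspace V" "dim V = 1" "u \<in> V" "u \<noteq> 0" "w \<in> V"
  shows "\<exists>r. w = r *\<^sub>R u"
proof -
  obtain b where b: "b \<in> V" "b \<noteq> 0" "\<And>w. w \<in> V \<Longrightarrow> \<exists>r. w = r *\<^sub>R b"
    using dim_1_generator[OF assms(1,2)] by blast
  obtain r where r: "u = r *\<^sub>R b" using b(3)[OF assms(3)] by blast
  obtain s where s: "w = s *\<^sub>R b" using b(3)[OF assms(5)] by blast
  have "w = (s / r) *\<^sub>R u" using r s assms(4) by auto
  then show ?thesis by blast
qed

section \<open>Pointwise algebra of a paracontact metric structure\<close>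

locale paracontact_manifold = affine_manifold A D
  for A :: "('m::{t2_space,second_countable_topology}, real^3) atlas" and D :: "'m connection" +
  fixes \<phi> :: "'m endo" and \<xi> :: "'m vfield" and \<eta> :: "'m oneform" and g :: "'m metric"
  assumes pcm: "paracontact_metric_manifold A \<phi> \<xi> \<eta> g"
    and lc: "levi_civita A g D"
begin

abbreviation "T \<equiv> tangent_space A"
abbreviation "vf \<equiv> vector_field_on A"

lemma apc: "almost_paracontact A \<phi> \<xi> \<eta>" and prm: "pseudo_riemannian_metric A g"
  using pcm unfolding paracontact_metric_manifold_def by simp_all

lemma vf_xi [simp]: "open S \<Longrightarrow> vf S \<xi>"
  using apc vf_subset[of UNIV \<xi> S] unfolding almost_paracontact_def by simp

lemma xi_T [simp]: "\<xi> p \<in> T p"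
  using vf_tangent[OF vf_xi[OF open_UNIV]] by simp

lemma phi_linear: "linear_on_space (T p) (\<phi> p)"
  and eta_linear: "linear_on_space (T p) (\<eta> p)"
  and phi_T [simp]: "v \<in> T p \<Longrightarrow> \<phi> p v \<in> T p"
  using apc unfolding almost_paracontact_def by blast+

lemma vf_app: "vf S X \<Longrightarrow> vf S (app \<phi> X)"
  and smooth_eta: "vf S X \<Longrightarrow> smooth_fun_on A S (\<lambda>p. \<eta> p (X p))"
  using apc unfolding almost_paracontact_def by blast+

lemma phi_xi [simp]: "\<phi> p (\<xi> p) = 0" and eta_xi [simp]: "\<eta> p (\<xi> p) = 1"
  and eta_phi [simp]: "v \<in> T p \<Longrightarrow> \<eta> p (\<phi> p v) = 0"
  and phi_phi: "v \<in> T p \<Longrightarrow> \<phi> p (\<phi> p v) = v - \<eta> p v *\<^sub>R \<xi> p"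
  and dim_plus: "dim {v \<in> T p. \<eta> p v = 0 \<and> \<phi> p v = v} = 1"
  and dim_minus: "dim {v \<in> T p. \<eta> p v = 0 \<and> \<phi> p v = - v} = 1"
  using apc unfolding almost_paracontact_def by blast+

lemma g_linear: "v \<in> T p \<Longrightarrow> linear_on_space (T p) (g p v)"
  and g_sym: "v \<in> T p \<Longrightarrow> w \<in> T p \<Longrightarrow> g p v w = g p w v"
  and g_nondeg: "v \<in> T p \<Longrightarrow> \<forall>w\<in>T p. g p v w = 0 \<Longrightarrow> v = 0"
  and smooth_g: "vf S X \<Longrightarrow> vf S Y \<Longrightarrow> smooth_fun_on A S (\<lambda>p. g p (X p) (Y p))"
  using prm unfolding pseudo_riemannian_metric_def by blast+

lemma phi_add [simp]: "v \<in> T p \<Longrightarrow> w \<in> T p \<Longrightarrow> \<phi> p (v + w) = \<phi> p v + \<phi> p w"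
  and phi_scale [simp]: "v \<in> T p \<Longrightarrow> \<phi> p (r *\<^sub>R v) = r *\<^sub>R \<phi> p v"
  and eta_add [simp]: "v \<in> T p \<Longrightarrow> w \<in> T p \<Longrightarrow> \<eta> p (v + w) = \<eta> p v + \<eta> p w"
  and eta_scale [simp]: "v \<in> T p \<Longrightarrow> \<eta> p (r *\<^sub>R v) = r * \<eta> p v"
  using linear_on_space_add[OF phi_linear] linear_on_space_scale[OF phi_linear]
    linear_on_space_add[OF eta_linear] linear_on_space_scale[OF eta_linear] by simp_all

lemma phi_zero [simp]: "\<phi> p 0 = 0" and eta_zero [simp]: "\<eta> p 0 = 0"
  using phi_scale[of 0 p 0] eta_scale[of 0 p 0] by simp_all

lemma phi_minus [simp]: "v \<in> T p \<Longrightarrow> \<phi> p (- v) = - \<phi> p v"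
  and eta_minus [simp]: "v \<in> T p \<Longrightarrow> \<eta> p (- v) = - \<eta> p v"
  using phi_scale[of v p "-1"] eta_scale[of v p "-1"] by simp_all

lemma phi_diff [simp]: "v \<in> T p \<Longrightarrow> w \<in> T p \<Longrightarrow> \<phi> p (v - w) = \<phi> p v - \<phi> p w"
  and eta_diff [simp]: "v \<in> T p \<Longrightarrow> w \<in> T p \<Longrightarrow> \<eta> p (v - w) = \<eta> p v - \<eta> p w"
  using phi_add[of v p "- w"] eta_add[of v p "- w"] by simp_all

lemma g_add_right [simp]: "x \<in> T p \<Longrightarrow> v \<in> T p \<Longrightarrow> w \<in> T p \<Longrightarrow> g p x (v + w) = g p x v + g p x w"
  and g_scale_right [simp]: "x \<in> T p \<Longrightarrow> v \<in> T p \<Longrightarrow> g p x (r *\<^sub>R v) = r * g p x v"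
  using linear_on_space_add[OF g_linear] linear_on_space_scale[OF g_linear] by simp_all

lemma g_add_left [simp]: "x \<in> T p \<Longrightarrow> v \<in> T p \<Longrightarrow> w \<in> T p \<Longrightarrow> g p (v + w) x = g p v x + g p w x"
  and g_scale_left [simp]: "x \<in> T p \<Longrightarrow> v \<in> T p \<Longrightarrow> g p (r *\<^sub>R v) x = r * g p v x"
  using g_add_right[of x p v w] g_scale_right[of x p v r] by (simp_all add: g_sym[of _ p x])

lemma g_zero [simp]: "x \<in> T p \<Longrightarrow> g p x 0 = 0" "x \<in> T p \<Longrightarrow> g p 0 x = 0"
  using g_scale_right[of x p 0 0] g_scale_left[of x p 0 0] by simp_all

lemma g_minus_right [simp]: "x \<in> T p \<Longrightarrow> v \<in> T p \<Longrightarrow> g p x (- v) = - g p x v"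
  and g_minus_left [simp]: "x \<in> T p \<Longrightarrow> v \<in> T p \<Longrightarrow> g p (- v) x = - g p v x"
  using g_scale_right[of x p v "-1"] g_scale_left[of x p v "-1"] by simp_all

lemma g_diff_right [simp]: "x \<in> T p \<Longrightarrow> v \<in> T p \<Longrightarrow> w \<in> T p \<Longrightarrow> g p x (v - w) = g p x v - g p x w"
  and g_diff_left [simp]: "x \<in> T p \<Longrightarrow> v \<in> T p \<Longrightarrow> w \<in> T p \<Longrightarrow> g p (v - w) x = g p v x - g p w x"
  using g_add_right[of x p v "- w"] g_add_left[of x p v "- w"] by simp_all

lemma g_phi_phi: "v \<in> T p \<Longrightarrow> w \<in> T p \<Longrightarrow> g p (\<phi> p v) (\<phi> p w) = - g p v w + \<eta> p v * \<eta> p w"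
  using pcm unfolding paracontact_metric_manifold_def by blast

text \<open>Compatibility with \<xi> in the first slot has left-hand side 0, because \<phi>
  annihilates \<xi>.\<close>

lemma g_xi [simp]: "v \<in> T p \<Longrightarrow> g p (\<xi> p) v = \<eta> p v" "v \<in> T p \<Longrightarrow> g p v (\<xi> p) = \<eta> p v"
  using g_phi_phi[of "\<xi> p" p v] by (simp_all add: g_sym[of v p "\<xi> p"])

lemma d_eta: "vf S X \<Longrightarrow> vf S Y \<Longrightarrow> p \<in> S \<Longrightarrow> d_oneform A \<eta> X Y p = g p (X p) (\<phi> p (Y p))"
  using pcm unfolding paracontact_metric_manifold_def by blast

lemma torsion_free: "vf S X \<Longrightarrow> vf S Y \<Longrightarrow> p \<in> S \<Longrightarrow> D X Y p - D Y X p = bracket A X Y p"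
  using lc unfolding levi_civita_def by blast

lemma D_metric:
  assumes "vf S X" "vf S Y" "vf S Z" "p \<in> S"
  shows "X p (\<lambda>q. g q (Y q) (Z q)) = g p (D X Y p) (Z p) + g p (Y p) (D X Z p)"
  using lc assms unfolding levi_civita_def by blast

definition eigenspace_plus where "eigenspace_plus p = {v \<in> T p. \<eta> p v = 0 \<and> \<phi> p v = v}"
definition eigenspace_minus where "eigenspace_minus p = {v \<in> T p. \<eta> p v = 0 \<and> \<phi> p v = - v}"

lemma subspace_eigen: "subspace (eigenspace_plus p)" "subspace (eigenspace_minus p)"
  unfolding subspace_def eigenspace_plus_def eigenspace_minus_def by (auto simp: algebra_simps)

lemma dim_eigen: "dim (eigenspace_plus p) = 1" "dim (eigenspace_minus p) = 1"
  using dim_plus dim_minus by (simp_all add: eigenspace_plus_def eigenspace_minus_def)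

lemma eigen_nonzero: "\<exists>u\<in>eigenspace_plus p. u \<noteq> 0" "\<exists>u\<in>eigenspace_minus p. u \<noteq> 0"
  by (rule dim_1_generator[OF subspace_eigen(1) dim_eigen(1), of p], blast)
    (rule dim_1_generator[OF subspace_eigen(2) dim_eigen(2), of p], blast)

lemma phi3: "w \<in> T p \<Longrightarrow> \<phi> p (\<phi> p (\<phi> p w)) = \<phi> p w"
  using phi_phi[of "\<phi> p w" p] by simp

text \<open>By \<open>phi3\<close>, these two combinations are twice the projections onto the
  eigenlines. Being built from \<phi> alone, they preserve smoothness of fields.\<close>

lemma proj_eigen:
  assumes "w \<in> T p"
  shows "\<phi> p (\<phi> p w) + \<phi> p w \<in> eigenspace_plus p" "\<phi> p (\<phi> p w) - \<phi> p w \<in> eigenspace_minus p"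
  using assms by (simp_all add: eigenspace_plus_def eigenspace_minus_def phi3 algebra_simps)

lemma decomposition:
  assumes "w \<in> T p"
  shows "w = \<eta> p w *\<^sub>R \<xi> p + (1/2) *\<^sub>R (\<phi> p (\<phi> p w) + \<phi> p w) + (1/2) *\<^sub>R (\<phi> p (\<phi> p w) - \<phi> p w)"
proof -
  have "(1/2) *\<^sub>R (\<phi> p (\<phi> p w) + \<phi> p w) + (1/2) *\<^sub>R (\<phi> p (\<phi> p w) - \<phi> p w)
    = ((1/2) + (1/2)) *\<^sub>R \<phi> p (\<phi> p w)"
    unfolding scaleR_right_distrib scaleR_right_diff_distrib scaleR_left_distrib by simp
  then show ?thesis using phi_phi[OF assms] by (simp add: add.assoc)
qed

lemma tangent_combination:
  assumes u: "u \<in> eigenspace_plus p" "u \<noteq> 0" and v: "v \<in> eigenspace_minus p" "v \<noteq> 0" and w: "w \<in> T p"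
  shows "\<exists>r s. w = \<eta> p w *\<^sub>R \<xi> p + r *\<^sub>R u + s *\<^sub>R v"
proof -
  obtain r where r: "\<phi> p (\<phi> p w) + \<phi> p w = r *\<^sub>R u"
    using dim_1_multiple[OF subspace_eigen(1) dim_eigen(1) u proj_eigen(1)[OF w]] by blast
  obtain s where s: "\<phi> p (\<phi> p w) - \<phi> p w = s *\<^sub>R v"
    using dim_1_multiple[OF subspace_eigen(2) dim_eigen(2) v proj_eigen(2)[OF w]] by blast
  show ?thesis using decomposition[OF w] unfolding r s scaleR_scaleR by blast
qed

text \<open>The tangent space has dimension at most three by the rank condition on the eigenbundles, so
  that the three independent coordinate fields span it.\<close>

lemma tangent_span_coordinate_fields:
  assumes c: "(U, c) \<in> A" "p \<in> U"
  shows "T p \<subseteq> span ((\<lambda>j. coordinate_field U c j p) ` Basis)"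
proof
  fix w assume w: "w \<in> T p"
  define C where "C = (\<lambda>j. coordinate_field U c j p) ` (Basis :: (real^3) set)"
  have C: "finite C" "independent C" "card C = 3" "C \<subseteq> T p"
    using coordinate_fields_independent[OF c] card_image[OF coordinate_fields_independent(1)[OF c]]
      vf_tangent[OF vf_coordinate_field[OF c(1)] c(2)] by (auto simp: C_def)
  obtain u where u: "u \<in> eigenspace_plus p" "u \<noteq> 0" using eigen_nonzero(1) by blast
  obtain v where v: "v \<in> eigenspace_minus p" "v \<noteq> 0" using eigen_nonzero(2) by blast
  have sp: "T p \<subseteq> span {\<xi> p, u, v}"
  proof
    fix w assume "w \<in> T p"
    then obtain r s where "w = \<eta> p w *\<^sub>R \<xi> p + r *\<^sub>R u + s *\<^sub>R v"
      using tangent_combination[OF u v] by blast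
    moreover have "\<eta> p w *\<^sub>R \<xi> p + r *\<^sub>R u + s *\<^sub>R v \<in> span {\<xi> p, u, v}"
      by (intro span_add span_scale span_base) auto
    ultimately show "w \<in> span {\<xi> p, u, v}" by simp
  qed
  have "w \<in> span C"
  proof (rule ccontr)
    \<comment> \<open>A vector outside the span would give four independent vectors in the span of
      three.\<close>
    assume n: "w \<notin> span C"
    then have "independent (insert w C)" using C(2) by (simp add: independent_insertI)
    moreover have "insert w C \<subseteq> span {\<xi> p, u, v}" using sp C(4) w by blast
    ultimately have "card (insert w C) \<le> card {\<xi> p, u, v}"
      using independent_span_bound[of "{\<xi> p, u, v}" "insert w C"] by simp
    also have "\<dots> \<le> 3" using card_length[of "[\<xi> p, u, v]"] by simp
    finally have "card (insert w C) \<le> 3" .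
    moreover have "w \<notin> C" using n span_base[of w C] by auto
    ultimately show False using C(1,3) by simp
  qed
  then show "w \<in> span ((\<lambda>j. coordinate_field U c j p) ` Basis)" by (simp add: C_def)
qed

text \<open>A linear \<open>P\<close> that kills the coordinate fields at \<open>p\<close> kills
  their span, hence the tangent space. This provides smooth fields whose projection to an eigenline
  does not vanish at \<open>p\<close>.\<close>

lemma exists_vf_nonzero:
  assumes P: "\<And>v w. v \<in> T p \<Longrightarrow> w \<in> T p \<Longrightarrow> P (v + w) = P v + P w"
     "\<And>v r. v \<in> T p \<Longrightarrow> P (r *\<^sub>R v) = r *\<^sub>R P v"
    and w: "w \<in> T p" "P w \<noteq> (0::'m tvec)"
  shows "\<exists>S X. p \<in> S \<and> vf S X \<and> P (X p) \<noteq> 0"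
proof -
  obtain U c where c: "(U, c) \<in> A" "p \<in> U" by (rule chart_at)
  have "\<exists>j\<in>Basis. P (coordinate_field U c j p) \<noteq> 0"
  proof (rule ccontr)
    assume n: "\<not> (\<exists>j\<in>Basis. P (coordinate_field U c j p) \<noteq> 0)"
    have "subspace {v \<in> T p. P v = 0}"
      unfolding subspace_def using P P(2)[of 0 0] by auto
    moreover have "(\<lambda>j. coordinate_field U c j p) ` Basis \<subseteq> {v \<in> T p. P v = 0}"
      using n vf_tangent[OF vf_coordinate_field[OF c(1)] c(2)] by auto
    ultimately have "span ((\<lambda>j. coordinate_field U c j p) ` Basis) \<subseteq> {v \<in> T p. P v = 0}"
      by (rule span_minimal[rotated])
    then show False using tangent_span_coordinate_fields[OF c] w by blast
  qed
  then show ?thesis using c vf_coordinate_field[OF c(1)] by blast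
qed

text \<open>The product 2 is the one of \<open>e + \<phi> e\<close> and \<open>e - \<phi> e\<close>
  for a \<phi>-basis. That both fields are null follows from the eigenvalue equations, see
  \<open>null_eigen\<close>.\<close>

definition null_frame :: "'m set \<Rightarrow> 'm vfield \<Rightarrow> 'm vfield \<Rightarrow> bool" where
  "null_frame S u v \<longleftrightarrow> vf S u \<and> vf S v \<and>
     (\<forall>q\<in>S. \<phi> q (u q) = u q \<and> \<phi> q (v q) = - v q \<and> g q (u q) (v q) = 2)"

text \<open>The form \<eta> vanishes on the image of \<phi>, and compatibility then reads
  \<open>g p x x = - g p x x\<close>.\<close>

lemma null_eigen:
  assumes "x \<in> T p" "\<phi> p x = x \<or> \<phi> p x = - x"
  shows "\<eta> p x = 0" "g p x x = 0"
proof -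
  show "\<eta> p x = 0" using eta_phi[OF assms(1)] eta_minus[OF assms(1)] assms(2) by fastforce
  then show "g p x x = 0" using g_phi_phi[OF assms(1,1)] assms by auto
qed

text \<open>Smooth fields are projected to the two eigenlines, and \<open>v\<close> is rescaled by
  \<open>2 / f\<close> where the product \<open>f\<close> of the projections is nonzero.\<close>

lemma null_frame_exists: "\<exists>S u v. p \<in> S \<and> null_frame S u v"
proof -
  obtain u0 where u0: "u0 \<in> eigenspace_plus p" "u0 \<noteq> 0" using eigen_nonzero(1) by blast
  obtain v0 where v0: "v0 \<in> eigenspace_minus p" "v0 \<noteq> 0" using eigen_nonzero(2) by blast
  \<comment> \<open>Each projection used below doubles the vectors of its own eigenline, so these
    sums are the images of \<open>u0\<close> and \<open>v0\<close>.\<close>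
  have "u0 + u0 \<noteq> 0" "v0 + v0 \<noteq> 0" using u0 v0 by (simp_all flip: scaleR_2)
  have "\<exists>S X. p \<in> S \<and> vf S X \<and> \<phi> p (\<phi> p (X p)) + \<phi> p (X p) \<noteq> 0"
  proof (rule exists_vf_nonzero[where w = u0 and P = "\<lambda>w. \<phi> p (\<phi> p w) + \<phi> p w"])
    show "u0 \<in> T p" "\<phi> p (\<phi> p u0) + \<phi> p u0 \<noteq> 0"
      using u0 \<open>u0 + u0 \<noteq> 0\<close> by (simp_all add: eigenspace_plus_def)
  qed (simp_all add: scaleR_right_distrib scaleR_right_diff_distrib)
  then obtain S X where X: "p \<in> S" "vf S X" "\<phi> p (\<phi> p (X p)) + \<phi> p (X p) \<noteq> 0" by blast
  have "\<exists>S X. p \<in> S \<and> vf S X \<and> \<phi> p (\<phi> p (X p)) - \<phi> p (X p) \<noteq> 0"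
  proof (rule exists_vf_nonzero[where w = v0 and P = "\<lambda>w. \<phi> p (\<phi> p w) - \<phi> p w"])
    show "v0 \<in> T p" "\<phi> p (\<phi> p v0) - \<phi> p v0 \<noteq> 0"
      using v0 \<open>v0 + v0 \<noteq> 0\<close> by (simp_all add: eigenspace_minus_def)
  qed (simp_all add: scaleR_right_distrib scaleR_right_diff_distrib)
  then obtain S' Y where Y: "p \<in> S'" "vf S' Y" "\<phi> p (\<phi> p (Y p)) - \<phi> p (Y p) \<noteq> 0" by blast
  define W where "W = S \<inter> S'"
  have W: "open W" "p \<in> W" using X Y vf_open by (auto simp: W_def)
  have XW: "vf W X" and YW: "vf W Y"
    using vf_subset[OF X(2) W(1)] vf_subset[OF Y(2) W(1)] by (auto simp: W_def)
  define u where "u = (\<lambda>q. app \<phi> (app \<phi> X) q + app \<phi> X q)"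
  define v where "v = (\<lambda>q. app \<phi> (app \<phi> Y) q - app \<phi> Y q)"
  have u: "vf W u" and v: "vf W v"
    unfolding u_def v_def by (intro vf_add vf_diff vf_app XW YW)+
  have ue: "u q \<in> eigenspace_plus q" and ve: "v q \<in> eigenspace_minus q" if "q \<in> W" for q
    using proj_eigen[OF vf_tangent[OF XW that]] proj_eigen[OF vf_tangent[OF YW that]]
    by (simp_all add: u_def v_def app_def)
  have u0: "u p \<noteq> 0" and v0: "v p \<noteq> 0" using X Y by (simp_all add: u_def v_def app_def)
  define f where "f = (\<lambda>q. g q (u q) (v q))"
  have f: "smooth_fun_on A W f" unfolding f_def by (rule smooth_g[OF u v])
  \<comment> \<open>The vector \<open>u p\<close> is orthogonal to \<xi> and to itself; were it also
    orthogonal to \<open>v p\<close>, the metric would be degenerate.\<close>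
  have "f p \<noteq> 0"
  proof
    assume 0: "f p = 0"
    have uT: "u p \<in> T p" "v p \<in> T p" using u v W vf_tangent by blast+
    have n: "\<eta> p (u p) = 0" "g p (u p) (u p) = 0"
      using null_eigen[OF uT(1)] ue[OF W(2)] by (auto simp: eigenspace_plus_def)
    have "g p (u p) w = 0" if w: "w \<in> T p" for w
    proof -
      obtain r s where "w = \<eta> p w *\<^sub>R \<xi> p + r *\<^sub>R u p + s *\<^sub>R v p"
        using tangent_combination[OF ue[OF W(2)] u0 ve[OF W(2)] v0 w] by blast
      then have "g p (u p) w = g p (u p) (\<eta> p w *\<^sub>R \<xi> p + r *\<^sub>R u p + s *\<^sub>R v p)" by simp
      then show ?thesis using uT n 0 by (simp add: f_def)
    qed
    then show False using g_nondeg[OF uT(1)] u0 by blast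
  qed
  define V where "V = {q \<in> W. f q \<noteq> 0}"
  have V: "open V" "p \<in> V" "V \<subseteq> W" using open_nonzero[OF f] \<open>f p \<noteq> 0\<close> W by (auto simp: V_def)
  have k: "smooth_fun_on A V (\<lambda>q. 2 / f q)"
    by (rule smooth_fun_on_divide[OF smooth_fun_on_const[OF V(1)] smooth_fun_on_subset[OF f V(1,3)]])
      (simp add: V_def)
  have "null_frame V u (\<lambda>q. (2 / f q) *\<^sub>R v q)"
    unfolding null_frame_def
  proof (intro conjI ballI)
    show "vf V u" "vf V (\<lambda>q. (2 / f q) *\<^sub>R v q)"
      by (intro vf_scale k vf_subset[OF u V(1,3)] vf_subset[OF v V(1,3)])+
    fix q assume q: "q \<in> V"
    then have qW: "q \<in> W" and fq: "f q \<noteq> 0" by (auto simp: V_def)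
    have uT: "u q \<in> T q" "v q \<in> T q" using u v qW vf_tangent by blast+
    show "\<phi> q (u q) = u q" using ue[OF qW] by (simp add: eigenspace_plus_def)
    show "\<phi> q ((2 / f q) *\<^sub>R v q) = - ((2 / f q) *\<^sub>R v q)"
      using ve[OF qW] by (simp add: eigenspace_minus_def)
    show "g q (u q) ((2 / f q) *\<^sub>R v q) = 2" using uT fq by (simp add: f_def)
  qed
  then show ?thesis using V(2) by blast
qed

section \<open>The tensor h and the normality tensor\<close>

lemma app_apply: "app \<phi> X p = \<phi> p (X p)"
  by (simp add: app_def)

lemma app_add:
  "vf S X \<Longrightarrow> vf S Y \<Longrightarrow> q \<in> S \<Longrightarrow> app \<phi> (\<lambda>q. X q + Y q) q = app \<phi> X q + app \<phi> Y q"
  using vf_tangent[of S X q] vf_tangent[of S Y q] by (simp add: app_def)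

lemma app_scale: "vf S X \<Longrightarrow> q \<in> S \<Longrightarrow> app \<phi> (\<lambda>q. f q *\<^sub>R X q) q = f q *\<^sub>R app \<phi> X q"
  using vf_tangent[of S X q] by (simp add: app_def)

text \<open>Both brackets contribute the derivative of \<open>f\<close> along \<xi> times
  \<open>\<phi> X\<close>, with opposite signs.\<close>

lemma tensorial_h:
  assumes p: "p \<in> S" "open S"
  shows "tensorial p (\<lambda>X. h_tensor A \<phi> \<xi> X p)"
proof (rule tensorialI[OF p(2,1)])
  fix W X Y assume W: "p \<in> W" "open W" and X: "vf W X" and Y: "vf W Y"
  note x = vf_xi[OF W(2)] and b = vf_tangent[OF vf_bracket W(1)]
  have "bracket A \<xi> (app \<phi> (\<lambda>q. X q + Y q)) p = bracket A \<xi> (\<lambda>q. app \<phi> X q + app \<phi> Y q) p"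
    by (rule bracket_cong[OF x _ x _ W(1)])
      (auto intro!: vf_app vf_add X Y app_add[OF X Y])
  then show "h_tensor A \<phi> \<xi> (\<lambda>q. X q + Y q) p = h_tensor A \<phi> \<xi> X p + h_tensor A \<phi> \<xi> Y p"
    by (simp add: h_tensor_def bracket_add_right[OF x _ _ W(1)] vf_app X Y b[OF x] algebra_simps
        del: scaleR_fun_apply flip: scaleR_right_distrib)
next
  fix W X f assume W: "p \<in> W" "open W" and X: "vf W X" and f: "smooth_fun_on A W f"
  note x = vf_xi[OF W(2)] and b = vf_tangent[OF vf_bracket W(1)]
  have "bracket A \<xi> (app \<phi> (\<lambda>q. f q *\<^sub>R X q)) p = bracket A \<xi> (\<lambda>q. f q *\<^sub>R app \<phi> X q) p"
    by (rule bracket_cong[OF x _ x _ W(1)])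
      (auto intro!: vf_app vf_scale X f app_scale[OF X])
  then show "h_tensor A \<phi> \<xi> (\<lambda>q. f q *\<^sub>R X q) p = f p *\<^sub>R h_tensor A \<phi> \<xi> X p"
    by (simp add: h_tensor_def bracket_scale_right[OF x _ f W(1)] vf_app X b[OF x] vf_tangent[OF X W(1)]
        app_apply[of X p] scaleR_right_diff_distrib scaleR_right_distrib)
qed

text \<open>Despite the name this is the full normality tensor, including the term with
  \<open>d_oneform\<close>, so that \<open>para_sasakian\<close> is its vanishing.\<close>

definition nijenhuis :: "'m vfield \<Rightarrow> 'm vfield \<Rightarrow> 'm vfield" where
  "nijenhuis X Y p = \<phi> p (\<phi> p (bracket A X Y p)) + bracket A (app \<phi> X) (app \<phi> Y) p
     - \<phi> p (bracket A (app \<phi> X) Y p) - \<phi> p (bracket A X (app \<phi> Y) p)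
     - (2 * d_oneform A \<eta> X Y p) *\<^sub>R \<xi> p"

lemma nijenhuis_anti:
  assumes X: "vf S X" and Y: "vf S Y" and p: "p \<in> S"
  shows "nijenhuis X Y p = - nijenhuis Y X p"
proof -
  note b = vf_tangent[OF vf_bracket p]
  have "d_oneform A \<eta> X Y p = - d_oneform A \<eta> Y X p"
    by (simp add: d_oneform_def bracket_anti[of X Y] b[OF Y X] field_simps)
  then show ?thesis
    by (simp add: nijenhuis_def bracket_anti[of X Y] bracket_anti[of "app \<phi> X"]
        bracket_anti[of X "app \<phi> Y"] b vf_app X Y)
qed

text \<open>Derivatives of \<open>f\<close> along \<open>X\<close> and along \<open>\<phi> X\<close>
  each occur twice with opposite signs. The exterior derivative is tensorial because
  \<open>d_eta\<close> rewrites it as a pointwise product.\<close>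

lemma tensorial_nijenhuis_2:
  assumes X: "vf S X" and p: "p \<in> S"
  shows "tensorial p (\<lambda>Y. nijenhuis X Y p)"
proof (rule tensorialI[OF vf_open[OF X] p])
  fix W Y Z assume W: "p \<in> W" "W \<subseteq> S" "open W" and Y: "vf W Y" and Z: "vf W Z"
  note X' = vf_subset[OF X W(3,2)] and b = vf_tangent[OF vf_bracket W(1)]
  have 1: "bracket A V (app \<phi> (\<lambda>q. Y q + Z q)) p = bracket A V (\<lambda>q. app \<phi> Y q + app \<phi> Z q) p"
    if V: "vf W V" for V
    by (rule bracket_cong[OF V _ V _ W(1)])
      (auto intro!: vf_app vf_add Z Y app_add[OF Y Z])
  show "nijenhuis X (\<lambda>q. Y q + Z q) p = nijenhuis X Y p + nijenhuis X Z p"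
    by (simp add: nijenhuis_def 1 X' vf_app bracket_add_right[OF _ _ _ W(1)] Y Z b d_eta[OF X' _ W(1)]
        vf_add vf_tangent[OF Y W(1)] vf_tangent[OF Z W(1)] vf_tangent[OF X p] scaleR_left_distrib
        distrib_left)
next
  fix W Y f assume W: "p \<in> W" "W \<subseteq> S" "open W" and Y: "vf W Y" and f: "smooth_fun_on A W f"
  note X' = vf_subset[OF X W(3,2)] and b = vf_tangent[OF vf_bracket W(1)]
  have 1: "bracket A V (app \<phi> (\<lambda>q. f q *\<^sub>R Y q)) p = bracket A V (\<lambda>q. f q *\<^sub>R app \<phi> Y q) p"
    if V: "vf W V" for V
    by (rule bracket_cong[OF V _ V _ W(1)])
      (auto intro!: vf_app vf_scale f Y app_scale[OF Y])
  show "nijenhuis X (\<lambda>q. f q *\<^sub>R Y q) p = f p *\<^sub>R nijenhuis X Y p"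
    by (simp add: nijenhuis_def 1 X' vf_app bracket_scale_right[OF _ _ f W(1)] Y b d_eta[OF X' _ W(1)]
        vf_scale f vf_tangent[OF Y W(1)] vf_tangent[OF X p] app_apply[of Y p]
        scaleR_right_diff_distrib scaleR_right_distrib mult_ac)
qed

lemma tensorial_nijenhuis_1:
  assumes Y: "vf S Y" and p: "p \<in> S"
  shows "tensorial p (\<lambda>X. nijenhuis X Y p)"
proof (rule tensorialI[OF vf_open[OF Y] p])
  fix W X Z assume W: "p \<in> W" "W \<subseteq> S" "open W" and X: "vf W X" and Z: "vf W Z"
  note Y' = vf_subset[OF Y W(3,2)]
  show "nijenhuis (\<lambda>q. X q + Z q) Y p = nijenhuis X Y p + nijenhuis Z Y p"
    using tensorial_add[OF tensorial_nijenhuis_2[OF Y' W(1)] W(1) X Z]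
    by (simp add: nijenhuis_anti[OF _ Y' W(1)] X Z vf_add)
next
  fix W X f assume W: "p \<in> W" "W \<subseteq> S" "open W" and X: "vf W X" and f: "smooth_fun_on A W f"
  note Y' = vf_subset[OF Y W(3,2)]
  show "nijenhuis (\<lambda>q. f q *\<^sub>R X q) Y p = f p *\<^sub>R nijenhuis X Y p"
    using tensorial_scale[OF tensorial_nijenhuis_2[OF Y' W(1)] W(1) X f]
    by (simp add: nijenhuis_anti[OF _ Y' W(1)] X f vf_scale)
qed

lemma para_sasakian_iff:
  "para_sasakian A \<phi> \<xi> \<eta> \<longleftrightarrow>
     (\<forall>S X Y. vf S X \<longrightarrow> vf S Y \<longrightarrow> (\<forall>p\<in>S. nijenhuis X Y p = 0))"
  unfolding para_sasakian_def nijenhuis_def ..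

end

section \<open>Calculus in a fixed null frame\<close>

locale null_framed = paracontact_manifold A D \<phi> \<xi> \<eta> g
  for A :: "('m::{t2_space,second_countable_topology}, real^3) atlas" and D :: "'m connection"
    and \<phi> :: "'m endo" and \<xi> :: "'m vfield" and \<eta> :: "'m oneform" and g :: "'m metric" +
  fixes S :: "'m set" and u v :: "'m vfield"
  assumes frame: "null_frame S u v"
begin

lemma vf_u [simp]: "vf S u" and vf_v [simp]: "vf S v" and open_S [simp]: "open S"
  using frame vf_open unfolding null_frame_def by blast+

lemma vf_xi_S [simp]: "vf S \<xi>"
  by simp

lemma u_T [simp]: "q \<in> S \<Longrightarrow> u q \<in> T q" and v_T [simp]: "q \<in> S \<Longrightarrow> v q \<in> T q"
  using vf_tangent vf_u vf_v by blast+

lemma phi_u [simp]: "q \<in> S \<Longrightarrow> \<phi> q (u q) = u q" and phi_v [simp]: "q \<in> S \<Longrightarrow> \<phi> q (v q) = - v q"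
  and g_u_v [simp]: "q \<in> S \<Longrightarrow> g q (u q) (v q) = 2"
  using frame unfolding null_frame_def by blast+

lemma g_v_u [simp]: "q \<in> S \<Longrightarrow> g q (v q) (u q) = 2"
  using g_sym[of "u q" q "v q"] by simp

lemma eta_u [simp]: "q \<in> S \<Longrightarrow> \<eta> q (u q) = 0" and eta_v [simp]: "q \<in> S \<Longrightarrow> \<eta> q (v q) = 0"
  and g_u_u [simp]: "q \<in> S \<Longrightarrow> g q (u q) (u q) = 0" and g_v_v [simp]: "q \<in> S \<Longrightarrow> g q (v q) (v q) = 0"
  using null_eigen[of "u q" q] null_eigen[of "v q" q] by simp_all

text \<open>Writing vectors in this form turns identities between tangent vectors into real
  arithmetic, through \<open>L_arith\<close> and \<open>L_eq_iff\<close>.\<close>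

definition L :: "'m \<Rightarrow> real \<Rightarrow> real \<Rightarrow> real \<Rightarrow> 'm tvec" where
  "L q x y z = x *\<^sub>R \<xi> q + y *\<^sub>R u q + z *\<^sub>R v q"

lemma L_T [simp]: "q \<in> S \<Longrightarrow> L q x y z \<in> T q"
  by (simp add: L_def)

lemma L_pairing [simp]:
  assumes "q \<in> S"
  shows "\<eta> q (L q x y z) = x" "g q (L q x y z) (u q) = 2 * z" "g q (L q x y z) (v q) = 2 * y"
    "g q (u q) (L q x y z) = 2 * z" "g q (v q) (L q x y z) = 2 * y"
  using assms by (simp_all add: L_def)

lemma L_add: "L q x y z + L q x' y' z' = L q (x + x') (y + y') (z + z')"
  and L_diff: "L q x y z - L q x' y' z' = L q (x - x') (y - y') (z - z')"
  and L_minus: "- L q x y z = L q (- x) (- y) (- z)"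
  and L_scale: "r *\<^sub>R L q x y z = L q (r * x) (r * y) (r * z)"
  and L_frame: "\<xi> q = L q 1 0 0" "u q = L q 0 1 0" "v q = L q 0 0 1"
  and L_zero: "L q 0 0 0 = 0"
  by (simp_all add: L_def scaleR_left_distrib scaleR_left_diff_distrib scaleR_right_distrib
      del: scaleR_fun_apply)

lemmas L_arith = L_add L_diff L_minus L_scale

lemma L_eq_iff:
  assumes "q \<in> S"
  shows "L q x y z = L q x' y' z' \<longleftrightarrow> x = x' \<and> y = y' \<and> z = z'"
  using L_pairing[OF assms, of x y z] L_pairing[OF assms, of x' y' z'] by auto

lemma L_eq_0_iff:
  assumes "q \<in> S"
  shows "L q x y z = 0 \<longleftrightarrow> x = 0 \<and> y = 0 \<and> z = 0"
  using L_eq_iff[OF assms, of x y z 0 0 0] by (simp add: L_zero)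

lemma phi_L: "q \<in> S \<Longrightarrow> \<phi> q (L q x y z) = L q 0 y (- z)"
  by (simp add: L_def)

lemma u_eigen: "q \<in> S \<Longrightarrow> u q \<in> eigenspace_plus q \<and> u q \<noteq> 0"
  and v_eigen: "q \<in> S \<Longrightarrow> v q \<in> eigenspace_minus q \<and> v q \<noteq> 0"
  using g_u_v[of q] g_v_u[of q]
  by (auto simp: eigenspace_plus_def eigenspace_minus_def simp del: g_u_v g_v_u)

text \<open>Since \<open>u\<close> and \<open>v\<close> are null with product 2, the coefficient of
  \<open>u\<close> is read off by pairing with \<open>v\<close>, and conversely, with the factor
  1/2.\<close>

lemma expansion:
  assumes q: "q \<in> S" and w: "w \<in> T q"
  shows "w = L q (\<eta> q w) (g q w (v q) / 2) (g q w (u q) / 2)"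
proof -
  obtain r s where "w = \<eta> q w *\<^sub>R \<xi> q + r *\<^sub>R u q + s *\<^sub>R v q"
    using tangent_combination[of "u q" q "v q" w] u_eigen[OF q] v_eigen[OF q] w by blast
  then have "w = L q (\<eta> q w) r s" by (simp add: L_def)
  then show ?thesis using L_pairing[OF q, of "\<eta> q w" r s] by simp
qed

lemma vf_L:
  assumes "smooth_fun_on A S x" "smooth_fun_on A S y" "smooth_fun_on A S z"
  shows "vf S (\<lambda>q. L q (x q) (y q) (z q))"
  unfolding L_def by (intro vf_add vf_scale vf_xi_S vf_u vf_v assms)

lemma const_derivative [simp]:
  "\<xi> q (\<lambda>_. r) = 0" "q \<in> S \<Longrightarrow> u q (\<lambda>_. r) = 0" "q \<in> S \<Longrightarrow> v q (\<lambda>_. r) = 0"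
  by (simp_all add: tangent_const[OF xi_T] tangent_const[OF u_T] tangent_const[OF v_T])

text \<open>The field is expanded with smooth coefficients on a whole neighbourhood; only then may
  linearity over functions be applied and the coefficients be evaluated at \<open>p\<close>.\<close>

lemma tensorial_L:
  assumes F: "tensorial p F" and p: "p \<in> S" and X: "p \<in> S'" "vf S' X" and Xp: "X p = L p x y z"
  shows "F X = x *\<^sub>R F \<xi> + y *\<^sub>R F u + z *\<^sub>R F v"
proof -
  define W where "W = S \<inter> S'"
  have W: "open W" "p \<in> W" "W \<subseteq> S" using p X vf_open by (auto simp: W_def)
  note sub = vf_subset[OF _ W(1,3)]
  have XW: "vf W X" using vf_subset[OF X(2) W(1)] by (simp add: W_def)
  define x' where "x' = (\<lambda>q. \<eta> q (X q))"
  define y' where "y' = (\<lambda>q. (1/2) * g q (X q) (v q))"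
  define z' where "z' = (\<lambda>q. (1/2) * g q (X q) (u q))"
  have s: "smooth_fun_on A W x'" "smooth_fun_on A W y'" "smooth_fun_on A W z'"
    unfolding x'_def y'_def z'_def
    by (intro smooth_eta smooth_fun_on_cmult smooth_g XW sub vf_u vf_v)+
  have vs: "vf W (\<lambda>q. x' q *\<^sub>R \<xi> q)" "vf W (\<lambda>q. y' q *\<^sub>R u q)" "vf W (\<lambda>q. z' q *\<^sub>R v q)"
    by (intro vf_scale sub vf_u vf_v vf_xi_S s)+
  have "F X = F (\<lambda>q. x' q *\<^sub>R \<xi> q + y' q *\<^sub>R u q + z' q *\<^sub>R v q)"
  proof (rule tensorial_cong[OF F W(2) XW])
    fix q assume "q \<in> W"
    then show "X q = x' q *\<^sub>R \<xi> q + y' q *\<^sub>R u q + z' q *\<^sub>R v q"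
      using expansion[of q "X q"] vf_tangent[OF XW] W(3) by (auto simp: x'_def y'_def z'_def L_def)
  qed (intro vf_add vs)
  also have "\<dots> = x' p *\<^sub>R F \<xi> + y' p *\<^sub>R F u + z' p *\<^sub>R F v"
    by (simp add: tensorial_add[OF F W(2)] tensorial_scale[OF F W(2)] vs vf_add s sub)
  also have "\<dots> = x *\<^sub>R F \<xi> + y *\<^sub>R F u + z *\<^sub>R F v"
    using p by (simp add: x'_def y'_def z'_def Xp)
  finally show ?thesis .
qed

lemma extend_vec_spec:
  assumes p: "p \<in> S" and w: "w \<in> T p"
  shows "extend_vec A p w p = w" "\<exists>W. p \<in> W \<and> vf W (extend_vec A p w)"
proof -
  \<comment> \<open>Constant coefficients in the frame give one smooth extension, which is what the
    choice in \<open>extend_vec\<close> requires.\<close>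
  define X where "X = (\<lambda>q. L q (\<eta> p w) (g p w (v p) / 2) (g p w (u p) / 2))"
  have "X p = w" using expansion[OF p w] by (simp add: X_def)
  moreover have "vf S X" unfolding X_def by (intro vf_L smooth_fun_on_const open_S)
  ultimately have "\<exists>X. X p = w \<and> (\<exists>S. p \<in> S \<and> vf S X)" using p by blast
  from someI_ex[OF this]
  show "extend_vec A p w p = w" "\<exists>W. p \<in> W \<and> vf W (extend_vec A p w)"
    by (simp_all add: extend_vec_def)
qed

lemma tensorial_extend_L:
  assumes F: "tensorial p F" and p: "p \<in> S"
  shows "F (extend_vec A p (L p x y z)) = x *\<^sub>R F \<xi> + y *\<^sub>R F u + z *\<^sub>R F v"
proof -
  obtain W where W: "p \<in> W" "vf W (extend_vec A p (L p x y z))"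
    using extend_vec_spec(2)[OF p L_T[OF p]] by blast
  show ?thesis by (rule tensorial_L[OF F p W extend_vec_spec(1)[OF p]]) (use p in simp)
qed

text \<open>Makes the choice in \<open>extend_vec\<close> irrelevant: the extension may be exchanged
  for any field with the same value at \<open>p\<close>.\<close>

lemma tensorial_extend_eq:
  assumes F: "tensorial p F" and p: "p \<in> S" and X: "p \<in> W" "vf W X"
  shows "F (extend_vec A p (X p)) = F X"
proof -
  have Xp: "X p = L p (\<eta> p (X p)) (g p (X p) (v p) / 2) (g p (X p) (u p) / 2)"
    using expansion[OF p vf_tangent[OF X(2,1)]] .
  show ?thesis
    using tensorial_extend_L[OF F p] tensorial_L[OF F p X Xp] Xp by metis
qed

lemma tensorial_extend_linear:
  assumes F: "tensorial p F" and p: "p \<in> S"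
  shows "linear_on_space (T p) (\<lambda>w. F (extend_vec A p w))"
proof (rule linear_on_spaceI[OF _ _ subspace_tangent])
  fix x y assume "x \<in> T p" "y \<in> T p"
  then obtain x0 x1 x2 y0 y1 y2 where "x = L p x0 x1 x2" "y = L p y0 y1 y2"
    using expansion[OF p] by metis
  then show "F (extend_vec A p (x + y)) = F (extend_vec A p x) + F (extend_vec A p y)"
    by (simp add: L_add tensorial_extend_L[OF F p] scaleR_left_distrib add_ac)
next
  fix x r assume "x \<in> T p"
  then obtain x0 x1 x2 where "x = L p x0 x1 x2"
    using expansion[OF p] by metis
  then show "F (extend_vec A p (r *\<^sub>R x)) = r *\<^sub>R F (extend_vec A p x)"
    by (simp add: L_scale tensorial_extend_L[OF F p] scaleR_right_distrib)
qed

section \<open>Traces\<close>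

text \<open>Pairing with \<open>b\<close> isolates \<open>r b * g p b b\<close>, and the sign
  \<open>g p b b\<close> is its own inverse.\<close>

lemma orthonormal_basis_expansion:
  assumes p: "p \<in> S" and B: "orthonormal_basis A g p B" and x: "x \<in> T p"
  shows "x = (\<Sum>b\<in>B. (g p b b * g p x b) *\<^sub>R b)"
proof -
  have f: "finite B" and sp: "span B = T p" and n: "\<And>b. b \<in> B \<Longrightarrow> g p b b = 1 \<or> g p b b = - 1"
    and o: "\<And>b b'. b \<in> B \<Longrightarrow> b' \<in> B \<Longrightarrow> b \<noteq> b' \<Longrightarrow> g p b b' = 0"
    using B unfolding orthonormal_basis_def by auto
  have BT: "B \<subseteq> T p" using sp span_superset by blast
  obtain r where r: "x = (\<Sum>b\<in>B. r b *\<^sub>R b)"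
    using x sp span_finite[OF f] by auto
  have eq: "r b = g p b b * g p x b" if b: "b \<in> B" for b
  proof -
    have bT: "b \<in> T p" using b BT by blast
    have "g p x b = g p b x" using g_sym x bT by blast
    also have "\<dots> = (\<Sum>b'\<in>B. r b' *\<^sub>R g p b b')"
      unfolding r by (rule linear_on_space_sum[OF g_linear[OF bT] subspace_tangent f BT])
    also have "\<dots> = (\<Sum>b'\<in>B. if b' = b then r b * g p b b else 0)"
      by (rule sum.cong) (use o b in auto)
    also have "\<dots> = r b * g p b b" using f b by simp
    finally show ?thesis using n[OF b] by auto
  qed
  have "(\<Sum>b\<in>B. (g p b b * g p x b) *\<^sub>R b) = (\<Sum>b\<in>B. r b *\<^sub>R b)"
    by (rule sum.cong[OF refl]) (simp only: eq)
  then show ?thesis by (rule trans[OF r sym])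
qed

lemma parseval:
  assumes p: "p \<in> S" and B: "orthonormal_basis A g p B" and x: "x \<in> T p" and y: "y \<in> T p"
  shows "(\<Sum>b\<in>B. g p b b * (g p b x * g p b y)) = g p x y"
proof -
  have f: "finite B" and BT: "B \<subseteq> T p"
    using B span_superset unfolding orthonormal_basis_def by auto
  have "g p x y = g p y x" using g_sym x y by blast
  also have "\<dots> = g p y (\<Sum>b\<in>B. (g p b b * g p x b) *\<^sub>R b)"
    using orthonormal_basis_expansion[OF p B x] by simp
  also have "\<dots> = (\<Sum>b\<in>B. (g p b b * g p x b) *\<^sub>R g p y b)"
    by (rule linear_on_space_sum[OF g_linear[OF y] subspace_tangent f BT])
  also have "\<dots> = (\<Sum>b\<in>B. g p b b * (g p b x * g p b y))"
  proof (rule sum.cong[OF refl])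
    fix b assume "b \<in> B"
    then have "b \<in> T p" using BT by blast
    then show "(g p b b * g p x b) *\<^sub>R g p y b = g p b b * (g p b x * g p b y)"
      using g_sym[of b p x] g_sym[of b p y] x y by simp
  qed
  finally show ?thesis by simp
qed

lemma orthonormal_basis_exists:
  assumes p: "p \<in> S"
  shows "\<exists>B. orthonormal_basis A g p B"
proof -
  \<comment> \<open>With \<open>f = \<phi> e\<close> one has \<open>u = e + f\<close> and
    \<open>v = e - f\<close>; thus the coefficients of \<open>e\<close> and \<open>f\<close> are the
    sum and the difference of those of \<open>u\<close> and \<open>v\<close>.\<close>
  define e where "e = L p 0 (1/2) (1/2)"
  define f where "f = L p 0 (1/2) (- 1/2)"
  have T: "e \<in> T p" "f \<in> T p" using p by (simp_all add: e_def f_def)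
  have gg: "g p e e = 1" "g p f f = - 1" "g p e f = 0" "g p f e = 0" "\<eta> p e = 0" "\<eta> p f = 0"
    "g p (\<xi> p) (\<xi> p) = 1" "g p (\<xi> p) e = 0" "g p (\<xi> p) f = 0" "g p e (\<xi> p) = 0" "g p f (\<xi> p) = 0"
    using p by (simp_all add: e_def f_def L_def)
  define B where "B = {\<xi> p, e, f}"
  have BT: "B \<subseteq> T p" using T by (simp add: B_def)
  have n: "\<And>b. b \<in> B \<Longrightarrow> g p b b \<in> {1, -1}" using gg by (auto simp: B_def)
  have o: "\<And>b b'. b \<in> B \<Longrightarrow> b' \<in> B \<Longrightarrow> b \<noteq> b' \<Longrightarrow> g p b b' = 0"
    unfolding B_def using gg by blast
  have fB: "finite B" by (simp add: B_def)
  have z: "r b = 0" if s: "(\<Sum>b\<in>B. r b *\<^sub>R b) = 0" and b: "b \<in> B" for r b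
  proof -
    have bT: "b \<in> T p" using b BT by blast
    have "0 = g p b (\<Sum>b\<in>B. r b *\<^sub>R b)" unfolding s using bT by simp
    also have "\<dots> = (\<Sum>b'\<in>B. r b' *\<^sub>R g p b b')"
      by (rule linear_on_space_sum[OF g_linear[OF bT] subspace_tangent fB BT])
    also have "\<dots> = (\<Sum>b'\<in>B. if b' = b then r b * g p b b else 0)"
      by (rule sum.cong) (use o b in auto)
    also have "\<dots> = r b * g p b b" using fB b by simp
    finally show ?thesis using n[OF b] by auto
  qed
  have i: "independent B"
    by (rule independent_if_scalars_zero[OF fB]) (erule z, assumption)
  have sB: "span B = T p"
  proof
    show "span B \<subseteq> T p" by (rule span_minimal[OF BT subspace_tangent])
    show "T p \<subseteq> span B"
    proof
      fix w assume w: "w \<in> T p"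
      have "(y - z) / 2 + (y + z) / 2 = y" "(y + z) / 2 - (y - z) / 2 = z" for y z :: real
        by (simp_all add: field_simps)
      then have "L p x y z = x *\<^sub>R \<xi> p + (y + z) *\<^sub>R e + (y - z) *\<^sub>R f" for x y z
        using L_frame(1)[of p] by (simp add: e_def f_def L_arith add.commute)
      moreover have "x *\<^sub>R \<xi> p + y *\<^sub>R e + z *\<^sub>R f \<in> span B" for x y z
        unfolding B_def by (intro span_add span_scale span_base) simp_all
      ultimately have "L p x y z \<in> span B" for x y z by simp
      then show "w \<in> span B" by (subst expansion[OF p w])
    qed
  qed
  have "orthonormal_basis A g p B"
    unfolding orthonormal_basis_def
  proof (intro conjI ballI impI)
    show "g p b b \<in> {1, -1}" if "b \<in> B" for b using that by (rule n)
    show "g p b b' = 0" if "b \<in> B" "b' \<in> B" "b \<noteq> b'" for b b' using that by (rule o)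
  qed (fact fB i sB)+
  then show ?thesis by blast
qed

text \<open>Each vector of the chosen orthonormal basis is expanded in the null frame; by
  \<open>parseval\<close> the coefficients of the nine values of \<beta> add up to entries of the
  Gram matrix. The factor 1/2 is the inverse of the product 2 of \<open>u\<close> and
  \<open>v\<close>.\<close>

lemma metric_trace_eq:
  assumes p: "p \<in> S"
    and l: "\<And>x. x \<in> T p \<Longrightarrow> linear_on_space (T p) (\<beta> x)"
    and l': "\<And>y. y \<in> T p \<Longrightarrow> linear_on_space (T p) (\<lambda>x. \<beta> x y)"
  shows "metric_trace A g p \<beta> = \<beta> (\<xi> p) (\<xi> p) + (1/2) *\<^sub>R (\<beta> (u p) (v p) + \<beta> (v p) (u p))"
proof -
  define B where "B = (SOME B. orthonormal_basis A g p B)"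
  have B: "orthonormal_basis A g p B"
    unfolding B_def by (rule someI_ex[OF orthonormal_basis_exists[OF p]])
  have BT: "B \<subseteq> T p" and sp: "span B = T p"
    using B span_superset unfolding orthonormal_basis_def by auto
  have frame_T: "\<xi> p \<in> T p" "u p \<in> T p" "v p \<in> T p" using p by simp_all
  note la = linear_on_space_add[OF l] and ls = linear_on_space_scale[OF l]
    and la' = linear_on_space_add[OF l'] and ls' = linear_on_space_scale[OF l']
  define G where "G x y = (\<Sum>b\<in>B. g p b b * (g p b x * g p b y))" for x y
  have G: "x \<in> T p \<Longrightarrow> y \<in> T p \<Longrightarrow> G x y = g p x y" for x y
    unfolding G_def by (rule parseval[OF p B])
  have exp: "g p b b *\<^sub>R \<beta> b b =
     (g p b b * (g p b (\<xi> p) * g p b (\<xi> p))) *\<^sub>R \<beta> (\<xi> p) (\<xi> p)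
   + (1/2 * (g p b b * (g p b (\<xi> p) * g p b (v p)))) *\<^sub>R \<beta> (\<xi> p) (u p)
   + (1/2 * (g p b b * (g p b (\<xi> p) * g p b (u p)))) *\<^sub>R \<beta> (\<xi> p) (v p)
   + (1/2 * (g p b b * (g p b (v p) * g p b (\<xi> p)))) *\<^sub>R \<beta> (u p) (\<xi> p)
   + (1/4 * (g p b b * (g p b (v p) * g p b (v p)))) *\<^sub>R \<beta> (u p) (u p)
   + (1/4 * (g p b b * (g p b (v p) * g p b (u p)))) *\<^sub>R \<beta> (u p) (v p)
   + (1/2 * (g p b b * (g p b (u p) * g p b (\<xi> p)))) *\<^sub>R \<beta> (v p) (\<xi> p)
   + (1/4 * (g p b b * (g p b (u p) * g p b (v p)))) *\<^sub>R \<beta> (v p) (u p)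
   + (1/4 * (g p b b * (g p b (u p) * g p b (u p)))) *\<^sub>R \<beta> (v p) (v p)" if "b \<in> B" for b
  proof -
    have b: "b \<in> T p" using that BT by blast
    have e: "\<beta> (L p x y z) (L p x y z) =
        (x * x) *\<^sub>R \<beta> (\<xi> p) (\<xi> p) + (x * y) *\<^sub>R \<beta> (\<xi> p) (u p) + (x * z) *\<^sub>R \<beta> (\<xi> p) (v p)
      + (y * x) *\<^sub>R \<beta> (u p) (\<xi> p) + (y * y) *\<^sub>R \<beta> (u p) (u p) + (y * z) *\<^sub>R \<beta> (u p) (v p)
      + (z * x) *\<^sub>R \<beta> (v p) (\<xi> p) + (z * y) *\<^sub>R \<beta> (v p) (u p) + (z * z) *\<^sub>R \<beta> (v p) (v p)" for x y z
      unfolding L_def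
      by (simp add: la ls la' ls' frame_T scaleR_right_distrib add_ac mult_ac)
    show ?thesis
      using e[of "\<eta> p b" "g p b (v p) / 2" "g p b (u p) / 2"] b
      unfolding expansion[OF p b, symmetric]
      by (simp add: scaleR_right_distrib mult_ac)
  qed
  have "metric_trace A g p \<beta> = (\<Sum>b\<in>B. g p b b *\<^sub>R \<beta> b b)"
    by (simp add: metric_trace_def B_def Let_def)
  also have "\<dots> = G (\<xi> p) (\<xi> p) *\<^sub>R \<beta> (\<xi> p) (\<xi> p)
     + (1/2 * G (\<xi> p) (v p)) *\<^sub>R \<beta> (\<xi> p) (u p) + (1/2 * G (\<xi> p) (u p)) *\<^sub>R \<beta> (\<xi> p) (v p)
     + (1/2 * G (v p) (\<xi> p)) *\<^sub>R \<beta> (u p) (\<xi> p) + (1/4 * G (v p) (v p)) *\<^sub>R \<beta> (u p) (u p)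
     + (1/4 * G (v p) (u p)) *\<^sub>R \<beta> (u p) (v p) + (1/2 * G (u p) (\<xi> p)) *\<^sub>R \<beta> (v p) (\<xi> p)
     + (1/4 * G (u p) (v p)) *\<^sub>R \<beta> (v p) (u p) + (1/4 * G (u p) (u p)) *\<^sub>R \<beta> (v p) (v p)"
    unfolding G_def sum_distrib_left scaleR_sum_left
    by (simp only: exp sum.distrib cong: sum.cong)
  also have "\<dots> = \<beta> (\<xi> p) (\<xi> p) + (1/2) *\<^sub>R (\<beta> (u p) (v p) + \<beta> (v p) (u p))"
    using p by (simp add: G frame_T scaleR_right_distrib)
  finally show ?thesis .
qed

section \<open>Connection and curvature in a null frame\<close>

lemma D_expand:
  assumes p: "p \<in> S" and X: "vf S X" and Y: "vf S Y"
    and eq: "\<And>q. q \<in> S \<Longrightarrow> Y q = L q (x q) (y q) (z q)"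
    and s: "smooth_fun_on A S x" "smooth_fun_on A S y" "smooth_fun_on A S z"
  shows "D X Y p = L p (X p x) (X p y) (X p z) + x p *\<^sub>R D X \<xi> p + y p *\<^sub>R D X u p + z p *\<^sub>R D X v p"
proof -
  have vs: "vf S (\<lambda>q. x q *\<^sub>R \<xi> q)" "vf S (\<lambda>q. y q *\<^sub>R u q)" "vf S (\<lambda>q. z q *\<^sub>R v q)"
    by (intro vf_scale vf_u vf_v vf_xi_S s)+
  have "D X Y p = D X (\<lambda>q. x q *\<^sub>R \<xi> q + y q *\<^sub>R u q + z q *\<^sub>R v q) p"
    by (rule D_cong_right[OF X Y _ p]) (auto simp: eq L_def intro!: vf_add vs)
  also have "\<dots> = (X p x *\<^sub>R \<xi> p + x p *\<^sub>R D X \<xi> p) + (X p y *\<^sub>R u p + y p *\<^sub>R D X u p)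
      + (X p z *\<^sub>R v p + z p *\<^sub>R D X v p)"
    by (simp only: D_add_right[OF vf_add[OF vs(1,2)] vs(3) X p] D_add_right[OF vs(1,2) X p]
        D_scale_right[OF X vf_xi_S s(1) p] D_scale_right[OF X vf_u s(2) p] D_scale_right[OF X vf_v s(3) p])
  finally show ?thesis by (simp add: L_def add_ac)
qed

lemma bracket_expand:
  assumes p: "p \<in> S" and X: "vf S X" and Y: "vf S Y"
    and eq: "\<And>q. q \<in> S \<Longrightarrow> Y q = L q (x q) (y q) (z q)"
    and s: "smooth_fun_on A S x" "smooth_fun_on A S y" "smooth_fun_on A S z"
  shows "bracket A X Y p = L p (X p x) (X p y) (X p z)
    + x p *\<^sub>R bracket A X \<xi> p + y p *\<^sub>R bracket A X u p + z p *\<^sub>R bracket A X v p"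
proof -
  have vs: "vf S (\<lambda>q. x q *\<^sub>R \<xi> q)" "vf S (\<lambda>q. y q *\<^sub>R u q)" "vf S (\<lambda>q. z q *\<^sub>R v q)"
    by (intro vf_scale vf_u vf_v vf_xi_S s)+
  have "bracket A X Y p = bracket A X (\<lambda>q. x q *\<^sub>R \<xi> q + y q *\<^sub>R u q + z q *\<^sub>R v q) p"
    by (rule bracket_cong[OF X Y X _ p]) (auto simp: eq L_def intro!: vf_add vs)
  also have "\<dots> = (X p x *\<^sub>R \<xi> p + x p *\<^sub>R bracket A X \<xi> p) + (X p y *\<^sub>R u p + y p *\<^sub>R bracket A X u p)
      + (X p z *\<^sub>R v p + z p *\<^sub>R bracket A X v p)"
    by (simp only: bracket_add_right[OF X vf_add[OF vs(1,2)] vs(3) p] bracket_add_right[OF X vs(1,2) p]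
        bracket_scale_right[OF X vf_xi_S s(1) p] bracket_scale_right[OF X vf_u s(2) p]
        bracket_scale_right[OF X vf_v s(3) p])
  finally show ?thesis by (simp add: L_def add_ac)
qed

text \<open>For a \<open>\<phi>\<close>-basis \<open>\<xi>, e, \<phi> e\<close> and the null frame \<open>u = e + \<phi> e\<close>, \<open>v = e - \<phi> e\<close>, the functions of
  the paper are \<open>a\<^sub>3 = aa - 1\<close>, \<open>a\<^sub>1 = (bb - cc) / 2\<close> and \<open>a\<^sub>2 = - (bb + cc) / 2\<close>, so that \<open>h\<^sup>2 = 0\<close> means
  \<open>bb * cc = 0\<close>.\<close>

definition aa where "aa q = (1/2) * g q (bracket A \<xi> u q) (v q)"
definition bb where "bb q = (1/2) * g q (bracket A \<xi> u q) (u q)"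
definition cc where "cc q = (1/2) * g q (bracket A \<xi> v q) (v q)"
definition mm where "mm q = (1/2) * g q (bracket A u v q) (v q)"
definition nn where "nn q = (1/2) * g q (bracket A u v q) (u q)"

lemma smooth_half_bracket:
  "vf S X \<Longrightarrow> vf S Y \<Longrightarrow> vf S Z \<Longrightarrow> smooth_fun_on A S (\<lambda>q. (1/2) * g q (bracket A X Y q) (Z q))"
  by (intro smooth_fun_on_cmult smooth_g vf_bracket)

lemma smooth_structure [simp]:
  "smooth_fun_on A S aa" "smooth_fun_on A S bb" "smooth_fun_on A S cc"
  "smooth_fun_on A S mm" "smooth_fun_on A S nn"
  unfolding aa_def[abs_def] bb_def[abs_def] cc_def[abs_def] mm_def[abs_def] nn_def[abs_def]
  by (rule smooth_half_bracket; simp)+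

lemma smooth_at_structure [simp]:
  "p \<in> S \<Longrightarrow> smooth_at A p aa" "p \<in> S \<Longrightarrow> smooth_at A p bb" "p \<in> S \<Longrightarrow> smooth_at A p cc"
  "p \<in> S \<Longrightarrow> smooth_at A p mm" "p \<in> S \<Longrightarrow> smooth_at A p nn"
  by (rule smooth_atI[OF smooth_structure(1)] smooth_atI[OF smooth_structure(2)]
      smooth_atI[OF smooth_structure(3)] smooth_atI[OF smooth_structure(4)]
      smooth_atI[OF smooth_structure(5)]; assumption)+

lemmas smooth_at_const [simp]

lemmas derivation_simps =
  tangent_diff[OF xi_T] tangent_diff[OF u_T] tangent_diff[OF v_T]
  tangent_minus[OF xi_T] tangent_minus[OF u_T] tangent_minus[OF v_T]
  tangent_cmult[OF xi_T] tangent_cmult[OF u_T] tangent_cmult[OF v_T]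

lemma bracket_T [simp]: "vf S X \<Longrightarrow> vf S Y \<Longrightarrow> q \<in> S \<Longrightarrow> bracket A X Y q \<in> T q"
  using vf_tangent vf_bracket by blast

lemma D_T [simp]: "vf S X \<Longrightarrow> vf S Y \<Longrightarrow> q \<in> S \<Longrightarrow> D X Y q \<in> T q"
  using vf_tangent vf_D by blast

text \<open>As \<eta> is constant on the frame, only the bracket term of its exterior derivative
  remains. For \<open>u\<close> and \<open>v\<close> the contact condition gives
  \<open>g(u, - v) = - 2\<close>, and the factor -1/2 turns this into 4.\<close>

lemma eta_bracket:
  assumes "q \<in> S"
  shows "\<eta> q (bracket A \<xi> u q) = 0" "\<eta> q (bracket A \<xi> v q) = 0" "\<eta> q (bracket A u v q) = 4"
proof -
  have *: "w (\<lambda>q. \<eta> q (\<xi> q)) = 0" "w (\<lambda>q. \<eta> q (u q)) = 0" "w (\<lambda>q. \<eta> q (v q)) = 0" if "w \<in> T q" for w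
    using that assms tangent_const[OF that]
      tangent_cong[OF that open_S, of "\<lambda>q. \<eta> q (u q)" "\<lambda>_. 0"]
      tangent_cong[OF that open_S, of "\<lambda>q. \<eta> q (v q)" "\<lambda>_. 0"] by simp_all
  show "\<eta> q (bracket A \<xi> u q) = 0" "\<eta> q (bracket A \<xi> v q) = 0" "\<eta> q (bracket A u v q) = 4"
    using d_eta[OF vf_xi_S vf_u assms] d_eta[OF vf_xi_S vf_v assms] d_eta[OF vf_u vf_v assms] assms
    by (simp_all add: d_oneform_def *)
qed

text \<open>A provisional structure function, needed until the Jacobi identity shows that it equals
  \<open>- aa\<close>.\<close>

definition dd where "dd q = (1/2) * g q (bracket A \<xi> v q) (u q)"

lemma brackets0:
  assumes "q \<in> S"
  shows "bracket A \<xi> u q = L q 0 (aa q) (bb q)" "bracket A \<xi> v q = L q 0 (cc q) (dd q)"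
    "bracket A u v q = L q 4 (mm q) (nn q)"
  using expansion[OF assms, of "bracket A \<xi> u q"] expansion[OF assms, of "bracket A \<xi> v q"]
    expansion[OF assms, of "bracket A u v q"] assms
  by (simp_all add: eta_bracket aa_def bb_def cc_def dd_def mm_def nn_def)

text \<open>These are the three components of the Jacobi identity for \<xi>, \<open>u\<close>,
  \<open>v\<close>. The \<xi>-component of the left side is 0 and that of the right side is
  \<open>4 * (aa + dd)\<close>.\<close>

lemma jacobi0:
  assumes p: "p \<in> S"
  shows "dd p = - aa p"
    and "\<xi> p mm + mm p * aa p + nn p * cc p = u p cc - v p aa + aa p * mm p + dd p * mm p"
    and "\<xi> p nn + mm p * bb p + nn p * dd p = u p dd - v p bb + aa p * nn p + dd p * nn p"
proof -
  have sd: "smooth_fun_on A S dd"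
    unfolding dd_def[abs_def] by (rule smooth_half_bracket; simp)
  note s0 = smooth_fun_on_const[OF open_S]
  have "bracket A \<xi> (bracket A u v) p = L p (\<xi> p (\<lambda>_. 4)) (\<xi> p mm) (\<xi> p nn)
    + 4 *\<^sub>R bracket A \<xi> \<xi> p + mm p *\<^sub>R bracket A \<xi> u p + nn p *\<^sub>R bracket A \<xi> v p"
    by (rule bracket_expand[OF p vf_xi_S vf_bracket[OF vf_u vf_v] brackets0(3) s0]) simp_all
  moreover have "bracket A v (bracket A \<xi> u) p = L p (v p (\<lambda>_. 0)) (v p aa) (v p bb)
    + 0 *\<^sub>R bracket A v \<xi> p + aa p *\<^sub>R bracket A v u p + bb p *\<^sub>R bracket A v v p"
    by (rule bracket_expand[OF p vf_v vf_bracket[OF vf_xi_S vf_u] brackets0(1) s0]) simp_all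
  moreover have "bracket A u (bracket A \<xi> v) p = L p (u p (\<lambda>_. 0)) (u p cc) (u p dd)
    + 0 *\<^sub>R bracket A u \<xi> p + cc p *\<^sub>R bracket A u u p + dd p *\<^sub>R bracket A u v p"
    by (rule bracket_expand[OF p vf_u vf_bracket[OF vf_xi_S vf_v] brackets0(2) s0]) (simp_all add: sd)
  ultimately have "L p 0 (\<xi> p mm + mm p * aa p + nn p * cc p) (\<xi> p nn + mm p * bb p + nn p * dd p)
    = L p (4 * aa p + 4 * dd p) (u p cc - v p aa + aa p * mm p + dd p * mm p)
        (u p dd - v p bb + aa p * nn p + dd p * nn p)"
    using bracket_jacobi[OF vf_xi_S vf_u vf_v p] p
    by (simp add: bracket_anti[of "bracket A \<xi> u" v] bracket_anti[of v u] bracket_self brackets0 L_arith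
        L_zero algebra_simps)
  then show "dd p = - aa p"
    "\<xi> p mm + mm p * aa p + nn p * cc p = u p cc - v p aa + aa p * mm p + dd p * mm p"
    "\<xi> p nn + mm p * bb p + nn p * dd p = u p dd - v p bb + aa p * nn p + dd p * nn p"
    unfolding L_eq_iff[OF p] by simp_all
qed

lemma brackets:
  assumes "q \<in> S"
  shows "bracket A \<xi> u q = L q 0 (aa q) (bb q)" "bracket A \<xi> v q = L q 0 (cc q) (- aa q)"
    "bracket A u v q = L q 4 (mm q) (nn q)"
  using brackets0[OF assms] jacobi0[OF assms] by simp_all

lemma jacobi:
  assumes p: "p \<in> S"
  shows "\<xi> p mm = u p cc - v p aa - mm p * aa p - nn p * cc p"
    and "\<xi> p nn = nn p * aa p - mm p * bb p - v p bb - u p aa"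
proof -
  have "u p dd = u p (\<lambda>q. - aa q)"
    by (rule tangent_cong[OF u_T[OF p] open_S p]) (rule jacobi0(1))
  then have "u p dd = - u p aa" using p by (simp add: derivation_simps)
  then show "\<xi> p mm = u p cc - v p aa - mm p * aa p - nn p * cc p"
    "\<xi> p nn = nn p * aa p - mm p * bb p - v p bb - u p aa"
    using jacobi0[OF p] by simp_all
qed

text \<open>The Koszul formula in linear form: the pairings of covariant derivatives with frame
  vectors are the unknowns of a linear system.\<close>

lemma D_table:
  assumes q: "q \<in> S"
  shows "D \<xi> \<xi> q = L q 0 0 0" "D \<xi> u q = L q 0 (aa q - 1) 0" "D \<xi> v q = L q 0 0 (1 - aa q)"
    "D u \<xi> q = L q 0 (- 1) (- bb q)" "D u u q = L q (2 * bb q) (- nn q) 0" "D u v q = L q 2 0 (nn q)"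
    "D v \<xi> q = L q 0 (- cc q) 1" "D v u q = L q (- 2) (- mm q) 0" "D v v q = L q (2 * cc q) 0 (mm q)"
proof -
  \<comment> \<open>The Gram matrix of the frame is constant, so metric compatibility has no
    derivative term and becomes skew-symmetry.\<close>
  have sk: "g q (D X Y q) (Z q) + g q (D X Z q) (Y q) = 0"
    if X: "vf S X" and Y: "vf S Y" and Z: "vf S Z"
      and r: "\<And>p. p \<in> S \<Longrightarrow> g p (Y p) (Z p) = r" for X Y Z r
    using D_metric[OF X Y Z q] vf_apply_const[OF X q r] g_sym[of "Y q" q "D X Z q"]
      vf_tangent[OF Y q] X Z q by simp
  have eta: "\<eta> q w = g q w (\<xi> q)" if "w \<in> T q" for w using that by simp
  have *: "g q (D X \<xi> q) (\<xi> q) = 0 \<and> g q (D X u q) (u q) = 0 \<and> g q (D X v q) (v q) = 0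
     \<and> g q (D X u q) (\<xi> q) = - g q (D X \<xi> q) (u q) \<and> g q (D X v q) (\<xi> q) = - g q (D X \<xi> q) (v q)
     \<and> g q (D X u q) (v q) = - g q (D X v q) (u q)" if X: "vf S X" for X
    using sk[OF X vf_xi_S vf_xi_S, of 1] sk[OF X vf_u vf_u, of 0] sk[OF X vf_v vf_v, of 0]
      sk[OF X vf_xi_S vf_u, of 0] sk[OF X vf_xi_S vf_v, of 0] sk[OF X vf_u vf_v, of 2] by simp
  note m = *[OF vf_xi_S] *[OF vf_u] *[OF vf_v]
  have t: "g q (D X Y q) w - g q (D Y X q) w = g q (bracket A X Y q) w"
    if X: "vf S X" and Y: "vf S Y" and w: "w \<in> T q" for X Y w
    unfolding torsion_free[OF X Y q, symmetric] using X Y w q by simp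
  have b: "g q (bracket A \<xi> u q) (\<xi> q) = 0" "g q (bracket A \<xi> u q) (u q) = 2 * bb q"
    "g q (bracket A \<xi> u q) (v q) = 2 * aa q" "g q (bracket A \<xi> v q) (\<xi> q) = 0"
    "g q (bracket A \<xi> v q) (u q) = - 2 * aa q" "g q (bracket A \<xi> v q) (v q) = 2 * cc q"
    "g q (bracket A u v q) (\<xi> q) = 4" "g q (bracket A u v q) (u q) = 2 * nn q"
    "g q (bracket A u v q) (v q) = 2 * mm q"
    using q by (simp_all add: brackets)
  note tt = t[OF vf_xi_S vf_u xi_T] t[OF vf_xi_S vf_u u_T[OF q]] t[OF vf_xi_S vf_u v_T[OF q]]
    t[OF vf_xi_S vf_v xi_T] t[OF vf_xi_S vf_v u_T[OF q]] t[OF vf_xi_S vf_v v_T[OF q]]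
    t[OF vf_u vf_v xi_T] t[OF vf_u vf_v u_T[OF q]] t[OF vf_u vf_v v_T[OF q]]
  \<comment> \<open>Pairing with \<open>v\<close> yields the coefficient of \<open>u\<close> and
    conversely; this explains the interchanged facts in the last step.\<close>
  have e: "D X Y q = L q x (y / 2) (z / 2)"
    if X: "vf S X" and Y: "vf S Y" and "g q (D X Y q) (\<xi> q) = x" "g q (D X Y q) (v q) = y"
      "g q (D X Y q) (u q) = z" for X Y x y z
    using expansion[OF q D_T[OF X Y q]] that eta[OF D_T[OF X Y q]] by simp
  \<comment> \<open>Eighteen equations from skew-symmetry and nine from torsion-freeness determine
    the 27 pairings.\<close>
  note all = m tt[unfolded b]
  have "g q (D \<xi> \<xi> q) (\<xi> q) = 0" "g q (D \<xi> \<xi> q) (u q) = 0" "g q (D \<xi> \<xi> q) (v q) = 0"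
    "g q (D \<xi> u q) (\<xi> q) = 0" "g q (D \<xi> u q) (u q) = 0" "g q (D \<xi> u q) (v q) = 2 * aa q - 2"
    "g q (D \<xi> v q) (\<xi> q) = 0" "g q (D \<xi> v q) (u q) = 2 - 2 * aa q" "g q (D \<xi> v q) (v q) = 0"
    "g q (D u \<xi> q) (\<xi> q) = 0" "g q (D u \<xi> q) (u q) = - 2 * bb q" "g q (D u \<xi> q) (v q) = - 2"
    "g q (D u u q) (\<xi> q) = 2 * bb q" "g q (D u u q) (u q) = 0" "g q (D u u q) (v q) = - 2 * nn q"
    "g q (D u v q) (\<xi> q) = 2" "g q (D u v q) (u q) = 2 * nn q" "g q (D u v q) (v q) = 0"
    "g q (D v \<xi> q) (\<xi> q) = 0" "g q (D v \<xi> q) (u q) = 2" "g q (D v \<xi> q) (v q) = - 2 * cc q"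
    "g q (D v u q) (\<xi> q) = - 2" "g q (D v u q) (u q) = 0" "g q (D v u q) (v q) = - 2 * mm q"
    "g q (D v v q) (\<xi> q) = 2 * cc q" "g q (D v v q) (u q) = 2 * mm q" "g q (D v v q) (v q) = 0"
    using all by linarith+
  note v = this
  show "D \<xi> \<xi> q = L q 0 0 0" "D \<xi> u q = L q 0 (aa q - 1) 0" "D \<xi> v q = L q 0 0 (1 - aa q)"
    "D u \<xi> q = L q 0 (- 1) (- bb q)" "D u u q = L q (2 * bb q) (- nn q) 0" "D u v q = L q 2 0 (nn q)"
    "D v \<xi> q = L q 0 (- cc q) 1" "D v u q = L q (- 2) (- mm q) 0" "D v v q = L q (2 * cc q) 0 (mm q)"
    using e[OF vf_xi_S vf_xi_S v(1) v(3) v(2)] e[OF vf_xi_S vf_u v(4) v(6) v(5)] e[OF vf_xi_S vf_v v(7) v(9) v(8)]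
      e[OF vf_u vf_xi_S v(10) v(12) v(11)] e[OF vf_u vf_u v(13) v(15) v(14)] e[OF vf_u vf_v v(16) v(18) v(17)]
      e[OF vf_v vf_xi_S v(19) v(21) v(20)] e[OF vf_v vf_u v(22) v(24) v(23)] e[OF vf_v vf_v v(25) v(27) v(26)]
    by (simp_all add: diff_divide_distrib)
qed

lemma D_left_L:
  assumes "p \<in> S" "vf S W" "vf S Z" "W p = L p x y z"
  shows "D W Z p = x *\<^sub>R D \<xi> Z p + y *\<^sub>R D u Z p + z *\<^sub>R D v Z p"
  using tensorial_L[OF tensorial_D[OF assms(3,1)] assms(1,1,2,4)] .

text \<open>The first covariant derivatives must be known on all of \<open>S\<close>, since they are
  differentiated again; the bracket is needed at \<open>p\<close> only.\<close>

lemma curvature_frame: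
  assumes p: "p \<in> S" and XYZ: "vf S X" "vf S Y" "vf S Z" and b: "bracket A X Y p = L p b0 b1 b2"
    and YZ: "\<And>q. q \<in> S \<Longrightarrow> D Y Z q = L q (x q) (y q) (z q)"
    and XZ: "\<And>q. q \<in> S \<Longrightarrow> D X Z q = L q (x' q) (y' q) (z' q)"
    and s: "smooth_fun_on A S x" "smooth_fun_on A S y" "smooth_fun_on A S z"
    and s': "smooth_fun_on A S x'" "smooth_fun_on A S y'" "smooth_fun_on A S z'"
  shows "curvature A D X Y Z p =
      (b0 *\<^sub>R D \<xi> Z p + b1 *\<^sub>R D u Z p + b2 *\<^sub>R D v Z p)
    - ((L p (X p x) (X p y) (X p z) + x p *\<^sub>R D X \<xi> p + y p *\<^sub>R D X u p + z p *\<^sub>R D X v p)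
     - (L p (Y p x') (Y p y') (Y p z') + x' p *\<^sub>R D Y \<xi> p + y' p *\<^sub>R D Y u p + z' p *\<^sub>R D Y v p))"
proof -
  have "D X (D Y Z) p = L p (X p x) (X p y) (X p z) + x p *\<^sub>R D X \<xi> p + y p *\<^sub>R D X u p + z p *\<^sub>R D X v p"
    by (rule D_expand[OF p XYZ(1) vf_D[OF XYZ(2,3)] YZ s])
  moreover have "D Y (D X Z) p =
      L p (Y p x') (Y p y') (Y p z') + x' p *\<^sub>R D Y \<xi> p + y' p *\<^sub>R D Y u p + z' p *\<^sub>R D Y v p"
    by (rule D_expand[OF p XYZ(2) vf_D[OF XYZ(1,3)] XZ s'])
  ultimately show ?thesis
    unfolding curvature_def D_left_L[OF p vf_bracket[OF XYZ(1,2)] XYZ(3) b] by (simp only:)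
qed

lemmas curvature_simps = D_table L_arith derivation_simps jacobi L_eq_iff algebra_simps

text \<open>The \<open>u\<close>-coefficient of R(u,v)u. Of all structure data the scalar curvature
  sees only this and \<open>bb * cc\<close>, so \<open>r = -6\<close> amounts to
  \<open>KK = 2\<close> once \<open>bb * cc = 0\<close>.\<close>

definition KK where
  "KK p = 4 * aa p - 6 - 2 * mm p * nn p + u p mm - v p nn - 2 * bb p * cc p"

text \<open>The rules \<open>jacobi\<close> eliminate the derivatives of \<open>mm\<close> and
  \<open>nn\<close> along \<xi>; what remains is comparison of coefficients.\<close>

lemma curvature_table:
  assumes p: "p \<in> S"
  shows "curvature A D \<xi> u \<xi> p = L p 0 (- 1 - bb p * cc p) (\<xi> p bb + 2 * bb p - 2 * aa p * bb p)" (is ?xux)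
    "curvature A D \<xi> u u p =
       L p (4 * aa p * bb p - 4 * bb p - 2 * \<xi> p bb) (- (v p bb + 2 * mm p * bb p)) 0" (is ?xuu)
    "curvature A D \<xi> u v p = L p (2 + 2 * bb p * cc p) 0 (v p bb + 2 * mm p * bb p)" (is ?xuv)
    "curvature A D \<xi> v \<xi> p = L p 0 (\<xi> p cc + 2 * aa p * cc p - 2 * cc p) (- 1 - bb p * cc p)" (is ?xvx)
    "curvature A D \<xi> v u p = L p (2 + 2 * bb p * cc p) (u p cc - 2 * nn p * cc p) 0" (is ?xvu)
    "curvature A D \<xi> v v p =
       L p (4 * cc p - 4 * aa p * cc p - 2 * \<xi> p cc) 0 (- (u p cc - 2 * nn p * cc p))" (is ?xvv)
    "curvature A D u v \<xi> p =
       L p 0 (u p cc - 2 * nn p * cc p) (- (v p bb + 2 * mm p * bb p))" (is ?uvx)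
    "curvature A D u v u p = L p (2 * v p bb + 4 * mm p * bb p) (KK p) 0" (is ?uvu)
    "curvature A D u v v p = L p (- 2 * (u p cc - 2 * nn p * cc p)) 0 (- KK p)" (is ?uvv)
proof -
  show ?xux
    by (rule trans[OF curvature_frame[OF p vf_xi_S vf_u vf_xi_S brackets(1)[OF p] D_table(4) D_table(1)]];
        simp add: p smooth_intros KK_def curvature_simps)
  show ?xuu
    by (rule trans[OF curvature_frame[OF p vf_xi_S vf_u vf_u brackets(1)[OF p] D_table(5) D_table(2)]];
        simp add: p smooth_intros KK_def curvature_simps)
  show ?xuv
    by (rule trans[OF curvature_frame[OF p vf_xi_S vf_u vf_v brackets(1)[OF p] D_table(6) D_table(3)]];
        simp add: p smooth_intros KK_def curvature_simps)
  show ?xvx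
    by (rule trans[OF curvature_frame[OF p vf_xi_S vf_v vf_xi_S brackets(2)[OF p] D_table(7) D_table(1)]];
        simp add: p smooth_intros KK_def curvature_simps)
  show ?xvu
    by (rule trans[OF curvature_frame[OF p vf_xi_S vf_v vf_u brackets(2)[OF p] D_table(8) D_table(2)]];
        simp add: p smooth_intros KK_def curvature_simps)
  show ?xvv
    by (rule trans[OF curvature_frame[OF p vf_xi_S vf_v vf_v brackets(2)[OF p] D_table(9) D_table(3)]];
        simp add: p smooth_intros KK_def curvature_simps)
  show ?uvx
    by (rule trans[OF curvature_frame[OF p vf_u vf_v vf_xi_S brackets(3)[OF p] D_table(7) D_table(4)]];
        simp add: p smooth_intros KK_def curvature_simps)
  show ?uvu
    by (rule trans[OF curvature_frame[OF p vf_u vf_v vf_u brackets(3)[OF p] D_table(8) D_table(5)]];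
        simp add: p smooth_intros KK_def curvature_simps)
  show ?uvv
    by (rule trans[OF curvature_frame[OF p vf_u vf_v vf_v brackets(3)[OF p] D_table(9) D_table(6)]];
        simp add: p smooth_intros KK_def curvature_simps)
qed

section \<open>The Lie derivative of the connection, the normality tensor and h on the frame\<close>

lemma lie_connection_frame:
  assumes p: "p \<in> S" and XY: "vf S X" "vf S Y" and b: "bracket A \<xi> X p = L p b0 b1 b2"
    and DXY: "\<And>q. q \<in> S \<Longrightarrow> D X Y q = L q (x q) (y q) (z q)"
    and bY: "\<And>q. q \<in> S \<Longrightarrow> bracket A \<xi> Y q = L q (x' q) (y' q) (z' q)"
    and s: "smooth_fun_on A S x" "smooth_fun_on A S y" "smooth_fun_on A S z"
    and s': "smooth_fun_on A S x'" "smooth_fun_on A S y'" "smooth_fun_on A S z'"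
  shows "lie_connection A \<xi> D X Y p =
      (L p (\<xi> p x) (\<xi> p y) (\<xi> p z) + x p *\<^sub>R bracket A \<xi> \<xi> p + y p *\<^sub>R bracket A \<xi> u p + z p *\<^sub>R bracket A \<xi> v p)
    - (b0 *\<^sub>R D \<xi> Y p + b1 *\<^sub>R D u Y p + b2 *\<^sub>R D v Y p)
    - (L p (X p x') (X p y') (X p z') + x' p *\<^sub>R D X \<xi> p + y' p *\<^sub>R D X u p + z' p *\<^sub>R D X v p)"
proof -
  have "bracket A \<xi> (D X Y) p = L p (\<xi> p x) (\<xi> p y) (\<xi> p z) + x p *\<^sub>R bracket A \<xi> \<xi> p
      + y p *\<^sub>R bracket A \<xi> u p + z p *\<^sub>R bracket A \<xi> v p"
    by (rule bracket_expand[OF p vf_xi_S vf_D[OF XY] DXY s])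
  moreover have "D X (bracket A \<xi> Y) p = L p (X p x') (X p y') (X p z') + x' p *\<^sub>R D X \<xi> p
      + y' p *\<^sub>R D X u p + z' p *\<^sub>R D X v p"
    by (rule D_expand[OF p XY(1) vf_bracket[OF vf_xi_S XY(2)] bY s'])
  ultimately show ?thesis
    unfolding lie_connection_def D_left_L[OF p vf_bracket[OF vf_xi_S XY(1)] XY(2) b] by (simp only:)
qed

lemma bracket_xi_xi: "bracket A \<xi> \<xi> q = L q 0 0 0"
  by (simp add: bracket_self L_zero)

text \<open>These are the only values that enter the trace over a null frame. The last two agree, as
  the Lie derivative of a torsion-free connection is symmetric.\<close>

lemma lie_connection_table:
  assumes p: "p \<in> S"
  shows "lie_connection A \<xi> D \<xi> \<xi> p = L p 0 0 0" (is ?xx)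
    "lie_connection A \<xi> D u v p = L p (- 4 * bb p * cc p) (- (u p cc - 2 * nn p * cc p)) (- (v p bb + 2 * mm p * bb p))" (is ?uv)
    "lie_connection A \<xi> D v u p = L p (- 4 * bb p * cc p) (- (u p cc - 2 * nn p * cc p)) (- (v p bb + 2 * mm p * bb p))" (is ?vu)
proof -
  show ?xx
    by (rule trans[OF lie_connection_frame[OF p vf_xi_S vf_xi_S bracket_xi_xi D_table(1) bracket_xi_xi]];
        simp add: p smooth_intros bracket_xi_xi brackets[OF p] curvature_simps)
  show ?uv
    by (rule trans[OF lie_connection_frame[OF p vf_u vf_v brackets(1)[OF p] D_table(6) brackets(2)]];
        simp add: p smooth_intros bracket_xi_xi brackets[OF p] curvature_simps)
  show ?vu
    by (rule trans[OF lie_connection_frame[OF p vf_v vf_u brackets(2)[OF p] D_table(8) brackets(1)]];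
        simp add: p smooth_intros bracket_xi_xi brackets[OF p] curvature_simps)
qed

text \<open>The eigenvalue equations hold on \<open>S\<close> only, so the fields
  \<open>app \<phi> u\<close> and \<open>app \<phi> v\<close> are replaced by congruence on that
  open set.\<close>

lemma brackets_app:
  assumes p: "p \<in> S" and X: "vf S X"
  shows "bracket A (app \<phi> \<xi>) X p = 0" "bracket A X (app \<phi> u) p = bracket A X u p"
    "bracket A X (app \<phi> v) p = - bracket A X v p"
proof -
  have "bracket A X (app \<phi> \<xi>) p = bracket A X (\<lambda>q. 0 *\<^sub>R \<xi> q) p"
    by (rule bracket_cong[OF X vf_app[OF vf_xi_S] X _ p])
      (auto simp: vf_zero app_def fun_eq_iff)
  also have "\<dots> = 0"
    using bracket_scale_right[OF X vf_xi_S smooth_fun_on_const[OF open_S, of 0] p]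
      vf_tangent[OF X p] by (simp add: tangent_const)
  finally show "bracket A (app \<phi> \<xi>) X p = 0" using bracket_anti[of "app \<phi> \<xi>" X p] by simp
  show "bracket A X (app \<phi> u) p = bracket A X u p"
    by (rule bracket_cong[OF X vf_app[OF vf_u] X vf_u p]) (simp_all add: app_def)
  have "bracket A X (app \<phi> v) p = bracket A X (\<lambda>q. (- 1) *\<^sub>R v q) p"
    by (rule bracket_cong[OF X vf_app[OF vf_v] X vf_cscale[OF vf_v] p]) (simp_all add: app_def)
  then show "bracket A X (app \<phi> v) p = - bracket A X v p"
    using bracket_scale_right[OF X vf_v smooth_fun_on_const[OF open_S, of "- 1"] p]
      vf_tangent[OF X p] by (simp add: tangent_const)
qed

lemma h_table:
  assumes p: "p \<in> S"
  shows "h_tensor A \<phi> \<xi> \<xi> p = L p 0 0 0" "h_tensor A \<phi> \<xi> u p = L p 0 0 (bb p)"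
    "h_tensor A \<phi> \<xi> v p = L p 0 (- cc p) 0"
proof -
  have 0: "bracket A \<xi> (app \<phi> \<xi>) p = L p 0 0 0"
    using brackets_app(1)[OF p vf_xi_S] bracket_anti[of \<xi> "app \<phi> \<xi>" p] by (simp add: L_zero)
  show "h_tensor A \<phi> \<xi> \<xi> p = L p 0 0 0" "h_tensor A \<phi> \<xi> u p = L p 0 0 (bb p)"
    "h_tensor A \<phi> \<xi> v p = L p 0 (- cc p) 0"
    unfolding h_tensor_def 0 brackets_app(2,3)[OF p vf_xi_S] bracket_xi_xi brackets[OF p] phi_L[OF p]
      L_arith L_eq_iff[OF p]
    by simp_all
qed

section \<open>The geometric conditions in a null frame\<close>

lemma h_L:
  assumes p: "p \<in> S" and X: "p \<in> W" "vf W X" and Xp: "X p = L p x y z"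
  shows "h_tensor A \<phi> \<xi> X p = L p 0 (- cc p * z) (bb p * y)"
  using tensorial_L[OF tensorial_h[OF p open_S] p X Xp] by (simp add: h_table[OF p] L_arith mult.commute)

lemma expansion_vf:
  assumes p: "p \<in> S" and X: "p \<in> W" "vf W X"
  obtains x y z where "X p = L p x y z"
  using expansion[OF p vf_tangent[OF X(2,1)]] by blast

lemma h_support_iff:
  assumes p: "p \<in> S"
  shows "p \<in> h_support A \<phi> \<xi> \<longleftrightarrow> bb p \<noteq> 0 \<or> cc p \<noteq> 0"
proof
  assume "p \<in> h_support A \<phi> \<xi>"
  then obtain W X where X: "p \<in> W" "vf W X" "h_tensor A \<phi> \<xi> X p \<noteq> 0"
    unfolding h_support_def by blast
  obtain x y z where "X p = L p x y z" using expansion_vf[OF p X(1,2)] .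
  then show "bb p \<noteq> 0 \<or> cc p \<noteq> 0"
    using X(3) h_L[OF p X(1,2)] by (auto simp: L_eq_0_iff[OF p])
next
  assume "bb p \<noteq> 0 \<or> cc p \<noteq> 0"
  then have "h_tensor A \<phi> \<xi> u p \<noteq> 0 \<or> h_tensor A \<phi> \<xi> v p \<noteq> 0"
    by (simp add: h_table[OF p] L_eq_0_iff[OF p])
  then show "p \<in> h_support A \<phi> \<xi>"
    unfolding h_support_def using p vf_u vf_v by blast
qed

text \<open>On \<open>u\<close> and \<open>v\<close> the \<xi>-part 4 of their bracket cancels
  against the exterior derivative, which leaves h as the only obstruction to normality.\<close>

lemma nijenhuis_table:
  assumes p: "p \<in> S"
  shows "nijenhuis \<xi> u p = L p 0 0 (2 * bb p)" "nijenhuis \<xi> v p = L p 0 (2 * cc p) 0"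
    "nijenhuis u v p = 0"
proof -
  note ba = brackets_app[OF p]
  have ba': "bracket A (app \<phi> u) X p = bracket A u X p" if "vf S X" for X
    using ba(2)[OF that] bracket_anti[of "app \<phi> u" X p] bracket_anti[of u X p] by simp
  note d = d_eta[OF vf_xi_S vf_u p] d_eta[OF vf_xi_S vf_v p] d_eta[OF vf_u vf_v p]
  show "nijenhuis \<xi> u p = L p 0 0 (2 * bb p)" "nijenhuis \<xi> v p = L p 0 (2 * cc p) 0"
    "nijenhuis u v p = 0"
    using p L_frame(1)[of p]
    by (simp_all add: nijenhuis_def d ba ba' vf_app brackets phi_L L_arith L_eq_iff L_eq_0_iff)
qed

lemma nijenhuis_self:
  assumes "vf S X" "p \<in> S"
  shows "nijenhuis X X p = 0"
  using nijenhuis_anti[OF assms(1,1,2)] by (simp add: fun_eq_iff)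

lemma nijenhuis_zero_iff:
  assumes p: "p \<in> S"
  shows "(\<forall>W X Y. p \<in> W \<longrightarrow> vf W X \<longrightarrow> vf W Y \<longrightarrow> nijenhuis X Y p = 0) \<longleftrightarrow> bb p = 0 \<and> cc p = 0"
proof (intro iffI allI impI)
  assume "\<forall>W X Y. p \<in> W \<longrightarrow> vf W X \<longrightarrow> vf W Y \<longrightarrow> nijenhuis X Y p = 0"
  then have "nijenhuis \<xi> u p = 0" "nijenhuis \<xi> v p = 0"
    using p vf_u vf_v vf_xi_S by blast+
  then show "bb p = 0 \<and> cc p = 0" by (simp add: nijenhuis_table[OF p] L_eq_0_iff[OF p])
next
  fix W X Y assume bc: "bb p = 0 \<and> cc p = 0" and W: "p \<in> W" and X: "vf W X" and Y: "vf W Y"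
  have N: "nijenhuis \<xi> u p = 0" "nijenhuis \<xi> v p = 0" "nijenhuis u v p = 0"
     "nijenhuis u \<xi> p = 0" "nijenhuis v \<xi> p = 0" "nijenhuis v u p = 0"
    using nijenhuis_table[OF p] bc nijenhuis_anti[OF vf_u vf_xi_S p] nijenhuis_anti[OF vf_v vf_xi_S p]
      nijenhuis_anti[OF vf_v vf_u p] by (simp_all add: L_zero)
  obtain x y z where Xp: "X p = L p x y z" using expansion_vf[OF p W X] .
  obtain x' y' z' where Yp: "Y p = L p x' y' z'" using expansion_vf[OF p W Y] .
  have "nijenhuis E Y p = 0" if "E = \<xi> \<or> E = u \<or> E = v" for E
  proof -
    have E: "vf S E" using that by auto
    show ?thesis
      using tensorial_L[OF tensorial_nijenhuis_2[OF E p] p W Y Yp] that N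
        nijenhuis_self[OF vf_xi_S p] nijenhuis_self[OF vf_u p] nijenhuis_self[OF vf_v p] by auto
  qed
  then show "nijenhuis X Y p = 0"
    using tensorial_L[OF tensorial_nijenhuis_1[OF Y W] p W X Xp] by simp
qed

lemma curvature_self: "vf W X \<Longrightarrow> vf W Z \<Longrightarrow> p \<in> W \<Longrightarrow> curvature A D X X Z p = 0"
  using curvature_anti[of W X X Z p] by (simp add: fun_eq_iff)

lemma curvature_L:
  assumes p: "p \<in> S" "p \<in> W" and X: "vf W X" and Y: "vf W Y" and Z: "vf W Z"
    and Xp: "X p = L p x y z" and Yp: "Y p = L p x' y' z'"
  shows "curvature A D X Y Z p = (x * y' - y * x') *\<^sub>R curvature A D \<xi> u Z p
    + (x * z' - z * x') *\<^sub>R curvature A D \<xi> v Z p + (y * z' - z * y') *\<^sub>R curvature A D u v Z p"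
proof -
  define V where "V = W \<inter> S"
  have V: "p \<in> V" "open V" "V \<subseteq> W" "V \<subseteq> S" using p vf_open[OF X] by (auto simp: V_def)
  note s = vf_subset[OF _ V(2,4)]
  note Y' = vf_subset[OF Y V(2,3)] and Z' = vf_subset[OF Z V(2,3)]
  have 1: "curvature A D E Y Z p = x' *\<^sub>R curvature A D E \<xi> Z p + y' *\<^sub>R curvature A D E u Z p
      + z' *\<^sub>R curvature A D E v Z p" if E: "vf S E" for E
    by (rule tensorial_L[OF tensorial_curvature_2[OF s[OF E] Z' V(1)] p Y Yp])
  note a = curvature_anti[OF s[OF vf_u] s[OF vf_xi_S] Z' V(1)] curvature_anti[OF s[OF vf_v] s[OF vf_xi_S] Z' V(1)]
    curvature_anti[OF s[OF vf_v] s[OF vf_u] Z' V(1)]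
    curvature_self[OF s[OF vf_xi_S] Z' V(1)] curvature_self[OF s[OF vf_u] Z' V(1)] curvature_self[OF s[OF vf_v] Z' V(1)]
  have "curvature A D X Y Z p = x *\<^sub>R curvature A D \<xi> Y Z p + y *\<^sub>R curvature A D u Y Z p
      + z *\<^sub>R curvature A D v Y Z p"
    by (rule tensorial_L[OF tensorial_curvature_1[OF Y Z p(2)] p X Xp])
  then show ?thesis
    unfolding 1[OF vf_xi_S] 1[OF vf_u] 1[OF vf_v] a
    by (simp add: scaleR_right_distrib scaleR_right_diff_distrib scaleR_left_diff_distrib mult.commute)
qed

text \<open>It suffices to compare R(\<xi>,u)\<xi> with \<open>- u + \<mu> bb v\<close>,
  R(\<xi>,v)\<xi> with \<open>- v - \<mu> cc u\<close>, and R(u,v)\<xi> with 0. The diagonal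
  coefficient \<open>- 1 - bb * cc\<close> is what ties \<kappa> = -1 to
  \<open>bb * cc = 0\<close>.\<close>

lemma kappa_mu_iff:
  assumes p: "p \<in> S"
  shows "kappa_mu_at A \<phi> \<xi> \<eta> D (\<lambda>_. -1) \<mu> p \<longleftrightarrow>
     bb p * cc p = 0 \<and> u p cc = 2 * nn p * cc p \<and> v p bb = - 2 * mm p * bb p
     \<and> \<mu> p * bb p = \<xi> p bb + 2 * bb p - 2 * aa p * bb p
     \<and> - \<mu> p * cc p = \<xi> p cc + 2 * aa p * cc p - 2 * cc p" (is "_ \<longleftrightarrow> ?R")
proof
  assume "kappa_mu_at A \<phi> \<xi> \<eta> D (\<lambda>_. -1) \<mu> p"
  then have k: "curvature A D X Y \<xi> p = L p 0
      (x' * y - x * y' + \<mu> p * cc p * (x' * z - x * z'))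
      (x' * z - x * z' + \<mu> p * bb p * (x * y' - x' * y))"
    if X: "vf S X" and Y: "vf S Y" and Xp: "X p = L p x y z" and Yp: "Y p = L p x' y' z'"
    for X Y x y z x' y' z'
  proof -
    have "curvature A D X Y \<xi> p = (-1) *\<^sub>R (\<eta> p (X p) *\<^sub>R Y p - \<eta> p (Y p) *\<^sub>R X p) +
        \<mu> p *\<^sub>R (\<eta> p (X p) *\<^sub>R h_tensor A \<phi> \<xi> Y p - \<eta> p (Y p) *\<^sub>R h_tensor A \<phi> \<xi> X p)"
      using \<open>kappa_mu_at A \<phi> \<xi> \<eta> D (\<lambda>_. -1) \<mu> p\<close> X Y p unfolding kappa_mu_at_def by blast
    then show ?thesis
      unfolding h_L[OF p p X Xp] h_L[OF p p Y Yp] Xp Yp L_pairing(1)[OF p] L_arith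
      by (simp add: algebra_simps)
  qed
  show ?R
    using k[OF vf_xi_S vf_u L_frame(1,2)] k[OF vf_xi_S vf_v L_frame(1,3)] k[OF vf_u vf_v L_frame(2,3)]
    unfolding curvature_table[OF p] L_eq_iff[OF p] by auto
next
  assume R: ?R
  show "kappa_mu_at A \<phi> \<xi> \<eta> D (\<lambda>_. -1) \<mu> p"
    unfolding kappa_mu_at_def
  proof (intro allI impI)
    fix W X Y assume W: "p \<in> W" and X: "vf W X" and Y: "vf W Y"
    obtain x y z where Xp: "X p = L p x y z" using expansion_vf[OF p W X] .
    obtain x' y' z' where Yp: "Y p = L p x' y' z'" using expansion_vf[OF p W Y] .
    have R': "bb p * cc p = 0" "u p cc = 2 * nn p * cc p" "v p bb = - 2 * mm p * bb p"
      "\<xi> p bb = \<mu> p * bb p - 2 * bb p + 2 * aa p * bb p"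
      "\<xi> p cc = - \<mu> p * cc p - 2 * aa p * cc p + 2 * cc p" using R by auto
    show "curvature A D X Y \<xi> p =
          (-1) *\<^sub>R (\<eta> p (X p) *\<^sub>R Y p - \<eta> p (Y p) *\<^sub>R X p) +
          \<mu> p *\<^sub>R (\<eta> p (X p) *\<^sub>R h_tensor A \<phi> \<xi> Y p - \<eta> p (Y p) *\<^sub>R h_tensor A \<phi> \<xi> X p)"
      unfolding curvature_L[OF p W X Y vf_xi[OF vf_open[OF X]] Xp Yp] h_L[OF p W X Xp] h_L[OF p W Y Yp]
        Xp Yp curvature_table[OF p] L_arith R' L_pairing(1)[OF p] L_eq_iff[OF p]
      by (simp add: algebra_simps)
  qed
qed

section \<open>Harmonicity, the Ricci tensor and the soliton equation\<close>

lemma lie_connection_extend: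
  assumes p: "p \<in> S" and X: "vf S X" and Y: "vf S Y"
  shows "lie_connection A \<xi> D (extend_vec A p (X p)) (extend_vec A p (Y p)) p = lie_connection A \<xi> D X Y p"
proof -
  obtain W where W: "p \<in> W" "vf W (extend_vec A p (X p))"
    using extend_vec_spec(2)[OF p vf_tangent[OF X p]] by blast
  show ?thesis
    using tensorial_extend_eq[OF tensorial_lie_connection_2[OF vf_xi[OF vf_open[OF W(2)]] W(2,1)] p p Y]
      tensorial_extend_eq[OF tensorial_lie_connection_1[OF vf_xi_S Y p] p p X] by simp
qed

text \<open>The trace is a vector whose three components give the three equations. They coincide
  with the first three in \<open>kappa_mu_iff\<close>, and this is the core of part (a).\<close>

lemma harmonic_iff:
  assumes p: "p \<in> S"
  shows "metric_trace A g p
        (\<lambda>x y. lie_connection A \<xi> D (extend_vec A p x) (extend_vec A p y) p) = 0 \<longleftrightarrow>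
     bb p * cc p = 0 \<and> u p cc = 2 * nn p * cc p \<and> v p bb = - 2 * mm p * bb p"
proof -
  let ?\<beta> = "\<lambda>x y. lie_connection A \<xi> D (extend_vec A p x) (extend_vec A p y) p"
  have l: "linear_on_space (T p) (?\<beta> x)" if x: "x \<in> T p" for x
  proof -
    obtain W where W: "p \<in> W" "vf W (extend_vec A p x)"
      using extend_vec_spec(2)[OF p x] by blast
    show ?thesis
      by (rule tensorial_extend_linear[OF tensorial_lie_connection_2[OF vf_xi[OF vf_open[OF W(2)]] W(2,1)] p])
  qed
  have l': "linear_on_space (T p) (\<lambda>x. ?\<beta> x y)" if y: "y \<in> T p" for y
  proof -
    obtain W where W: "p \<in> W" "vf W (extend_vec A p y)"
      using extend_vec_spec(2)[OF p y] by blast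
    show ?thesis
      by (rule tensorial_extend_linear[OF tensorial_lie_connection_1[OF vf_xi[OF vf_open[OF W(2)]] W(2,1)] p])
  qed
  have mt: "metric_trace A g p ?\<beta> = ?\<beta> (\<xi> p) (\<xi> p) + (1/2) *\<^sub>R (?\<beta> (u p) (v p) + ?\<beta> (v p) (u p))"
    by (rule metric_trace_eq[OF p l l'])
  have "metric_trace A g p ?\<beta> = L p (- 4 * bb p * cc p) (- (u p cc - 2 * nn p * cc p)) (- (v p bb + 2 * mm p * bb p))"
    unfolding mt lie_connection_extend[OF p vf_xi_S vf_xi_S]
      lie_connection_extend[OF p vf_u vf_v] lie_connection_extend[OF p vf_v vf_u] lie_connection_table[OF p]
    by (simp add: L_arith L_eq_iff[OF p] field_simps)
  then show ?thesis by (auto simp: L_eq_0_iff[OF p])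
qed

text \<open>The three chosen extensions are exchanged one slot at a time, using tensoriality in that
  slot while the other two arguments are fixed.\<close>

lemma curvature_extend:
  assumes p: "p \<in> S" and X: "vf S X" and Y: "vf S Y" and Z: "vf S Z"
  shows "curvature A D (extend_vec A p (X p)) (extend_vec A p (Y p)) (extend_vec A p (Z p)) p
    = curvature A D X Y Z p"
proof -
  obtain W1 where W1: "p \<in> W1" "vf W1 (extend_vec A p (X p))"
    using extend_vec_spec(2)[OF p vf_tangent[OF X p]] by blast
  obtain W2 where W2: "p \<in> W2" "vf W2 (extend_vec A p (Y p))"
    using extend_vec_spec(2)[OF p vf_tangent[OF Y p]] by blast
  define V where "V = W1 \<inter> W2 \<inter> S"
  have V: "open V" "p \<in> V" "V \<subseteq> W1" "V \<subseteq> W2" "V \<subseteq> S"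
    using W1 W2 p vf_open[OF W1(2)] vf_open[OF W2(2)] by (auto simp: V_def)
  note X' = vf_subset[OF W1(2) V(1,3)] and Y' = vf_subset[OF W2(2) V(1,4)] and Z' = vf_subset[OF Z V(1,5)]
  show ?thesis
    using tensorial_extend_eq[OF tensorial_curvature_3[OF X' Y' V(2)] p p Z]
      tensorial_extend_eq[OF tensorial_curvature_2[OF X' Z' V(2)] p p Y]
      tensorial_extend_eq[OF tensorial_curvature_1[OF Y Z p] p p X] by simp
qed

lemma curvature_T [simp]:
  "vf W X \<Longrightarrow> vf W Y \<Longrightarrow> vf W Z \<Longrightarrow> p \<in> W \<Longrightarrow> curvature A D X Y Z p \<in> T p"
  unfolding curvature_def
  by (intro tangent_minus_vec vf_tangent[OF vf_D] vf_bracket vf_D)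

text \<open>The trace formula for null frames needs a bilinear integrand, and linearity in the
  traced slot has to be shown through the chosen extension.\<close>

lemma ricci_eq:
  assumes p: "p \<in> S" and X: "vf S X" and Y: "vf S Y"
  shows "ricci A g D p (X p) (Y p) = g p (curvature A D X \<xi> Y p) (\<xi> p)
     + (g p (curvature A D X u Y p) (v p) + g p (curvature A D X v Y p) (u p)) / 2"
proof -
  obtain W1 where W1: "p \<in> W1" "vf W1 (extend_vec A p (X p))"
    using extend_vec_spec(2)[OF p vf_tangent[OF X p]] by blast
  obtain W2 where W2: "p \<in> W2" "vf W2 (extend_vec A p (Y p))"
    using extend_vec_spec(2)[OF p vf_tangent[OF Y p]] by blast
  define V where "V = W1 \<inter> W2"
  have V: "open V" "p \<in> V" "V \<subseteq> W1" "V \<subseteq> W2"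
    using W1 W2 vf_open[OF W1(2)] vf_open[OF W2(2)] by (auto simp: V_def)
  note X' = vf_subset[OF W1(2) V(1,3)] and Y' = vf_subset[OF W2(2) V(1,4)]
  let ?R = "\<lambda>z. curvature A D (extend_vec A p (X p)) (extend_vec A p z) (extend_vec A p (Y p)) p"
  have lR: "linear_on_space (T p) ?R"
    by (rule tensorial_extend_linear[OF tensorial_curvature_2[OF X' Y' V(2)] p])
  have RT: "?R z \<in> T p" if z: "z \<in> T p" for z
  proof -
    obtain W where W: "p \<in> W" "vf W (extend_vec A p z)" using extend_vec_spec(2)[OF p z] by blast
    have o: "open (V \<inter> W)" using V(1) vf_open[OF W(2)] by blast
    show ?thesis
      by (rule curvature_T[of "V \<inter> W"])
        (use o W V(2) in \<open>auto intro: vf_subset[OF X'] vf_subset[OF Y'] vf_subset[OF W(2)]\<close>)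
  qed
  have "linear_on_space (T p) (\<lambda>w. g p (?R z) w)" if "z \<in> T p" for z
    by (rule g_linear[OF RT[OF that]])
  moreover have "linear_on_space (T p) (\<lambda>z. g p (?R z) w)" if w: "w \<in> T p" for w
    by (rule linear_on_spaceI[OF _ _ subspace_tangent])
      (simp_all add: linear_on_space_add[OF lR] linear_on_space_scale[OF lR] RT w)
  ultimately have "ricci A g D p (X p) (Y p) = g p (?R (\<xi> p)) (\<xi> p)
     + (1/2) *\<^sub>R (g p (?R (u p)) (v p) + g p (?R (v p)) (u p))"
    unfolding ricci_def by (rule metric_trace_eq[OF p])
  then show ?thesis
    by (simp add: curvature_extend[OF p X _ Y])
qed

text \<open>The coefficients mixing \<xi> with \<open>u\<close> and \<open>v\<close> are those of
  \<open>harmonic_iff\<close>. Those of \<open>y * y'\<close> and \<open>z * z'\<close> are twice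
  the expressions equated with \<open>\<mu> * bb\<close> and \<open>- \<mu> * cc\<close> in
  \<open>kappa_mu_iff\<close>.\<close>

lemma ricci_L:
  assumes p: "p \<in> S"
  shows "ricci A g D p (L p x y z) (L p x' y' z') =
     x * x' * (- 2 - 2 * bb p * cc p) - (x * y' + y * x') * (v p bb + 2 * mm p * bb p)
     - (x * z' + z * x') * (u p cc - 2 * nn p * cc p)
     + y * y' * (2 * \<xi> p bb + 4 * bb p - 4 * aa p * bb p)
     + z * z' * (2 * \<xi> p cc + 4 * aa p * cc p - 4 * cc p)
     + (y * z' + z * y') * (- 2 - 2 * bb p * cc p - KK p)"
proof -
  define X where "X = (\<lambda>q. L q x y z)"
  define Y where "Y = (\<lambda>q. L q x' y' z')"
  have X: "vf S X" and Y: "vf S Y"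
    unfolding X_def Y_def by (intro vf_L smooth_fun_on_const open_S)+
  have Xp: "X p = L p x y z" and Yp: "Y p = L p x' y' z'" by (simp_all add: X_def Y_def)
  have 3: "curvature A D E F Y p = x' *\<^sub>R curvature A D E F \<xi> p + y' *\<^sub>R curvature A D E F u p
     + z' *\<^sub>R curvature A D E F v p" if "vf S E" "vf S F" for E F
    by (rule tensorial_L[OF tensorial_curvature_3[OF that p] p p Y Yp])
  have "curvature A D X \<xi> Y p = - y *\<^sub>R curvature A D \<xi> u Y p - z *\<^sub>R curvature A D \<xi> v Y p"
    using curvature_L[OF p p X vf_xi_S Y Xp L_frame(1)] by simp
  moreover have "curvature A D X u Y p = x *\<^sub>R curvature A D \<xi> u Y p - z *\<^sub>R curvature A D u v Y p"
    using curvature_L[OF p p X vf_u Y Xp L_frame(2)] by simp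
  moreover have "curvature A D X v Y p = x *\<^sub>R curvature A D \<xi> v Y p + y *\<^sub>R curvature A D u v Y p"
    using curvature_L[OF p p X vf_v Y Xp L_frame(3)] by simp
  ultimately have "ricci A g D p (X p) (Y p) =
     x * x' * (- 2 - 2 * bb p * cc p) - (x * y' + y * x') * (v p bb + 2 * mm p * bb p)
     - (x * z' + z * x') * (u p cc - 2 * nn p * cc p)
     + y * y' * (2 * \<xi> p bb + 4 * bb p - 4 * aa p * bb p)
     + z * z' * (2 * \<xi> p cc + 4 * aa p * cc p - 4 * cc p)
     + (y * z' + z * y') * (- 2 - 2 * bb p * cc p - KK p)"
    unfolding ricci_eq[OF p X Y] using p
    by (simp add: 3 curvature_table L_arith algebra_simps add_divide_distrib diff_divide_distrib)
  then show ?thesis by (simp only: Xp Yp)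
qed

lemma ricci_linear:
  assumes p: "p \<in> S" and x: "x \<in> T p"
  shows "linear_on_space (T p) (ricci A g D p x)" "linear_on_space (T p) (\<lambda>y. ricci A g D p y x)"
proof -
  obtain x0 x1 x2 where x': "x = L p x0 x1 x2" using expansion[OF p x] by blast
  have *: "\<exists>y0 y1 y2. y = L p y0 y1 y2" if "y \<in> T p" for y
    using expansion[OF p that] by blast
  show "linear_on_space (T p) (ricci A g D p x)"
    by (rule linear_on_spaceI[OF _ _ subspace_tangent])
      (auto dest!: * simp: x' L_arith ricci_L[OF p] algebra_simps)
  show "linear_on_space (T p) (\<lambda>y. ricci A g D p y x)"
    by (rule linear_on_spaceI[OF _ _ subspace_tangent])
      (auto dest!: * simp: x' L_arith ricci_L[OF p] algebra_simps)
qed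

lemma scalar_curvature_eq:
  assumes p: "p \<in> S"
  shows "scalar_curvature A g D p = - 4 - 4 * bb p * cc p - KK p"
  using metric_trace_eq[of p "ricci A g D p", OF p ricci_linear[OF p]]
    ricci_L[OF p, of 1 0 0 1 0 0] ricci_L[OF p, of 0 1 0 0 0 1] ricci_L[OF p, of 0 0 1 0 1 0]
  by (simp add: scalar_curvature_def L_frame field_simps)

lemma g_L: "p \<in> S \<Longrightarrow> g p (L p x y z) (L p x' y' z') = x * x' + 2 * y * z' + 2 * z * y'"
  by (simp add: L_def)

text \<open>In \<open>D u \<xi>\<close> and \<open>D v \<xi>\<close> the parts \<open>- u\<close>
  and \<open>v\<close> are skew for the metric and drop out after symmetrization; the entries of h
  survive.\<close>

lemma lie_metric_eq:
  assumes p: "p \<in> S" "p \<in> W" and X: "vf W X" and Y: "vf W Y"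
    and Xp: "X p = L p x y z" and Yp: "Y p = L p x' y' z'"
  shows "lie_metric A \<xi> g X Y p = - 4 * cc p * z * z' - 4 * bb p * y * y'"
proof -
  note xi = vf_xi[OF vf_open[OF X]]
  have D: "D V \<xi> p = L p 0 (- b - cc p * c) (c - bb p * b)" if "vf W V" "V p = L p a b c" for V a b c
    using tensorial_L[OF tensorial_D[OF vf_xi_S p(1)] p that] p
    by (simp add: D_table L_arith algebra_simps)
  have "D \<xi> X p \<in> T p" "D \<xi> Y p \<in> T p" "D X \<xi> p \<in> T p" "D Y \<xi> p \<in> T p" "X p \<in> T p" "Y p \<in> T p"
    using xi X Y p(2) by (auto intro: vf_tangent[of W] vf_D)
  then have "lie_metric A \<xi> g X Y p = g p (D X \<xi> p) (Y p) + g p (X p) (D Y \<xi> p)"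
    unfolding lie_metric_def D_metric[OF xi X Y p(2)] torsion_free[OF xi X p(2), symmetric]
      torsion_free[OF xi Y p(2), symmetric] by simp
  then show ?thesis
    unfolding D[OF X Xp] D[OF Y Yp] Xp Yp g_L[OF p(1)] by (simp add: algebra_simps)
qed

text \<open>The equation is tested on the six pairs of frame vectors. The (\<xi>,\<xi>)-component
  determines \<open>k\<close>, the (u,v)-component then gives \<open>KK = - k\<close>, and the
  diagonal null components give the derivatives along \<xi>.\<close>

lemma soliton_iff:
  assumes p: "p \<in> S"
  shows "(\<forall>W X Y. p \<in> W \<longrightarrow> vf W X \<longrightarrow> vf W Y \<longrightarrow>
      lie_metric A \<xi> g X Y p + ricci A g D p (X p) (Y p) = k * g p (X p) (Y p)) \<longleftrightarrow>
    k = - 2 - 2 * bb p * cc p \<and> KK p = - k \<and> v p bb = - 2 * mm p * bb p \<and> u p cc = 2 * nn p * cc p \<and>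
    \<xi> p bb = 2 * aa p * bb p \<and> \<xi> p cc = 4 * cc p - 2 * aa p * cc p" (is "?L \<longleftrightarrow> ?R")
proof
  assume ?L
  then have *: "lie_metric A \<xi> g X Y p + ricci A g D p (X p) (Y p) = k * g p (X p) (Y p)"
    if "vf S X" "vf S Y" for X Y using that p by blast
  have **: "- 4 * cc p * z * z' - 4 * bb p * y * y' + ricci A g D p (L p x y z) (L p x' y' z')
      = k * (x * x' + 2 * y * z' + 2 * z * y')"
    if "vf S X" "vf S Y" "X p = L p x y z" "Y p = L p x' y' z'" for X Y x y z x' y' z'
    using *[OF that(1,2)] lie_metric_eq[OF p p that] that(3,4) g_L[OF p] by simp
  show ?R
    using **[OF vf_xi_S vf_xi_S L_frame(1) L_frame(1)] **[OF vf_xi_S vf_u L_frame(1,2)]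
      **[OF vf_xi_S vf_v L_frame(1,3)] **[OF vf_u vf_u L_frame(2,2)] **[OF vf_u vf_v L_frame(2,3)]
      **[OF vf_v vf_v L_frame(3,3)]
    unfolding ricci_L[OF p] by simp
next
  assume R: ?R
  then have R': "k = - 2 - 2 * bb p * cc p" "KK p = 2 + 2 * bb p * cc p" "v p bb = - 2 * mm p * bb p"
    "u p cc = 2 * nn p * cc p" "\<xi> p bb = 2 * aa p * bb p" "\<xi> p cc = 4 * cc p - 2 * aa p * cc p"
    by auto
  show ?L
  proof (intro allI impI)
    fix W X Y assume W: "p \<in> W" and X: "vf W X" and Y: "vf W Y"
    obtain x y z where Xp: "X p = L p x y z" using expansion_vf[OF p W X] .
    obtain x' y' z' where Yp: "Y p = L p x' y' z'" using expansion_vf[OF p W Y] .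
    show "lie_metric A \<xi> g X Y p + ricci A g D p (X p) (Y p) = k * g p (X p) (Y p)"
      unfolding lie_metric_eq[OF p W X Y Xp Yp] Xp Yp g_L[OF p] ricci_L[OF p] R'
      by (simp add: algebra_simps)
  qed
qed

end

text \<open>Recovers \<open>e\<close> and \<open>\<phi> e\<close> from the null frame
  \<open>e + \<phi> e\<close>, \<open>e - \<phi> e\<close>.\<close>

lemma half_sum_diff:
  fixes x y :: "'a::real_vector"
  shows "(1/2) *\<^sub>R (x + y) + (1/2) *\<^sub>R (x - y) = x"
    and "(1/2) *\<^sub>R (x + y) - (1/2) *\<^sub>R (x - y) = y"
  by (simp_all add: scaleR_right_distrib scaleR_right_diff_distrib flip: scaleR_left_distrib)

section \<open>From frames back to the manifold\<close>

context paracontact_manifold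
begin

lemma null_framedI: "null_frame S u v \<Longrightarrow> null_framed A D \<phi> \<xi> \<eta> g S u v"
  by unfold_locales

lemma null_framed_at:
  obtains S u v where "p \<in> S" "null_framed A D \<phi> \<xi> \<eta> g S u v"
  using null_frame_exists null_framedI by metis

text \<open>Allows a prescribed \<phi>-basis to be computed with in its own null frame on its whole
  domain. Here \<phi> squares to the identity on \<open>e\<close> because \<eta> vanishes on
  it.\<close>

lemma phi_basis_null_framed:
  assumes "phi_basis_on A \<phi> \<xi> g V e"
  shows "null_framed A D \<phi> \<xi> \<eta> g V (\<lambda>q. e q + \<phi> q (e q)) (\<lambda>q. e q - \<phi> q (e q))"
proof (rule null_framedI)
  have e: "vf V e" using assms by (simp add: phi_basis_on_def)
  show "null_frame V (\<lambda>q. e q + \<phi> q (e q)) (\<lambda>q. e q - \<phi> q (e q))"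
    unfolding null_frame_def
  proof (intro conjI ballI)
    show "vf V (\<lambda>q. e q + \<phi> q (e q))" "vf V (\<lambda>q. e q - \<phi> q (e q))"
      using vf_add[OF e vf_app[OF e]] vf_diff[OF e vf_app[OF e]] by (simp_all add: app_apply)
    fix q assume q: "q \<in> V"
    have eT: "e q \<in> T q" by (rule vf_tangent[OF e q])
    have *: "g q (e q) (e q) = 1" "g q (\<phi> q (e q)) (\<phi> q (e q)) = -1" "g q (\<xi> q) (e q) = 0"
      "g q (e q) (\<phi> q (e q)) = 0" using assms q unfolding phi_basis_on_def by blast+
    then have "\<phi> q (\<phi> q (e q)) = e q" using phi_phi[OF eT] eT by simp
    then show "\<phi> q (e q + \<phi> q (e q)) = e q + \<phi> q (e q)"
      "\<phi> q (e q - \<phi> q (e q)) = - (e q - \<phi> q (e q))"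
      using eT by (simp_all add: add.commute)
    show "g q (e q + \<phi> q (e q)) (e q - \<phi> q (e q)) = 2"
      using * eT g_sym[OF phi_T[OF eT] eT] by simp
  qed
qed

lemma para_sasakian_iff_h_support: "para_sasakian A \<phi> \<xi> \<eta> \<longleftrightarrow> h_support A \<phi> \<xi> = {}"
proof -
  have "(\<forall>W X Y. p \<in> W \<longrightarrow> vf W X \<longrightarrow> vf W Y \<longrightarrow> nijenhuis X Y p = 0) \<longleftrightarrow> p \<notin> h_support A \<phi> \<xi>" for p
  proof -
    obtain S u v where p: "p \<in> S" and "null_framed A D \<phi> \<xi> \<eta> g S u v" by (rule null_framed_at)
    then interpret null_framed A D \<phi> \<xi> \<eta> g S u v by simp
    show ?thesis using nijenhuis_zero_iff[OF p] h_support_iff[OF p] by simp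
  qed
  then show ?thesis unfolding para_sasakian_iff by blast
qed

end

text \<open>The condition at \<open>p\<close> sees \<mu> through its value there only, so \<mu> may
  be chosen point by point.\<close>

lemma kappa_mu_at_cong:
  assumes "\<mu> p = \<mu>' p" "kappa_mu_at A \<phi> \<xi> \<eta> D \<kappa> \<mu> p"
  shows "kappa_mu_at A \<phi> \<xi> \<eta> D \<kappa> \<mu>' p"
  using assms(2) unfolding kappa_mu_at_def assms(1) .

section \<open>The function \<mu>, locally and globally\<close>

context null_framed
begin

text \<open>Demanded on all of \<open>S\<close> because the vanishing of one structure function on a
  neighbourhood is differentiated.\<close>

definition harmonic_conditions :: bool where
  "harmonic_conditions \<longleftrightarrow>
     (\<forall>q\<in>S. bb q * cc q = 0 \<and> u q cc = 2 * nn q * cc q \<and> v q bb = - 2 * mm q * bb q)"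

lemma kappa_mu_unique:
  assumes p: "p \<in> S" "p \<in> h_support A \<phi> \<xi>"
    and "kappa_mu_at A \<phi> \<xi> \<eta> D (\<lambda>_. -1) \<mu> p" "kappa_mu_at A \<phi> \<xi> \<eta> D (\<lambda>_. -1) \<mu>' p"
  shows "\<mu> p = \<mu>' p"
proof -
  have "\<mu> p * bb p = \<mu>' p * bb p" "\<mu> p * cc p = \<mu>' p * cc p"
    using assms(3)[unfolded kappa_mu_iff[OF p(1)]] assms(4)[unfolded kappa_mu_iff[OF p(1)]]
    by linarith+
  then show ?thesis using p(2) unfolding h_support_iff[OF p(1)] by auto
qed

lemma kappa_mu_local:
  assumes H: "harmonic_conditions" and p: "p \<in> S" "p \<in> h_support A \<phi> \<xi>"
  shows "\<exists>W \<mu>. p \<in> W \<and> W \<subseteq> h_support A \<phi> \<xi> \<and> smooth_fun_on A W \<mu> \<and>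
     (\<forall>q\<in>W. kappa_mu_at A \<phi> \<xi> \<eta> D (\<lambda>_. -1) \<mu> q)"
proof -
  have bc: "bb q * cc q = 0" "u q cc = 2 * nn q * cc q" "v q bb = - 2 * mm q * bb q" if "q \<in> S" for q
    using H that unfolding harmonic_conditions_def by blast+
  have xs: "smooth_fun_on A S (\<lambda>q. \<xi> q f)" if "smooth_fun_on A S f" for f
    by (rule vf_smooth[OF vf_xi_S that]) simp
  have vanish: "\<xi> q f = 0" if "open W" "q \<in> W" "\<And>r. r \<in> W \<Longrightarrow> f r = 0" for W q f
    using vf_apply_const[OF vf_xi[OF that(1)] that(2,3)] .
  consider "bb p \<noteq> 0" | "cc p \<noteq> 0" using p(2) unfolding h_support_iff[OF p(1)] by blast
  then show ?thesis
  proof cases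
    case 1
    define W where "W = {q \<in> S. bb q \<noteq> 0}"
    \<comment> \<open>Solved from the equation for \<open>\<mu> * bb\<close> in
      \<open>kappa_mu_iff\<close>.\<close>
    define \<mu> where "\<mu> q = (\<xi> q bb + 2 * bb q - 2 * (aa q * bb q)) / bb q" for q
    have W: "open W" "W \<subseteq> S" "p \<in> W" using 1 p open_nonzero by (auto simp: W_def)
    \<comment> \<open>As \<open>cc\<close> vanishes on the open set \<open>W\<close>, so does its
      derivative along \<xi>, and the equation containing \<open>cc\<close> becomes 0 = 0.\<close>
    have c: "cc q = 0" if "q \<in> W" for q using bc(1)[of q] that by (auto simp: W_def)
    have "smooth_fun_on A W \<mu>"
      unfolding \<mu>_def
      by (rule smooth_fun_on_divide)
        (auto simp: W_def[symmetric] intro!: smooth_fun_on_subset[OF _ W(1,2)] smooth_intros xs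
          smooth_structure smooth_fun_on_const[OF open_S], simp add: W_def)
    moreover have "kappa_mu_at A \<phi> \<xi> \<eta> D (\<lambda>_. -1) \<mu> q" if q: "q \<in> W" for q
    proof -
      have qS: "q \<in> S" and bq: "bb q \<noteq> 0" using q by (auto simp: W_def)
      show ?thesis
        unfolding kappa_mu_iff[OF qS] \<mu>_def
        using bc[OF qS] c[OF q] vanish[of W q cc, OF W(1) q c] bq by simp
    qed
    moreover have "W \<subseteq> h_support A \<phi> \<xi>" using h_support_iff by (auto simp: W_def)
    ultimately show ?thesis using W(3) by blast
  next
    case 2
    define W where "W = {q \<in> S. cc q \<noteq> 0}"
    \<comment> \<open>The minus sign comes from h v = - \<open>cc\<close> u.\<close>
    define \<mu> where "\<mu> q = - ((\<xi> q cc + 2 * (aa q * cc q) - 2 * cc q) / cc q)" for q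
    have W: "open W" "W \<subseteq> S" "p \<in> W" using 2 p open_nonzero by (auto simp: W_def)
    have c: "bb q = 0" if "q \<in> W" for q using bc(1)[of q] that by (auto simp: W_def)
    have "smooth_fun_on A W \<mu>"
      unfolding \<mu>_def
      by (rule smooth_fun_on_minus, rule smooth_fun_on_divide)
        (auto simp: W_def[symmetric] intro!: smooth_fun_on_subset[OF _ W(1,2)] smooth_intros xs
          smooth_structure smooth_fun_on_const[OF open_S], simp add: W_def)
    moreover have "kappa_mu_at A \<phi> \<xi> \<eta> D (\<lambda>_. -1) \<mu> q" if q: "q \<in> W" for q
    proof -
      have qS: "q \<in> S" and bq: "cc q \<noteq> 0" using q by (auto simp: W_def)
      show ?thesis
        unfolding kappa_mu_iff[OF qS] \<mu>_def
        using bc[OF qS] c[OF q] vanish[of W q bb, OF W(1) q c] bq by simp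
    qed
    moreover have "W \<subseteq> h_support A \<phi> \<xi>" using h_support_iff by (auto simp: W_def)
    ultimately show ?thesis using W(3) by blast
  qed
qed

lemma harmonic_imp_conditions:
  assumes "infinitesimal_harmonic A g D \<xi>"
  shows "harmonic_conditions"
  using assms harmonic_iff unfolding infinitesimal_harmonic_def harmonic_conditions_def by blast

end

context paracontact_manifold
begin

text \<open>The local functions fit together because \<mu> is determined wherever h is nonzero
  (\<open>kappa_mu_unique\<close>).\<close>

lemma harmonic_kappa_mu_space:
  assumes "infinitesimal_harmonic A g D \<xi>"
  shows "\<exists>\<mu>. kappa_mu_space_on A \<phi> \<xi> \<eta> D (h_support A \<phi> \<xi>) (\<lambda>_. -1) \<mu>"
proof -
  let ?H = "h_support A \<phi> \<xi>"
  \<comment> \<open>An arbitrary admissible value at each point; smoothness is recovered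
    afterwards.\<close>
  define \<mu> where "\<mu> p = (SOME m. kappa_mu_at A \<phi> \<xi> \<eta> D (\<lambda>_. -1) (\<lambda>_. m) p)" for p
  have loc: "\<exists>W f. p \<in> W \<and> W \<subseteq> ?H \<and> smooth_fun_on A W f \<and>
     (\<forall>q\<in>W. kappa_mu_at A \<phi> \<xi> \<eta> D (\<lambda>_. -1) f q)" if p: "p \<in> ?H" for p
  proof -
    obtain S u v where pS: "p \<in> S" and "null_framed A D \<phi> \<xi> \<eta> g S u v" by (rule null_framed_at)
    then interpret null_framed A D \<phi> \<xi> \<eta> g S u v by simp
    show ?thesis by (rule kappa_mu_local[OF harmonic_imp_conditions[OF assms] pS p])
  qed
  have km: "kappa_mu_at A \<phi> \<xi> \<eta> D (\<lambda>_. -1) \<mu> p" if p: "p \<in> ?H" for p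
  proof -
    obtain W f where "p \<in> W" "\<forall>q\<in>W. kappa_mu_at A \<phi> \<xi> \<eta> D (\<lambda>_. -1) f q" using loc[OF p] by blast
    then have "kappa_mu_at A \<phi> \<xi> \<eta> D (\<lambda>_. -1) (\<lambda>_. f p) p" by (auto intro: kappa_mu_at_cong[of f])
    then have "kappa_mu_at A \<phi> \<xi> \<eta> D (\<lambda>_. -1) (\<lambda>_. \<mu> p) p" unfolding \<mu>_def by (rule someI)
    then show ?thesis by (rule kappa_mu_at_cong[rotated]) simp
  qed
  have "open ?H"
  proof (subst open_subopen, intro ballI)
    fix p assume "p \<in> ?H"
    then obtain W f where "p \<in> W" "W \<subseteq> ?H" "smooth_fun_on A W f" using loc by blast
    then show "\<exists>W. open W \<and> p \<in> W \<and> W \<subseteq> ?H" using smooth_fun_on_open by blast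
  qed
  then have "smooth_fun_on A ?H \<mu>"
  proof (rule smooth_fun_on_local)
    fix p assume p: "p \<in> ?H"
    obtain W f where W: "p \<in> W" "W \<subseteq> ?H" "smooth_fun_on A W f"
      and f: "\<And>q. q \<in> W \<Longrightarrow> kappa_mu_at A \<phi> \<xi> \<eta> D (\<lambda>_. -1) f q" using loc[OF p] by blast
    \<comment> \<open>Uniqueness identifies the pointwise choice with the smooth local solution, and
      smoothness is local.\<close>
    have "f q = \<mu> q" if q: "q \<in> W" for q
    proof -
      obtain S u v where qS: "q \<in> S" and "null_framed A D \<phi> \<xi> \<eta> g S u v" by (rule null_framed_at)
      then interpret null_framed A D \<phi> \<xi> \<eta> g S u v by simp
      have qH: "q \<in> ?H" using W(2) q by blast
      show ?thesis by (rule kappa_mu_unique[OF qS qH f[OF q] km[OF qH]])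
    qed
    then show "\<exists>W. p \<in> W \<and> smooth_fun_on A W \<mu>" using W(1) smooth_fun_on_cong[OF W(3)] by blast
  qed
  moreover have "smooth_fun_on A ?H (\<lambda>_. -1)" by (rule smooth_fun_on_const) fact
  ultimately show ?thesis unfolding kappa_mu_space_on_def using km by blast
qed

text \<open>In the null frame of the \<phi>-basis, \<open>bb = a1 - a2\<close> and
  \<open>cc = - (a1 + a2)\<close>, so \<open>bb * cc = 0\<close> is
  \<open>a2 = \<epsilon> a1\<close>. The sign is chosen separately at each point.\<close>

lemma phi_basis_formula:
  assumes e: "phi_basis_on A \<phi> \<xi> g V e"
    and h: "\<forall>p\<in>V. h_tensor A \<phi> \<xi> e p = a1 p *\<^sub>R e p + a2 p *\<^sub>R \<phi> p (e p)"
    and harm: "infinitesimal_harmonic A g D \<xi>"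
    and km: "\<And>p. p \<in> h_support A \<phi> \<xi> \<Longrightarrow> kappa_mu_at A \<phi> \<xi> \<eta> D (\<lambda>_. -1) \<mu> p"
    and p: "p \<in> V"
  shows "\<exists>\<epsilon>\<in>{1, -1}. a2 p = \<epsilon> * a1 p \<and>
      (p \<in> h_support A \<phi> \<xi> \<longrightarrow> a1 p \<noteq> 0 \<and>
         (let a3 = g p (D \<xi> (app \<phi> e) p) (e p);
              AA = \<xi> p a1 + 2 * \<epsilon> * a1 p * a3
          in \<mu> p = - \<epsilon> * AA / a1 p))"
proof -
  interpret null_framed A D \<phi> \<xi> \<eta> g V "\<lambda>q. e q + \<phi> q (e q)" "\<lambda>q. e q - \<phi> q (e q)"
    by (rule phi_basis_null_framed[OF e])
  have ve: "vf V e" using e by (simp add: phi_basis_on_def)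
  have eL: "e q = L q 0 (1/2) (1/2)" "\<phi> q (e q) = L q 0 (1/2) (- 1/2)" for q
    by (simp_all add: L_def half_sum_diff)
  have ab: "- cc q = a1 q + a2 q" "bb q = a1 q - a2 q" if q: "q \<in> V" for q
  proof -
    have "L q 0 (- cc q * (1/2)) (bb q * (1/2)) = a1 q *\<^sub>R e q + a2 q *\<^sub>R \<phi> q (e q)"
      using h q h_L[OF q q ve eL(1)] by metis
    then have "L q 0 (- cc q * (1/2)) (bb q * (1/2)) = L q 0 ((a1 q + a2 q) / 2) ((a1 q - a2 q) / 2)"
      unfolding eL(2)[of q] unfolding eL(1)[of q] by (simp add: L_arith add_divide_distrib diff_divide_distrib)
    then show "- cc q = a1 q + a2 q" "bb q = a1 q - a2 q" unfolding L_eq_iff[OF q] by auto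
  qed
  have bc: "bb p * cc p = 0"
    using harmonic_imp_conditions[OF harm] p unfolding harmonic_conditions_def by blast
  have "\<xi> p a1 = \<xi> p (\<lambda>q. (1/2) * bb q + (- 1/2) * cc q)"
  proof (rule vf_apply_cong[OF vf_xi_S p])
    show "a1 q = (1/2) * bb q + (- 1/2) * cc q" if "q \<in> V" for q using ab[OF that] by linarith
  qed
  also have "\<dots> = (1/2) * \<xi> p bb + (- 1/2) * \<xi> p cc"
    by (rule tangent_lin[OF xi_T]) (use p in simp_all)
  finally have xa: "\<xi> p a1 = (\<xi> p bb - \<xi> p cc) / 2" by simp
  have aL: "app \<phi> e q = L q 0 (1/2) (- 1/2)" for q
    unfolding app_apply by (rule eL(2))
  have "D \<xi> (app \<phi> e) p = L p 0 ((aa p - 1) / 2) ((aa p - 1) / 2)"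
    by (rule trans[OF D_expand[OF p vf_xi_S vf_app[OF ve] aL]];
        simp add: smooth_fun_on_const D_table[OF p] L_arith L_eq_iff[OF p] field_simps)
  then have a3: "g p (D \<xi> (app \<phi> e) p) (e p) = aa p - 1"
    unfolding eL(1)[of p] by (simp add: g_L[OF p] field_simps)
  show ?thesis
  proof (cases "p \<in> h_support A \<phi> \<xi>")
    case False
    \<comment> \<open>Here \<open>a1 p\<close> and \<open>a2 p\<close> are both 0, and either sign
      serves.\<close>
    then have "bb p = 0" "cc p = 0" using h_support_iff[OF p] by auto
    then show ?thesis using ab[OF p] False by auto
  next
    case True
    have k: "\<mu> p * bb p = \<xi> p bb + 2 * bb p - 2 * aa p * bb p"
      "- \<mu> p * cc p = \<xi> p cc + 2 * aa p * cc p - 2 * cc p"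
      using km[OF True] unfolding kappa_mu_iff[OF p] by auto
    consider "bb p \<noteq> 0" "cc p = 0" | "bb p = 0" "cc p \<noteq> 0"
      using bc True unfolding h_support_iff[OF p] by auto
    then show ?thesis
    proof cases
      case 1
      \<comment> \<open>Now h e is a multiple of \<open>v = e - \<phi> e\<close>, that is,
        \<epsilon> = -1.\<close>
      then have a: "a2 p = - a1 p" "a1 p = bb p / 2" using ab[OF p] by auto
      \<comment> \<open>With \<open>cc p = 0\<close> the second equation of \<open>k\<close> forces
        \<open>\<xi> p cc = 0\<close>.\<close>
      have x: "\<xi> p a1 = \<xi> p bb / 2" using xa k(2) 1 by simp
      have "\<mu> p = - (- 1) * (\<xi> p a1 + 2 * (- 1) * a1 p * (aa p - 1)) / a1 p"
        unfolding x a using k(1) 1 by (simp add: field_simps)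
      moreover have "a1 p \<noteq> 0" using a(2) 1 by simp
      ultimately show ?thesis using a(1) unfolding a3 Let_def by (intro bexI[of _ "-1"]) auto
    next
      case 2
      \<comment> \<open>Now h e is a multiple of \<open>u = e + \<phi> e\<close>, that is,
        \<epsilon> = 1.\<close>
      then have a: "a2 p = a1 p" "a1 p = - cc p / 2" using ab[OF p] by auto
      have x: "\<xi> p a1 = - \<xi> p cc / 2" using xa k(1) 2 by simp
      have xc: "\<xi> p cc = 2 * cc p - \<mu> p * cc p - 2 * aa p * cc p" using k(2) by linarith
      have "\<mu> p = - 1 * (\<xi> p a1 + 2 * 1 * a1 p * (aa p - 1)) / a1 p"
        unfolding x a xc using 2 by (simp add: field_simps)
      moreover have "a1 p \<noteq> 0" using a(2) 2 by simp
      ultimately show ?thesis using a(1) unfolding a3 Let_def by (intro bexI[of _ 1]) auto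
    qed
  qed
qed

lemma soliton_pointwise:
  "paracontact_ricci_soliton A \<xi> g D \<longleftrightarrow> (\<exists>k. \<forall>p. \<forall>W X Y. p \<in> W \<longrightarrow> vf W X \<longrightarrow> vf W Y \<longrightarrow>
      lie_metric A \<xi> g X Y p + ricci A g D p (X p) (Y p) = k * g p (X p) (Y p))"
  unfolding paracontact_ricci_soliton_def by blast

end

section \<open>Ricci solitons\<close>

context null_framed
begin

text \<open>By its \<open>(\<xi>, \<xi>)\<close>-component the soliton equation makes \<open>bb * cc\<close> constant, while its \<open>(u, u)\<close>-
  and \<open>(v, v)\<close>-components give \<open>\<xi> (bb * cc) = 4 * bb * cc\<close>.\<close>

lemma soliton_frame:
  assumes "\<forall>p. \<forall>W X Y. p \<in> W \<longrightarrow> vf W X \<longrightarrow> vf W Y \<longrightarrow>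
      lie_metric A \<xi> g X Y p + ricci A g D p (X p) (Y p) = k * g p (X p) (Y p)"
    and p: "p \<in> S"
  shows "bb p * cc p = 0" "k = - 2" "KK p = 2" "v p bb = - 2 * mm p * bb p" "u p cc = 2 * nn p * cc p"
    "\<xi> p bb = 2 * aa p * bb p" "\<xi> p cc = 4 * cc p - 2 * aa p * cc p"
proof -
  have s: "k = - 2 - 2 * bb q * cc q \<and> KK q = - k \<and> v q bb = - 2 * mm q * bb q \<and> u q cc = 2 * nn q * cc q \<and>
    \<xi> q bb = 2 * aa q * bb q \<and> \<xi> q cc = 4 * cc q - 2 * aa q * cc q" if "q \<in> S" for q
    by (rule iffD1[OF soliton_iff[OF that]]) (use assms(1) in blast)
  \<comment> \<open>The constant \<open>k\<close> is the same at all points, so this product can be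
    differentiated along \<xi> to give 0.\<close>
  have "bb q * cc q = - (k + 2) / 2" if "q \<in> S" for q using s[OF that] by simp
  then have "\<xi> p (\<lambda>q. bb q * cc q) = 0" by (rule vf_apply_const[OF vf_xi_S p])
  then have "bb p * \<xi> p cc + cc p * \<xi> p bb = 0"
    using vf_apply_mult[OF vf_xi_S p smooth_structure(2,3)] by simp
  moreover have "\<xi> p bb = 2 * aa p * bb p" "\<xi> p cc = 4 * cc p - 2 * aa p * cc p" using s[OF p] by auto
  ultimately have "4 * (bb p * cc p) = 0" by (simp only:) (simp add: algebra_simps)
  then show bc: "bb p * cc p = 0" by simp
  show "k = - 2" "KK p = 2" "v p bb = - 2 * mm p * bb p" "u p cc = 2 * nn p * cc p"
    "\<xi> p bb = 2 * aa p * bb p" "\<xi> p cc = 4 * cc p - 2 * aa p * cc p"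
    using s[OF p] bc by auto
qed

text \<open>Conversely to \<open>phi_basis_null_framed\<close>, half the sum of the null fields is a
  \<phi>-basis; hypotheses about \<phi>-bases can be applied to it.\<close>

lemma phi_basis_null_frame:
  "phi_basis_on A \<phi> \<xi> g S (\<lambda>q. L q 0 (1/2) (1/2))"
  unfolding phi_basis_on_def
proof (intro conjI ballI)
  show "vf S (\<lambda>q. L q 0 (1/2) (1/2))" by (intro vf_L smooth_fun_on_const open_S)
qed (simp_all add: g_L phi_L)

end

context paracontact_manifold
begin

text \<open>Where h vanishes the Lie derivative of the metric vanishes as well
  (\<open>lie_metric_eq\<close>), so the soliton equation is the Einstein equation.\<close>

lemma einstein_if_soliton_h_zero:
  assumes "paracontact_ricci_soliton A \<xi> g D" "h_support A \<phi> \<xi> = {}"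
  shows "einstein A g D"
proof -
  obtain k where k: "\<forall>p. \<forall>W X Y. p \<in> W \<longrightarrow> vf W X \<longrightarrow> vf W Y \<longrightarrow>
      lie_metric A \<xi> g X Y p + ricci A g D p (X p) (Y p) = k * g p (X p) (Y p)"
    using assms(1) unfolding soliton_pointwise by blast
  have "ricci A g D p x y = k * g p x y" if x: "x \<in> T p" and y: "y \<in> T p" for p x y
  proof -
    obtain S u v where p: "p \<in> S" and "null_framed A D \<phi> \<xi> \<eta> g S u v" by (rule null_framed_at)
    then interpret null_framed A D \<phi> \<xi> \<eta> g S u v by simp
    obtain x0 x1 x2 where x': "x = L p x0 x1 x2" using expansion[OF p x] by blast
    obtain y0 y1 y2 where y': "y = L p y0 y1 y2" using expansion[OF p y] by blast
    have "bb p = 0" "cc p = 0" using h_support_iff[OF p] assms(2) by auto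
    moreover note soliton_frame[OF k p]
    ultimately show ?thesis unfolding x' y' ricci_L[OF p] g_L[OF p] by (simp add: algebra_simps)
  qed
  then show ?thesis unfolding einstein_def by blast
qed

lemma soliton_imp:
  assumes s: "paracontact_ricci_soliton A \<xi> g D"
  shows "\<exists>\<mu>. (\<forall>p. kappa_mu_at A \<phi> \<xi> \<eta> D (\<lambda>_. -1) \<mu> p) \<and>
      kappa_mu_space_on A \<phi> \<xi> \<eta> D (h_support A \<phi> \<xi>) (\<lambda>_. -1) \<mu> \<and>
      (\<forall>V e. phi_basis_on A \<phi> \<xi> g V e \<longrightarrow>
         (\<forall>p \<in> V \<inter> h_support A \<phi> \<xi>. \<exists>\<epsilon>\<in>{1, -1}. \<exists>a1.
            h_tensor A \<phi> \<xi> e p = a1 *\<^sub>R (e p + \<epsilon> *\<^sub>R \<phi> p (e p)) \<and> \<mu> p = - 2 * \<epsilon>))"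
    and "scalar_curvature A g D p = -6"
proof -
  obtain k where k: "\<forall>p. \<forall>W X Y. p \<in> W \<longrightarrow> vf W X \<longrightarrow> vf W Y \<longrightarrow>
      lie_metric A \<xi> g X Y p + ricci A g D p (X p) (Y p) = k * g p (X p) (Y p)"
    using s unfolding soliton_pointwise by blast
  have "infinitesimal_harmonic A g D \<xi>"
    unfolding infinitesimal_harmonic_def
  proof
    fix p
    obtain S u v where p: "p \<in> S" and "null_framed A D \<phi> \<xi> \<eta> g S u v" by (rule null_framed_at)
    then interpret null_framed A D \<phi> \<xi> \<eta> g S u v by simp
    show "metric_trace A g p (\<lambda>x y. lie_connection A \<xi> D (extend_vec A p x) (extend_vec A p y) p) = 0"
      unfolding harmonic_iff[OF p] using soliton_frame[OF k p] by blast
  qed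
  from harmonic_kappa_mu_space[OF this] obtain \<mu>
    where \<mu>: "kappa_mu_space_on A \<phi> \<xi> \<eta> D (h_support A \<phi> \<xi>) (\<lambda>_. -1) \<mu>" ..
  have km: "kappa_mu_at A \<phi> \<xi> \<eta> D (\<lambda>_. -1) \<mu> p" for p
  proof (cases "p \<in> h_support A \<phi> \<xi>")
    case True
    then show ?thesis using \<mu> unfolding kappa_mu_space_on_def by blast
  next
    case False
    obtain S u v where p: "p \<in> S" and "null_framed A D \<phi> \<xi> \<eta> g S u v" by (rule null_framed_at)
    then interpret null_framed A D \<phi> \<xi> \<eta> g S u v by simp
    have "bb p = 0" "cc p = 0" using h_support_iff[OF p] False by auto
    \<comment> \<open>At a zero of h the soliton equations make \<open>\<xi> p bb\<close> and
      \<open>\<xi> p cc\<close> vanish too, even if h is nonzero at nearby points. Harmonicity alone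
      does not give this.\<close>
    then show ?thesis unfolding kappa_mu_iff[OF p] using soliton_frame[OF k p] by simp
  qed
  have "\<exists>\<epsilon>\<in>{1, -1}. \<exists>a1. h_tensor A \<phi> \<xi> e p = a1 *\<^sub>R (e p + \<epsilon> *\<^sub>R \<phi> p (e p)) \<and> \<mu> p = - 2 * \<epsilon>"
    if e: "phi_basis_on A \<phi> \<xi> g V e" and p: "p \<in> V" "p \<in> h_support A \<phi> \<xi>" for V e p
  proof -
    interpret null_framed A D \<phi> \<xi> \<eta> g V "\<lambda>q. e q + \<phi> q (e q)" "\<lambda>q. e q - \<phi> q (e q)"
      by (rule phi_basis_null_framed[OF e])
    have ve: "vf V e" using e by (simp add: phi_basis_on_def)
    have eL: "e p = L p 0 (1/2) (1/2)"
      by (simp add: L_def half_sum_diff(1))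
    have he: "h_tensor A \<phi> \<xi> e p = L p 0 (- cc p * (1/2)) (bb p * (1/2))"
      by (rule h_L[OF p(1) p(1) ve eL])
    \<comment> \<open>Inserting the soliton values of the two derivatives cancels the terms with
      \<open>aa\<close>. Thus \<mu> is 2 where \<open>bb\<close> is nonzero and -2 where
      \<open>cc\<close> is.\<close>
    have m: "\<mu> p * bb p = 2 * bb p" "\<mu> p * cc p = - 2 * cc p"
      using km[of p] unfolding kappa_mu_iff[OF p(1)] using soliton_frame(6,7)[OF k p(1)] by auto
    have bc: "bb p * cc p = 0" by (rule soliton_frame(1)[OF k p(1)])
    consider "bb p \<noteq> 0" "cc p = 0" | "bb p = 0" "cc p \<noteq> 0"
      using bc p(2) unfolding h_support_iff[OF p(1)] by auto
    then show ?thesis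
    proof cases
      case 1
      then have "h_tensor A \<phi> \<xi> e p = (bb p / 2) *\<^sub>R (e p + (- 1) *\<^sub>R \<phi> p (e p))"
        unfolding he by (simp add: L_def)
      moreover have "\<mu> p = - 2 * (- 1)" using m(1) 1 by simp
      ultimately show ?thesis by blast
    next
      case 2
      then have "h_tensor A \<phi> \<xi> e p = (- cc p / 2) *\<^sub>R (e p + 1 *\<^sub>R \<phi> p (e p))"
        unfolding he by (simp add: L_def)
      moreover have "(\<mu> p + 2) * cc p = 0" using m(2) by (simp add: distrib_right)
      then have "\<mu> p = - 2 * 1" using 2 by simp
      ultimately show ?thesis by blast
    qed
  qed
  then show "\<exists>\<mu>. (\<forall>p. kappa_mu_at A \<phi> \<xi> \<eta> D (\<lambda>_. -1) \<mu> p) \<and>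
      kappa_mu_space_on A \<phi> \<xi> \<eta> D (h_support A \<phi> \<xi>) (\<lambda>_. -1) \<mu> \<and>
      (\<forall>V e. phi_basis_on A \<phi> \<xi> g V e \<longrightarrow>
         (\<forall>p \<in> V \<inter> h_support A \<phi> \<xi>. \<exists>\<epsilon>\<in>{1, -1}. \<exists>a1.
            h_tensor A \<phi> \<xi> e p = a1 *\<^sub>R (e p + \<epsilon> *\<^sub>R \<phi> p (e p)) \<and> \<mu> p = - 2 * \<epsilon>))"
    using km \<mu> by (intro exI[of _ \<mu>]) simp
  obtain S u v where p: "p \<in> S" and "null_framed A D \<phi> \<xi> \<eta> g S u v" by (rule null_framed_at)
  then interpret null_framed A D \<phi> \<xi> \<eta> g S u v by simp
  show "scalar_curvature A g D p = -6"
    using scalar_curvature_eq[OF p] soliton_frame[OF k p] by simp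
qed

text \<open>The constant -2 is the value of Ric(\<xi>,\<xi>) when \<open>bb * cc = 0\<close>. The
  second claim excludes Einstein metrics, whose Ricci tensor vanishes on null vectors.\<close>

lemma kappa_mu_imp_soliton_frame:
  assumes km: "kappa_mu_at A \<phi> \<xi> \<eta> D (\<lambda>_. -1) \<mu> p"
    and eps: "\<forall>V e. phi_basis_on A \<phi> \<xi> g V e \<longrightarrow>
         (\<forall>p \<in> V \<inter> h_support A \<phi> \<xi>. \<exists>\<epsilon>\<in>{1, -1}. \<exists>a1.
            h_tensor A \<phi> \<xi> e p = a1 *\<^sub>R (e p + \<epsilon> *\<^sub>R \<phi> p (e p)) \<and> \<mu> p = - 2 * \<epsilon>)"
    and r: "scalar_curvature A g D p = -6"
  shows "\<forall>W X Y. p \<in> W \<longrightarrow> vf W X \<longrightarrow> vf W Y \<longrightarrow>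
      lie_metric A \<xi> g X Y p + ricci A g D p (X p) (Y p) = - 2 * g p (X p) (Y p)"
    and "p \<in> h_support A \<phi> \<xi> \<Longrightarrow> \<exists>x\<in>T p. g p x x = 0 \<and> ricci A g D p x x \<noteq> 0"
proof -
  obtain S u v where p: "p \<in> S" and "null_framed A D \<phi> \<xi> \<eta> g S u v" by (rule null_framed_at)
  then interpret null_framed A D \<phi> \<xi> \<eta> g S u v by simp
  have k: "bb p * cc p = 0" "u p cc = 2 * nn p * cc p" "v p bb = - 2 * mm p * bb p"
      "\<mu> p * bb p = \<xi> p bb + 2 * bb p - 2 * aa p * bb p"
      "- \<mu> p * cc p = \<xi> p cc + 2 * aa p * cc p - 2 * cc p"
    using km unfolding kappa_mu_iff[OF p] by auto
  \<comment> \<open>The hypothesis \<open>eps\<close> speaks about points with h nonzero only;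
    elsewhere \<open>bb\<close> and \<open>cc\<close> are 0 and both equations are trivial.\<close>
  have m: "\<mu> p * bb p = 2 * bb p \<and> \<mu> p * cc p = - 2 * cc p"
  proof (cases "p \<in> h_support A \<phi> \<xi>")
    case False
    then show ?thesis using h_support_iff[OF p] by simp
  next
    case True
    let ?e = "\<lambda>q. L q 0 (1/2) (1/2)"
    have "vf S ?e" using phi_basis_null_frame by (simp add: phi_basis_on_def)
    from h_L[OF p p this refl]
    have he: "h_tensor A \<phi> \<xi> ?e p = L p 0 (- cc p * (1/2)) (bb p * (1/2))" .
    obtain \<epsilon> a1 where \<epsilon>: "\<epsilon> \<in> {1, -1}" "\<mu> p = - 2 * \<epsilon>"
      and h: "h_tensor A \<phi> \<xi> ?e p = a1 *\<^sub>R (?e p + \<epsilon> *\<^sub>R \<phi> p (?e p))"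
      using eps phi_basis_null_frame p True by blast
    have "L p 0 (- cc p * (1/2)) (bb p * (1/2)) = L p 0 (a1 * (1 + \<epsilon>) / 2) (a1 * (1 - \<epsilon>) / 2)"
      using h unfolding he by (simp add: phi_L[OF p] L_arith L_eq_iff[OF p] field_simps)
    \<comment> \<open>For \<epsilon> = 1 this kills \<open>bb\<close>, for \<epsilon> = -1 it kills
      \<open>cc\<close>, and \<mu> = -2\<epsilon> has the right value for the other one.\<close>
    then have "- cc p = a1 * (1 + \<epsilon>)" "bb p = a1 * (1 - \<epsilon>)" unfolding L_eq_iff[OF p] by auto
    then show ?thesis using \<epsilon> by auto
  qed
  have x: "\<xi> p bb = 2 * aa p * bb p" "\<xi> p cc = 4 * cc p - 2 * aa p * cc p" using k(4,5) m by auto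
  have K: "KK p = 2" using r k(1) unfolding scalar_curvature_eq[OF p] by auto
  show "\<forall>W X Y. p \<in> W \<longrightarrow> vf W X \<longrightarrow> vf W Y \<longrightarrow>
      lie_metric A \<xi> g X Y p + ricci A g D p (X p) (Y p) = - 2 * g p (X p) (Y p)"
    by (rule iffD2[OF soliton_iff[OF p]]) (use k x K in simp)
  \<comment> \<open>The null vectors \<open>u p\<close> and \<open>v p\<close> serve as witnesses,
    as one of \<open>bb p\<close>, \<open>cc p\<close> is nonzero.\<close>
  have "g p (L p 0 1 0) (L p 0 1 0) = 0" "g p (L p 0 0 1) (L p 0 0 1) = 0"
    "ricci A g D p (L p 0 1 0) (L p 0 1 0) = 4 * bb p" "ricci A g D p (L p 0 0 1) (L p 0 0 1) = 4 * cc p"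
    unfolding g_L[OF p] ricci_L[OF p] x by (simp_all add: algebra_simps)
  then show "\<exists>x\<in>T p. g p x x = 0 \<and> ricci A g D p x x \<noteq> 0" if "p \<in> h_support A \<phi> \<xi>"
    using that L_T[OF p] unfolding h_support_iff[OF p] by (metis mult_eq_0_iff zero_neq_numeral)
qed

end

text \<open>In part (b) the paraSasakian case is excluded on the right because such manifolds with
  scalar curvature -6 are Einstein. Smoothness of \<mu> is asserted only where h is nonzero, for
  elsewhere the condition does not determine \<mu>.\<close>

theorem theorem3p5:
  fixes A :: "('m::{t2_space,second_countable_topology}, real^3) atlas"
    and \<phi> :: "'m endo" and \<xi> :: "'m vfield" and \<eta> :: "'m oneform"
    and g :: "'m metric" and D :: "'m connection"
  assumes "paracontact_metric_manifold A \<phi> \<xi> \<eta> g"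
    and "levi_civita A g D"
  shows
    "(\<not> para_sasakian A \<phi> \<xi> \<eta> \<and> infinitesimal_harmonic A g D \<xi> \<longrightarrow>
        h_support A \<phi> \<xi> \<noteq> {} \<and>
        (\<exists>\<mu>. kappa_mu_space_on A \<phi> \<xi> \<eta> D (h_support A \<phi> \<xi>) (\<lambda>_. -1) \<mu> \<and>
          (\<forall>V e a1 a2. phi_basis_on A \<phi> \<xi> g V e \<longrightarrow>
             (\<forall>p\<in>V. h_tensor A \<phi> \<xi> e p = a1 p *\<^sub>R e p + a2 p *\<^sub>R \<phi> p (e p)) \<longrightarrow>
             (\<forall>p\<in>V. \<exists>\<epsilon>\<in>{1, -1}. a2 p = \<epsilon> * a1 p \<and>
                (p \<in> h_support A \<phi> \<xi> \<longrightarrow> a1 p \<noteq> 0 \<and>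
                   (let a3 = g p (D \<xi> (app \<phi> e) p) (e p);
                        AA = \<xi> p a1 + 2 * \<epsilon> * a1 p * a3
                    in \<mu> p = - \<epsilon> * AA / a1 p))))))
     \<and>
     (paracontact_ricci_soliton A \<xi> g D \<and> \<not> einstein A g D \<longleftrightarrow>
        \<not> para_sasakian A \<phi> \<xi> \<eta> \<and>
        (\<exists>\<mu>. (\<forall>p. kappa_mu_at A \<phi> \<xi> \<eta> D (\<lambda>_. -1) \<mu> p) \<and>
          kappa_mu_space_on A \<phi> \<xi> \<eta> D (h_support A \<phi> \<xi>) (\<lambda>_. -1) \<mu> \<and>
          (\<forall>V e. phi_basis_on A \<phi> \<xi> g V e \<longrightarrow>
             (\<forall>p \<in> V \<inter> h_support A \<phi> \<xi>. \<exists>\<epsilon>\<in>{1, -1}. \<exists>a1.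
                h_tensor A \<phi> \<xi> e p = a1 *\<^sub>R (e p + \<epsilon> *\<^sub>R \<phi> p (e p)) \<and> \<mu> p = - 2 * \<epsilon>))) \<and>
        (\<forall>p. scalar_curvature A g D p = -6))"
proof -
  have "smooth_atlas A" "affine_connection A D"
    using assms by (simp_all add: paracontact_metric_manifold_def levi_civita_def)
  then interpret paracontact_manifold A D \<phi> \<xi> \<eta> g
    using assms by unfold_locales
  show ?thesis
  proof (intro conjI impI iffI; (elim conjE)?)
    assume "\<not> para_sasakian A \<phi> \<xi> \<eta>"
    then show "h_support A \<phi> \<xi> \<noteq> {}" by (simp add: para_sasakian_iff_h_support)
  next
    assume harm: "infinitesimal_harmonic A g D \<xi>"
    obtain \<mu> where \<mu>: "kappa_mu_space_on A \<phi> \<xi> \<eta> D (h_support A \<phi> \<xi>) (\<lambda>_. -1) \<mu>"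
      using harmonic_kappa_mu_space[OF harm] ..
    then have km: "\<And>p. p \<in> h_support A \<phi> \<xi> \<Longrightarrow> kappa_mu_at A \<phi> \<xi> \<eta> D (\<lambda>_. -1) \<mu> p"
      unfolding kappa_mu_space_on_def by blast
    show "\<exists>\<mu>. kappa_mu_space_on A \<phi> \<xi> \<eta> D (h_support A \<phi> \<xi>) (\<lambda>_. -1) \<mu> \<and>
          (\<forall>V e a1 a2. phi_basis_on A \<phi> \<xi> g V e \<longrightarrow>
             (\<forall>p\<in>V. h_tensor A \<phi> \<xi> e p = a1 p *\<^sub>R e p + a2 p *\<^sub>R \<phi> p (e p)) \<longrightarrow>
             (\<forall>p\<in>V. \<exists>\<epsilon>\<in>{1, -1}. a2 p = \<epsilon> * a1 p \<and>
                (p \<in> h_support A \<phi> \<xi> \<longrightarrow> a1 p \<noteq> 0 \<and>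
                   (let a3 = g p (D \<xi> (app \<phi> e) p) (e p);
                        AA = \<xi> p a1 + 2 * \<epsilon> * a1 p * a3
                    in \<mu> p = - \<epsilon> * AA / a1 p))))"
      by (rule exI[of _ \<mu>], rule conjI[OF \<mu>], intro allI impI ballI)
        (rule phi_basis_formula[OF _ _ harm km])
  next
    assume s: "paracontact_ricci_soliton A \<xi> g D" and "\<not> einstein A g D"
    then show "\<not> para_sasakian A \<phi> \<xi> \<eta>"
      using einstein_if_soliton_h_zero para_sasakian_iff_h_support by blast
    show "\<exists>\<mu>. (\<forall>p. kappa_mu_at A \<phi> \<xi> \<eta> D (\<lambda>_. -1) \<mu> p) \<and>
          kappa_mu_space_on A \<phi> \<xi> \<eta> D (h_support A \<phi> \<xi>) (\<lambda>_. -1) \<mu> \<and>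
          (\<forall>V e. phi_basis_on A \<phi> \<xi> g V e \<longrightarrow>
             (\<forall>p \<in> V \<inter> h_support A \<phi> \<xi>. \<exists>\<epsilon>\<in>{1, -1}. \<exists>a1.
                h_tensor A \<phi> \<xi> e p = a1 *\<^sub>R (e p + \<epsilon> *\<^sub>R \<phi> p (e p)) \<and> \<mu> p = - 2 * \<epsilon>))"
      by (rule soliton_imp(1)[OF s])
    show "\<forall>p. scalar_curvature A g D p = -6"
      using soliton_imp(2)[OF s] by blast
  next
    assume r: "\<forall>p. scalar_curvature A g D p = -6"
      and ex: "\<exists>\<mu>. (\<forall>p. kappa_mu_at A \<phi> \<xi> \<eta> D (\<lambda>_. -1) \<mu> p) \<and>
          kappa_mu_space_on A \<phi> \<xi> \<eta> D (h_support A \<phi> \<xi>) (\<lambda>_. -1) \<mu> \<and>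
          (\<forall>V e. phi_basis_on A \<phi> \<xi> g V e \<longrightarrow>
             (\<forall>p \<in> V \<inter> h_support A \<phi> \<xi>. \<exists>\<epsilon>\<in>{1, -1}. \<exists>a1.
                h_tensor A \<phi> \<xi> e p = a1 *\<^sub>R (e p + \<epsilon> *\<^sub>R \<phi> p (e p)) \<and> \<mu> p = - 2 * \<epsilon>))"
      and n: "\<not> para_sasakian A \<phi> \<xi> \<eta>"
    from ex obtain \<mu> where km: "\<And>p. kappa_mu_at A \<phi> \<xi> \<eta> D (\<lambda>_. -1) \<mu> p"
      and eps: "\<forall>V e. phi_basis_on A \<phi> \<xi> g V e \<longrightarrow>
             (\<forall>p \<in> V \<inter> h_support A \<phi> \<xi>. \<exists>\<epsilon>\<in>{1, -1}. \<exists>a1.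
                h_tensor A \<phi> \<xi> e p = a1 *\<^sub>R (e p + \<epsilon> *\<^sub>R \<phi> p (e p)) \<and> \<mu> p = - 2 * \<epsilon>)"
      by (elim exE conjE) blast
    note sf = kappa_mu_imp_soliton_frame[OF km eps spec[OF r]]
    show "paracontact_ricci_soliton A \<xi> g D"
      \<comment> \<open>One constant for all points: \<open>sf(1)\<close> holds with -2
        everywhere.\<close>
      unfolding soliton_pointwise by (rule exI[of _ "-2"], rule allI, rule sf(1))
    show "\<not> einstein A g D"
    proof
      assume "einstein A g D"
      then obtain c where c: "\<And>p x y. x \<in> T p \<Longrightarrow> y \<in> T p \<Longrightarrow> ricci A g D p x y = c * g p x y"
        unfolding einstein_def by blast
      obtain p where "p \<in> h_support A \<phi> \<xi>" using n para_sasakian_iff_h_support by blast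
      \<comment> \<open>A null vector with nonzero Ricci value contradicts proportionality of the
        Ricci tensor to the metric.\<close>
      from sf(2)[OF this] obtain x where "x \<in> T p" "g p x x = 0" "ricci A g D p x x \<noteq> 0" by blast
      then show False using c by simp
    qed
  qed
qed

end
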